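(* Let $n\ge 2$ and $N=\binom n2$. A real skew-symmetric $n\times n$ matrix $A$ is totally positive if and only if \[ M_{j,k}(A)>0\qquad\text{for all } 1\le j\le k\le n-1 . \] Moreover this test is minimal: $\mathcal{SS}_n^{>0}$ cannot be described as $\{A\in\mathcal{SS}_n : f_1(A)>0,\dots,f_r(A)>0\}$ by regular (polynomial) functions $f_1,\dots,f_r$ with $r<N$, whereas the test above uses exactly $N$ inequalities.
   Context: Fix $n\ge 2$, $N=\binom n2$. $\mathcal{SS}_n$ denotes the space of real skew-symmetric $n\times n$ matrices. Let $E_{a,b}$ be the $2n\times 2n$ matrix unit. For $t\in\mathbb R$ put $x_i(t)=\mathrm{Id}_{2n}+tE_{i,i+1}-tE_{n+i+1,n+i}$ for $1\le i\le n-1$, and $x_n(t)=\mathrm{Id}_{2n}+tE_{n-1,2n}-tE_{n,2n-1}$; these lie in $\mathrm{SO}(2n)$, the special orthogonal group of the symmetric bilinear form $q(x,y)=\sum_{i=1}^n (x_iy_{n+i}+y_ix_{n+i})$ on $\mathbb R^{2n}$. Let $(i_1,\dots,i_N)$ be the sequence obtained by concatenating, for $m=1,2,\dots,\lfloor n/2\rfloor$ in order, the three blocks "$n$", "$n-2,n-3,\dots,2m-1$", "$n-1,n-2,\dots,2m$" (a decreasing run $a,a-1,\dots,b$ is empty if $a<b$); e.g. for $n=4$ it is $4,2,1,3,2,4$ and for $n=5$ it is $5,3,2,1,4,3,2,5,3,4$. For $t=(t_1,\dots,t_N)\in\mathbb R^N$ let $X(t)$ be the $n\times 2n$ matrix formed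 by the first $n$ rows of $x_{i_1}(t_1)x_{i_2}(t_2)\cdots x_{i_N}(t_N)$. Writing $X(t)=[U(t)\mid R(t)]$ with $U(t)$ the left $n\times n$ block (which is upper unitriangular), set $A(t)=U(t)^{-1}R(t)$; then $\mathrm{rowspan}\,X(t)=\mathrm{rowspan}[\mathrm{Id}_n\mid A(t)]$ and $A(t)$ is skew-symmetric with polynomial entries in $t$. A matrix $A\in\mathcal{SS}_n$ is called totally positive if $A=A(t)$ for some $t\in\mathbb R_{>0}^N$ (this is Lusztig total positivity of $\mathrm{rowspan}[\mathrm{Id}_n\mid A]$ in the orthogonal Grassmannian $\mathrm{OGr}(n,2n)$); $\mathcal{SS}_n^{>0}$ is the set of totally positive matrices. For an $n\times n$ matrix $A$ and $1\le j\le k\le n-1$, define \[ M_{j,k}(A)=(-1)^{jk}\det\Big(A_{\{1,\dots,n-k-1\}\cup\{n-k+j,\dots,n\}}^{\{1,\dots,n-j\}}\Big), \] the (signed) determinant of the submatrix of $A$ with rows $\{1,\dots,n-k-1,n-k+j,\dots,n\}$ and columns $\{1,\dots,n-j\}$. *)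

theory Defs
  imports "Jordan_Normal_Form.Matrix" "Jordan_Normal_Form.Determinant"
          "Jordan_Normal_Form.DL_Submatrix" "Jordan_Normal_Form.Gauss_Jordan_Elimination"
begin

(* Conventions: JNF matrices are 0-indexed; the paper's 1-based index a
   corresponds to JNF index a-1. *)

definition unit_E :: "nat \<Rightarrow> nat \<Rightarrow> nat \<Rightarrow> real mat" where
  "unit_E m a b = mat m m (\<lambda>(i,j). if i = a - 1 \<and> j = b - 1 then 1 else 0)"

(* generators x_i(t) in SO(2n) *)
definition xgen :: "nat \<Rightarrow> nat \<Rightarrow> real \<Rightarrow> real mat" where
  "xgen n i t =
     (if i = n then 1\<^sub>m (2*n) + t \<cdot>\<^sub>m unit_E (2*n) (n-1) (2*n) - t \<cdot>\<^sub>m unit_E (2*n) n (2*n-1)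
      else 1\<^sub>m (2*n) + t \<cdot>\<^sub>m unit_E (2*n) i (i+1) - t \<cdot>\<^sub>m unit_E (2*n) (n+i+1) (n+i))"

definition word :: "nat \<Rightarrow> nat list" where
  "word n = concat (map (\<lambda>m. [n] @ rev [2*m-1 ..< n-1] @ rev [2*m ..< n]) [1 ..< n div 2 + 1])"

definition NN :: "nat \<Rightarrow> nat" where
  "NN n = n choose 2"

definition xprod :: "nat \<Rightarrow> (nat \<Rightarrow> real) \<Rightarrow> real mat" where
  "xprod n t = foldr (\<lambda>k M. xgen n (word n ! (k-1)) (t k) * M) [1 ..< NN n + 1] (1\<^sub>m (2*n))"

definition Xmat :: "nat \<Rightarrow> (nat \<Rightarrow> real) \<Rightarrow> real mat" where
  "Xmat n t = mat n (2*n) (\<lambda>(i,j). xprod n t $$ (i,j))"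

definition Umat :: "nat \<Rightarrow> (nat \<Rightarrow> real) \<Rightarrow> real mat" where
  "Umat n t = mat n n (\<lambda>(i,j). Xmat n t $$ (i,j))"

definition Rmat :: "nat \<Rightarrow> (nat \<Rightarrow> real) \<Rightarrow> real mat" where
  "Rmat n t = mat n n (\<lambda>(i,j). Xmat n t $$ (i, n + j))"

definition Amat :: "nat \<Rightarrow> (nat \<Rightarrow> real) \<Rightarrow> real mat" where
  "Amat n t = the (mat_inverse (Umat n t)) * Rmat n t"

definition skew_sym :: "nat \<Rightarrow> real mat set" where
  "skew_sym n = {A. A \<in> carrier_mat n n \<and> transpose_mat A = - A}"

definition totally_positive :: "nat \<Rightarrow> real mat \<Rightarrow> bool" where
  "totally_positive n A \<longleftrightarrow> (\<exists>t. (\<forall>k\<in>{1..NN n}. t k > 0) \<and> A = Amat n t)"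

(* M_{j,k}(A): rows {1..n-k-1} \<union> {n-k+j..n}, columns {1..n-j} (1-based) *)
definition Mjk :: "nat \<Rightarrow> nat \<Rightarrow> nat \<Rightarrow> real mat \<Rightarrow> real" where
  "Mjk n j k A = (-1) ^ (j*k) *
     det (submatrix A ({0 ..< n-k-1} \<union> {n-k+j-1 ..< n}) {0 ..< n-j})"

inductive polyfun :: "nat \<Rightarrow> (real mat \<Rightarrow> real) \<Rightarrow> bool" for n where
  pf_const: "polyfun n (\<lambda>A. c)"
| pf_entry: "i < n \<Longrightarrow> j < n \<Longrightarrow> polyfun n (\<lambda>A. A $$ (i,j))"
| pf_add: "polyfun n f \<Longrightarrow> polyfun n g \<Longrightarrow> polyfun n (\<lambda>A. f A + g A)"
| pf_mult: "polyfun n f \<Longrightarrow> polyfun n g \<Longrightarrow> polyfun n (\<lambda>A. f A * g A)"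

end

theory Submission
  imports Defs "HOL-Computational_Algebra.Polynomial"
begin

text \<open>
  The word for \<open>n + 2\<close> is a first block followed by the word for \<open>n\<close> shifted by two. The first block
  alone produces a skew-symmetric matrix of rank two, and the shifted word acts on the last \<open>n\<close>
  coordinates only, so the matrix \<open>B\<close> of the shifted word is recovered from \<open>A\<close> as the Schur
  complement with respect to the first two rows and columns. Under this recursion
  the minors \<open>M\<^sub>j\<^sub>k(A)\<close> with \<open>k < n\<close> equal \<open>A\<^sub>1\<^sub>2\<^sup>2 M\<^sub>j\<^sub>k(B)\<close>. Let \<open>U\<close> be the unipotent factor of
  \<open>B\<close>; then \<open>U B\<close> vanishes above the antidiagonal, and this makes the remaining minors products of
  \<open>A\<^sub>1\<^sub>2\<close>, a corner minor of \<open>B\<close> and an entry of the rank two matrix. Those entries are monomials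
  in the parameters of the first block and determine them. By induction \<open>t \<mapsto> A(t)\<close> maps the vectors
  with nonzero entries onto the skew-symmetric matrices with nonvanishing minors, and all minors are
  positive precisely when all parameters are.

  For minimality, substitute \<open>t\<^sub>k = s\<^sub>k x\<^sub>k\<close> with signs \<open>s\<^sub>k\<close> and \<open>x\<^sub>1 \<gg> x\<^sub>2 \<gg> \<dots> > 0\<close> small. The sign of a nonzero
  polynomial is then a constant times a character of \<open>{1, -1}\<^sup>N\<close>, and fewer than \<open>N\<close> characters have
  a common nontrivial kernel element, which yields a parameter vector outside the positive orthant on
  which all \<open>f\<^sub>i(A(t))\<close> are positive.
\<close>
section \<open>Determinants of matrices given by functions\<close>

text \<open>The obstacle is that positivity of a product says nothing about its factors. The
  recursion therefore has to offer the factors in an order in which each new minor contains only one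
  unknown factor. The numbers fit: passing from n to n + 2 adds 2n + 1 minors and 2n + 1 parameters.
  Every criterion is stated for a predicate that is either positivity or nonvanishing. Nonvanishing
  makes the recursion invertible, so a matrix with positive minors is first written with nonzero
  parameters, and only then are signs compared. The same comparison shows that nonzero parameters
  with a negative one among them never give a totally positive matrix, which is what the minimality
  argument needs. Multiplication by U is harmless for the remaining minors because their rows form a
  final segment, possibly together with row 0. The zeros of U B above the antidiagonal reproduce
  themselves: the unipotent factor of a block has two superdiagonals, and B is moved by two
  places.\<close>

definition fdet :: "nat \<Rightarrow> (nat \<Rightarrow> nat \<Rightarrow> real) \<Rightarrow> real" where
  "fdet p f = det (mat p p (\<lambda>(a,b). f a b))"

lemma fdet_cong:
  assumes "\<And>a b. a < p \<Longrightarrow> b < p \<Longrightarrow> f a b = g a b"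
  shows "fdet p f = fdet p g"
proof -
  have "mat p p (\<lambda>(a,b). f a b) = mat p p (\<lambda>(a,b). g a b)"
    by (rule eq_matI) (auto simp: assms)
  then show ?thesis by (simp add: fdet_def)
qed

lemma fdet_0 [simp]: "fdet 0 f = 1"
  by (simp add: fdet_def)

lemma fdet_1 [simp]: "fdet (Suc 0) f = f 0 0"
  unfolding fdet_def by (subst det_single) auto

lemma fdet_2 [simp]: "fdet (Suc (Suc 0)) f = f 0 0 * f 1 1 - f 0 1 * f 1 0"
proof -
  let ?M = "mat 2 2 (\<lambda>(a,b). f a b)"
  have d: "det (mat (Suc 0) (Suc 0) g) = g (0, 0)" for g :: "nat \<times> nat \<Rightarrow> real"
    by (subst det_single) auto
  have "det ?M = (\<Sum>j<2. ?M $$ (0,j) * cofactor ?M 0 j)"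
    by (rule laplace_expansion_row) auto
  then show ?thesis
    by (simp add: fdet_def numeral_2_eq_2 cofactor_def d mat_delete_def)
qed

lemma fdet_mult:
  "fdet p (\<lambda>a b. \<Sum>c<p. f a c * g c b) = fdet p f * fdet p g"
proof -
  have "mat p p (\<lambda>(a,b). \<Sum>c<p. f a c * g c b) =
      mat p p (\<lambda>(a,b). f a b) * mat p p (\<lambda>(a,b). g a b)"
    by (rule eq_matI) (auto simp: scalar_prod_def lessThan_atLeast0 intro!: sum.cong)
  then show ?thesis
    unfolding fdet_def by (simp add: det_mult[of _ p])
qed

lemma fdet_unitriangular:
  assumes "\<And>a b. a < p \<Longrightarrow> b < a \<Longrightarrow> f a b = 0" "\<And>a. a < p \<Longrightarrow> f a a = 1"
  shows "fdet p f = 1"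
proof -
  let ?M = "mat p p (\<lambda>(a,b). f a b)"
  have "upper_triangular ?M"
    using assms(1) by (auto simp: upper_triangular_def)
  then have "det ?M = prod_list (diag_mat ?M)"
    by (rule det_upper_triangular[of _ p]) auto
  also have "diag_mat ?M = map (\<lambda>i. 1) [0..<p]"
    using assms(2) by (auto simp: diag_mat_def)
  also have "prod_list \<dots> = 1"
    by (induction p) auto
  finally show ?thesis by (simp add: fdet_def)
qed

lemma fdet_block2:
  assumes "\<And>b. 2 \<le> b \<Longrightarrow> b < p + 2 \<Longrightarrow> f 0 b = 0" "\<And>b. 2 \<le> b \<Longrightarrow> b < p + 2 \<Longrightarrow> f (Suc 0) b = 0"
  shows "fdet (p + 2) f = (f 0 0 * f 1 1 - f 0 1 * f 1 0) * fdet p (\<lambda>a b. f (a+2) (b+2))"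
proof -
  let ?A = "mat 2 2 (\<lambda>(a,b). f a b)" and ?C = "mat p 2 (\<lambda>(a,b). f (a+2) b)"
    and ?D = "mat p p (\<lambda>(a,b). f (a+2) (b+2))"
  have f0: "f a b = 0" if "a < 2" "2 \<le> b" "b < p+2" for a b
    using assms that by (cases a) (auto simp: less_Suc_eq numeral_2_eq_2)
  have "mat (p+2) (p+2) (\<lambda>(a,b). f a b) = four_block_mat ?A (0\<^sub>m 2 p) ?C ?D"
    apply (rule eq_matI)
    subgoal for i j
      using f0[of i j] le_add_diff_inverse2[of 2 i] le_add_diff_inverse2[of 2 j]
      by (auto simp: not_less)
    by auto
  then have "fdet (p+2) f = det (four_block_mat ?A (0\<^sub>m 2 p) ?C ?D)"
    by (simp add: fdet_def)
  also have "\<dots> = det ?A * det ?D"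
    by (rule det_four_block_mat_upper_right_zero[where n = 2 and m = p]) auto
  also have "det ?A = f 0 0 * f 1 1 - f 0 1 * f 1 0"
    using fdet_2[of f] by (simp add: fdet_def numeral_2_eq_2)
  finally show ?thesis by (simp add: fdet_def)
qed

text \<open>The columns \<open>b \<ge> 2\<close> are cleared with the help of the first two, since every row of the
  rank-two part is a combination of \<open>r0\<close> and \<open>r1\<close>.\<close>

lemma fdet_rank_two_perturbation:
  assumes al: "\<alpha> \<noteq> 0" and r: "r0 0 = 0" "r0 1 = \<alpha>" "r1 0 = -\<alpha>" "r1 1 = 0"
    and f: "\<And>a b. a < p + 2 \<Longrightarrow> b < p + 2 \<Longrightarrow>
      f a b = (x a * r1 b - z a * r0 b) / \<alpha> + (if 2 \<le> b then h a (b - 2) else 0)"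
    and h: "\<And>b. b < p \<Longrightarrow> h 0 b = 0" "\<And>b. b < p \<Longrightarrow> h 1 b = 0"
  shows "fdet (p + 2) f = (x 0 * z 1 - z 0 * x 1) * fdet p (\<lambda>a b. h (a + 2) b)"
proof -
  define g where "g = (\<lambda>a b. if b = 0 then - x a else if b = 1 then - z a else h a (b - 2))"
  define T :: "nat \<Rightarrow> nat \<Rightarrow> real" where "T = (\<lambda>c b. if c = 0 then - r1 b / \<alpha> else if c = 1 then r0 b / \<alpha>
      else if c = b then 1 else 0)"
  have fg: "f a b = (\<Sum>c<p+2. g a c * T c b)" if "a < p+2" "b < p+2" for a b
  proof -
    have "(\<Sum>c<p+2. g a c * T c b) = g a 0 * T 0 b + g a 1 * T 1 b + (\<Sum>c<p. g a (c+2) * T (c+2) b)"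
      by (simp add: sum.lessThan_Suc_shift del: sum.lessThan_Suc)
    also have "(\<Sum>c<p. g a (c+2) * T (c+2) b) = (\<Sum>c<p. if c + 2 = b then h a (b-2) else 0)"
      by (rule sum.cong) (auto simp: g_def T_def)
    also have "\<dots> = (if 2 \<le> b then h a (b - 2) else 0)"
    proof (cases "2 \<le> b")
      case True
      have "(\<Sum>c<p. if c + 2 = b then h a (b-2) else 0) = (\<Sum>c<p. if c = b - 2 then h a (b-2) else 0)"
        using True by (intro sum.cong) auto
      also have "\<dots> = h a (b - 2)" using that True by (subst sum.delta) auto
      finally show ?thesis using True by simp
    qed auto
    also have "g a 0 * T 0 b + g a 1 * T 1 b = (x a * r1 b - z a * r0 b) / \<alpha>"
      by (simp add: g_def T_def diff_divide_distrib)
    finally show ?thesis using f[OF that] by simp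
  qed
  have "fdet (p+2) f = fdet (p+2) (\<lambda>a b. \<Sum>c<p+2. g a c * T c b)"
    by (rule fdet_cong) (rule fg)
  also have "\<dots> = fdet (p+2) g * fdet (p+2) T" by (rule fdet_mult)
  \<comment> \<open>The values of \<open>r0\<close> and \<open>r1\<close> on columns 0 and 1 make
    the upper left block of \<open>T\<close> the identity.\<close>
  also have "fdet (p+2) T = 1"
    using al r by (intro fdet_unitriangular) (auto simp: T_def)
  also have "fdet (p+2) g = (g 0 0 * g 1 1 - g 0 1 * g 1 0) * fdet p (\<lambda>a b. g (a+2) (b+2))"
    using h by (intro fdet_block2) (auto simp: g_def)
  also have "fdet p (\<lambda>a b. g (a+2) (b+2)) = fdet p (\<lambda>a b. h (a+2) b)"
    by (rule fdet_cong) (auto simp: g_def)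
  finally show ?thesis by (simp add: g_def)
qed

text \<open>Cauchy-Binet with one surviving term: the selected rows of \<open>k\<close> are
  supported on the selected columns, so the minor of the product is the minor of \<open>A\<close>
  times a unitriangular determinant.\<close>

lemma fdet_row_operations:
  fixes \<sigma> :: "nat \<Rightarrow> nat"
  assumes inj: "inj_on \<sigma> {..<p}" and sub: "\<sigma> ` {..<p} \<subseteq> {..<m}"
    and k0: "\<And>a l. a < p \<Longrightarrow> l < m \<Longrightarrow> l \<notin> \<sigma> ` {..<p} \<Longrightarrow> k (\<sigma> a) l = 0"
    and tri: "\<And>a b. a < p \<Longrightarrow> b < a \<Longrightarrow> k (\<sigma> a) (\<sigma> b) = 0" "\<And>a. a < p \<Longrightarrow> k (\<sigma> a) (\<sigma> a) = 1"
  shows "fdet p (\<lambda>a b. \<Sum>l<m. k (\<sigma> a) l * A l b) = fdet p (\<lambda>a b. A (\<sigma> a) b)"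
proof -
  have "(\<Sum>l<m. k (\<sigma> a) l * A l b) = (\<Sum>c<p. k (\<sigma> a) (\<sigma> c) * A (\<sigma> c) b)" if "a < p" for a b
  proof -
    have "(\<Sum>l<m. k (\<sigma> a) l * A l b) = (\<Sum>l\<in>\<sigma> ` {..<p}. k (\<sigma> a) l * A l b)"
      using sub k0[OF that] by (intro sum.mono_neutral_right) (auto simp: finite_subset)
    also have "\<dots> = (\<Sum>c<p. k (\<sigma> a) (\<sigma> c) * A (\<sigma> c) b)"
      by (simp add: sum.reindex[OF inj])
    finally show ?thesis .
  qed
  then have "fdet p (\<lambda>a b. \<Sum>l<m. k (\<sigma> a) l * A l b) = 
      fdet p (\<lambda>a b. \<Sum>c<p. k (\<sigma> a) (\<sigma> c) * A (\<sigma> c) b)"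
    by (intro fdet_cong)
  also have "\<dots> = fdet p (\<lambda>a b. k (\<sigma> a) (\<sigma> b)) * fdet p (\<lambda>a b. A (\<sigma> a) b)"
    by (rule fdet_mult)
  also have "fdet p (\<lambda>a b. k (\<sigma> a) (\<sigma> b)) = 1"
    using tri by (intro fdet_unitriangular) auto
  finally show ?thesis by simp
qed

text \<open>The row map enumerates what is left after deleting \<open>j\<close> consecutive rows
  from index \<open>n - k - 1\<close> on. In this form minors can be transformed without
  \<open>submatrix\<close> and \<open>pick\<close>.\<close>

definition corner_minor :: "nat \<Rightarrow> nat \<Rightarrow> nat \<Rightarrow> (nat \<Rightarrow> nat \<Rightarrow> real) \<Rightarrow> real" where
  "corner_minor n j k A = fdet (n - j) (\<lambda>a b. A (if a < n - Suc k then a else a + j) b)"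

lemma pick_two_blocks:
  assumes "c + j \<le> n" "a < n - j"
  shows "pick ({0..<c} \<union> {c + j..<n}) a = (if a < c then a else a + j)"
proof -
  let ?I = "{0..<c} \<union> {c + j..<n}" and ?i = "if a < c then a else a + j"
  \<comment> \<open>\<open>pick\<close> returns the element of the set with exactly \<open>a\<close>
    smaller ones, so counting identifies it.\<close>
  have "card {x \<in> ?I. x < ?i} = a"
  proof (cases "a < c")
    case True
    then have "{x \<in> ?I. x < ?i} = {0..<a}" by auto
    then show ?thesis by simp
  next
    case False
    then have "{x \<in> ?I. x < ?i} = {0..<c} \<union> {c+j..<a+j}" using assms by auto
    then show ?thesis using False by (simp add: card_Un_disjoint)
  qed
  moreover have "?i \<in> ?I" using assms by auto
  ultimately show ?thesis using pick_card_in_set[of ?i ?I] by simp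
qed

lemma Mjk_eq:
  assumes A: "A \<in> carrier_mat n n" and jk: "1 \<le> j" "j \<le> k" "k \<le> n - 1"
  shows "Mjk n j k A = (-1) ^ (j*k) * corner_minor n j k (\<lambda>a b. A $$ (a,b))"
proof -
  let ?c = "n - k - 1"
  let ?I = "{0..<?c} \<union> {?c + j..<n}" and ?J = "{0..<n-j}"
  have le: "?c + j \<le> n" using jk by auto
  have I: "n - k + j - 1 = ?c + j" using jk by auto
  have cI: "card {i. i < dim_row A \<and> i \<in> ?I} = n - j"
  proof -
    have "{i. i < dim_row A \<and> i \<in> ?I} = ?I" using A le by auto
    moreover have "card ?I = ?c + (n - (?c + j))" by (subst card_Un_disjoint) auto
    ultimately show ?thesis using le by simp
  qed
  have cJ: "card {i. i < dim_col A \<and> i \<in> ?J} = n - j"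
  proof -
    have "{i. i < dim_col A \<and> i \<in> ?J} = ?J" using A by auto
    then show ?thesis by simp
  qed
  have pJ: "pick ?J b = b" if "b < n - j" for b
    using pick_two_blocks[of "n-j" 0 "n - j" b] that by simp
  have "submatrix A ?I ?J =
      mat (n-j) (n-j) (\<lambda>(a,b). A $$ (if a < n - Suc k then a else a + j, b))"
    unfolding submatrix_def cI cJ
    using pick_two_blocks[OF le] pJ by (intro eq_matI) auto
  then show ?thesis
    unfolding Mjk_def I corner_minor_def fdet_def by simp
qed

section \<open>Corner minors and the Schur complement\<close>

definition signed_minor :: "nat \<Rightarrow> nat \<Rightarrow> nat \<Rightarrow> (nat \<Rightarrow> nat \<Rightarrow> real) \<Rightarrow> real" where
  "signed_minor n j k A = (-1) ^ (j*k) * corner_minor n j k A"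

lemma sum_split_first_two:
  fixes f :: "nat \<Rightarrow> 'a::comm_monoid_add"
  shows "(\<Sum>l<n+2. f l) = f 0 + f 1 + (\<Sum>l<n. f (l+2))"
  by (simp add: sum.lessThan_Suc_shift add.assoc del: sum.lessThan_Suc)

text \<open>The leading 2 by 2 block of a skew matrix is \<alpha> times the standard symplectic
  matrix. With its inverse inserted, the term subtracted in the Schur complement is the minor of
  rows 0, 1 and columns \<open>i\<close>, \<open>j\<close>, divided by \<alpha>. So
  \<open>schur\<close> says that \<open>B\<close> is this complement.\<close>

locale schur_complement =
  fixes n :: nat and A B :: "nat \<Rightarrow> nat \<Rightarrow> real" and \<alpha> :: real
  assumes al: "A 0 1 = \<alpha>" "\<alpha> \<noteq> 0"
    and skew: "\<And>i j. i < n + 2 \<Longrightarrow> j < n + 2 \<Longrightarrow> A i j = - A j i"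
    and schur: "\<And>i j. i < n + 2 \<Longrightarrow> j < n + 2 \<Longrightarrow>
      A i j = (A 0 i * A 1 j - A 1 i * A 0 j) / \<alpha> + (if 2 \<le> i \<and> 2 \<le> j then B (i-2) (j-2) else 0)"
begin

lemma A_top: "A 0 0 = 0" "A 0 (Suc 0) = \<alpha>" "A (Suc 0) 0 = - \<alpha>" "A (Suc 0) (Suc 0) = 0"
  using skew[of 0 0] skew[of 1 1] skew[of 1 0] al by auto

text \<open>For \<open>k < n\<close> the deletion spares rows 0 and 1, which can be used to clear
  everything but the Schur complement. Splitting off two leading rows and columns changes neither
  \<open>j\<close> nor \<open>k\<close>; the prefactor is the determinant of the leading
  block.\<close>

lemma minor_interior:
  assumes "1 \<le> j" "j \<le> k" "k + 1 \<le> n"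
  shows "corner_minor (n+2) j k A = \<alpha>\<^sup>2 * corner_minor n j k B"
proof -
  define \<sigma> where "\<sigma> = (\<lambda>a. if a < n + 2 - Suc k then a else a + j)"
  define p where "p = n - j"
  have p: "n + 2 - j = p + 2" using assms by (auto simp: p_def)
  have s: "\<sigma> 0 = 0" "\<sigma> 1 = 1" using assms by (auto simp: \<sigma>_def)
  have "fdet (p+2) (\<lambda>a b. A (\<sigma> a) b)
     = (A 0 (\<sigma> 0) * A 1 (\<sigma> 1) - A 1 (\<sigma> 0) * A 0 (\<sigma> 1)) *
       fdet p (\<lambda>a b. if 2 \<le> \<sigma> (a+2) then B (\<sigma> (a+2) - 2) b else 0)"
  proof (rule fdet_rank_two_perturbation[where ?r0.0 = "A 0" and ?r1.0 = "A 1" and \<alpha> = \<alpha>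
          and h = "\<lambda>a b. if 2 \<le> \<sigma> a then B (\<sigma> a - 2) b else 0"])
    fix a b assume "a < p + 2" "b < p + 2"
    then have "\<sigma> a < n + 2" "b < n + 2" using assms by (auto simp: \<sigma>_def p_def)
    then show "A (\<sigma> a) b = (A 0 (\<sigma> a) * A 1 b - A 1 (\<sigma> a) * A 0 b) / \<alpha> +
        (if 2 \<le> b then if 2 \<le> \<sigma> a then B (\<sigma> a - 2) (b - 2) else 0 else 0)"
      by (subst schur) auto
  qed (use al A_top s in auto)
  also have "fdet p (\<lambda>a b. if 2 \<le> \<sigma> (a+2) then B (\<sigma> (a+2) - 2) b else 0)
      = fdet p (\<lambda>a b. B (if a < n - Suc k then a else a + j) b)"
    using assms by (intro fdet_cong) (auto simp: \<sigma>_def)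
  finally show ?thesis
    unfolding corner_minor_def p using A_top s
    by (simp add: \<sigma>_def p_def power2_eq_square)
qed

lemma signed_minor_interior:
  assumes "1 \<le> j" "j \<le> k" "k + 1 \<le> n"
  shows "signed_minor (n+2) j k A = \<alpha>\<^sup>2 * signed_minor n j k B"
  using minor_interior[OF assms] by (simp add: signed_minor_def)

end

text \<open>In the application \<open>B\<close> is the totally positive matrix of size \<open>n\<close> and \<open>U\<close> its unipotent factor;
  \<open>y0\<close> and \<open>y1\<close> below are then the first two rows of the rank two matrix of the first block.\<close>

locale schur_reduction = schur_complement +
  fixes U :: "nat \<Rightarrow> nat \<Rightarrow> real"
  assumes U_lower: "\<And>i j. i < n \<Longrightarrow> j < i \<Longrightarrow> U i j = 0"
    and U_diag: "\<And>i. i < n \<Longrightarrow> U i i = 1"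
    and anti: "\<And>i j. i + j + 2 \<le> n \<Longrightarrow> (\<Sum>l<n. U i l * B l j) = 0"
begin

text \<open>The block sum of the 2 by 2 identity and \<open>U\<close>. Multiplying by it from the
  left keeps rows 0 and 1 of \<open>A\<close> and turns \<open>B\<close> into
  \<open>U B\<close>.\<close>

definition K :: "nat \<Rightarrow> nat \<Rightarrow> real" where
  "K i l = (if i < 2 \<or> l < 2 then (if i = l then 1 else 0) else U (i-2) (l-2))"

definition y0 where "y0 i = (\<Sum>l<n+2. K i l * A 0 l)"
definition y1 where "y1 i = (\<Sum>l<n+2. K i l * A 1 l)"
definition R where "R i j = (\<Sum>l<n. U i l * B l j)"

lemma K_lower: "i < n + 2 \<Longrightarrow> j < i \<Longrightarrow> K i j = 0"
  using U_lower[of "i-2" "j-2"] by (auto simp: K_def)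

lemma K_diag: "i < n + 2 \<Longrightarrow> K i i = 1"
  using U_diag[of "i-2"] by (auto simp: K_def)

lemma K_top: "i < 2 \<Longrightarrow> (\<Sum>l<n+2. K i l * f l) = f i"
proof -
  assume "i < 2"
  then have "(\<Sum>l<n+2. K i l * f l) = (\<Sum>l<n+2. if l = i then f l else 0)"
    by (intro sum.cong) (auto simp: K_def)
  then show ?thesis using \<open>i < 2\<close> by (simp add: sum.delta)
qed

lemma y_top: "y0 0 = 0" "y0 (Suc 0) = \<alpha>" "y1 0 = - \<alpha>" "y1 (Suc 0) = 0"
  using K_top[of 0 "A 0"] K_top[of 1 "A 0"] K_top[of 0 "A 1"] K_top[of 1 "A 1"]
  by (auto simp: y0_def y1_def A_top)

lemma y0_last: "y0 (n+1) = A 0 (n+1)"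
proof -
  have "(\<Sum>l<n+2. K (n+1) l * A 0 l) = (\<Sum>l<n+2. if l = n+1 then A 0 l else 0)"
    using K_lower[of "n+1"] K_diag[of "n+1"]
    by (intro sum.cong refl) (auto simp: less_Suc_eq)
  then show ?thesis by (simp add: y0_def sum.delta)
qed

text \<open>Row operations change only the left vectors of the rank two part, so rows 0 and 1 of
  \<open>A\<close> remain as its right vectors, as the perturbation formula requires.\<close>

lemma KA: 
  assumes ij: "i < n + 2" "j < n + 2"
  shows "(\<Sum>l<n+2. K i l * A l j) = (y0 i * A 1 j - y1 i * A 0 j) / \<alpha>
    + (if 2 \<le> j then (if 2 \<le> i then R (i-2) (j-2) else 0) else 0)"
proof -
  have "(\<Sum>l<n+2. K i l * A l j) = (\<Sum>l<n+2. K i l * ((A 0 l * A 1 j - A 1 l * A 0 j) / \<alpha>) +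
      K i l * (if 2 \<le> l \<and> 2 \<le> j then B (l-2) (j-2) else 0))"
  proof (rule sum.cong[OF refl])
    fix l assume "l \<in> {..<n+2}"
    then have "A l j = (A 0 l * A 1 j - A 1 l * A 0 j) / \<alpha> +
        (if 2 \<le> l \<and> 2 \<le> j then B (l-2) (j-2) else 0)"
      using ij by (intro schur) auto
    then show "K i l * A l j = K i l * ((A 0 l * A 1 j - A 1 l * A 0 j) / \<alpha>) +
        K i l * (if 2 \<le> l \<and> 2 \<le> j then B (l-2) (j-2) else 0)"
      by (simp only: distrib_left)
  qed
  also have "\<dots> = (\<Sum>l<n+2. K i l * ((A 0 l * A 1 j - A 1 l * A 0 j) / \<alpha>))
      + (\<Sum>l<n+2. K i l * (if 2 \<le> l \<and> 2 \<le> j then B (l-2) (j-2) else 0))"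
    by (rule sum.distrib)
  also have "(\<Sum>l<n+2. K i l * (if 2 \<le> l \<and> 2 \<le> j then B (l-2) (j-2) else 0))
      = (if 2 \<le> j then (if 2 \<le> i then R (i-2) (j-2) else 0) else 0)"
    unfolding sum_split_first_two by (auto simp: R_def K_def)
  also have "(\<Sum>l<n+2. K i l * ((A 0 l * A 1 j - A 1 l * A 0 j) / \<alpha>))
      = (y0 i * A 1 j - y1 i * A 0 j) / \<alpha>"
    unfolding y0_def y1_def sum_distrib_right sum_subtractf[symmetric] sum_divide_distrib
    by (intro sum.cong) (auto simp: algebra_simps)
  finally show ?thesis .
qed

lemma fdet_R:
  assumes "j \<le> n"
  shows "fdet (n-j) (\<lambda>a b. R (a+j) b) = fdet (n-j) (\<lambda>a b. B (a+j) b)"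
  unfolding R_def
proof (rule fdet_row_operations)
  show "U (a + j) l = 0" if "a < n - j" "l < n" "l \<notin> (\<lambda>a. a + j) ` {..<n - j}" for a l
  proof -
    have "l < j"
    proof (rule ccontr)
      assume "\<not> l < j"
      then have "l = (l - j) + j" "l - j \<in> {..<n-j}" using that by auto
      with that(3) show False by blast
    qed
    then show ?thesis using that by (intro U_lower) auto
  qed
qed (use assms U_lower U_diag in \<open>auto simp: inj_on_def\<close>)

text \<open>The first two of the selected rows contain rows \<open>j - 2\<close> and
  \<open>j - 1\<close> of \<open>R\<close> (zero for a negative index), cut to the first
  \<open>n - j\<close> columns. Their index sums are at most (j - 1) + (n - j - 1) = n - 2, just
  above the antidiagonal, so only the rank two part survives there.\<close>

lemma minor_last:
  assumes "1 \<le> j" "j \<le> n"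
  shows "corner_minor (n+2) j (n+1) A =
    (y0 j * y1 (j+1) - y1 j * y0 (j+1)) * fdet (n-j) (\<lambda>a b. B (a+j) b)"
proof -
  define p where "p = n - j"
  have p: "n + 2 - j = p + 2" using assms by (auto simp: p_def)
  have "corner_minor (n+2) j (n+1) A = fdet (p+2) (\<lambda>a b. A (a+j) b)"
    unfolding corner_minor_def p by simp
  also have "\<dots> = fdet (p+2) (\<lambda>a b. \<Sum>l<n+2. K (a+j) l * A l b)"
  proof (rule fdet_row_operations[symmetric])
    show "K (a + j) l = 0" if "a < p + 2" "l < n + 2" "l \<notin> (\<lambda>a. a + j) ` {..<p + 2}" for a l
    proof -
      have "l < j"
      proof (rule ccontr)
        assume "\<not> l < j"
        then have "l = (l - j) + j" "l - j \<in> {..<p+2}" using that assms by (auto simp: p_def)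
        with that(3) show False by blast
      qed
      then show ?thesis using that assms by (intro K_lower) (auto simp: p_def)
    qed
  qed (use assms K_lower K_diag in \<open>auto simp: inj_on_def p_def\<close>)
  also have "\<dots> = (y0 (0+j) * y1 (1+j) - y1 (0+j) * y0 (1+j)) *
       fdet p (\<lambda>a b. if 2 \<le> a + 2 + j then R (a + 2 + j - 2) b else 0)"
  proof (rule fdet_rank_two_perturbation[where ?r0.0 = "A 0" and ?r1.0 = "A 1" and \<alpha> = \<alpha>
          and h = "\<lambda>a b. if 2 \<le> a + j then R (a + j - 2) b else 0"])
    fix a b assume "a < p + 2" "b < p + 2"
    then show "(\<Sum>l<n + 2. K (a + j) l * A l b) = (y0 (a + j) * A 1 b - y1 (a + j) * A 0 b) / \<alpha> +
        (if 2 \<le> b then if 2 \<le> a + j then R (a + j - 2) (b - 2) else 0 else 0)"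
      using assms by (intro KA) (auto simp: p_def)
  qed (use al A_top assms anti in \<open>auto simp: R_def p_def\<close>)
  also have "fdet p (\<lambda>a b. if 2 \<le> a + 2 + j then R (a + 2 + j - 2) b else 0) = 
      fdet p (\<lambda>a b. B (a+j) b)"
    using fdet_R[of j] assms by (simp add: p_def)
  finally show ?thesis by (simp add: p_def)
qed

text \<open>Compared with \<open>minor_last\<close>, row 0 takes the place of row \<open>j\<close>.
  There \<open>y0\<close> is 0 and \<open>y1\<close> is -\<alpha>, so the 2 by 2 determinant
  collapses to \<alpha> times one entry.\<close>

lemma minor_prelast:
  assumes "1 \<le> j" "j \<le> n"
  shows "corner_minor (n+2) j n A = \<alpha> * y0 (j+1) * fdet (n-j) (\<lambda>a b. B (a+j) b)"
proof -
  define p where "p = n - j"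
  define \<sigma> where "\<sigma> = (\<lambda>a. if a < 1 then 0 else a + j)"
  have p: "n + 2 - j = p + 2" using assms by (auto simp: p_def)
  have s: "\<sigma> 0 = 0" "\<sigma> (Suc 0) = Suc j" "\<sigma> (Suc (Suc a)) = Suc (Suc (a + j))" for a by (auto simp: \<sigma>_def)
  have "corner_minor (n+2) j n A = fdet (p+2) (\<lambda>a b. A (\<sigma> a) b)"
    unfolding corner_minor_def p by (rule fdet_cong) (simp add: \<sigma>_def)
  also have "\<dots> = fdet (p+2) (\<lambda>a b. \<Sum>l<n+2. K (\<sigma> a) l * A l b)"
  proof (rule fdet_row_operations[symmetric])
    show "K (\<sigma> a) l = 0" if "a < p + 2" "l < n + 2" "l \<notin> \<sigma> ` {..<p + 2}" for a l
    proof -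
      have l: "l < j + 1"
      proof (rule ccontr)
        assume "\<not> l < j + 1"
        then have "l = \<sigma> (l - j)" "l - j \<in> {..<p+2}" using that assms by (auto simp: p_def \<sigma>_def)
        with that(3) show False by blast
      qed
      have "0 \<in> \<sigma> ` {..<p + 2}" by (rule image_eqI[of _ _ 0]) (auto simp: \<sigma>_def)
      with that(3) have "l \<noteq> 0" by metis
      with l show ?thesis using that assms by (cases a) (auto simp: p_def \<sigma>_def K_def intro!: U_lower)
    qed
  qed (use assms K_lower K_diag in \<open>auto simp: inj_on_def p_def \<sigma>_def split: if_splits\<close>)
  also have "\<dots> = (y0 (\<sigma> 0) * y1 (\<sigma> 1) - y1 (\<sigma> 0) * y0 (\<sigma> 1)) *
       fdet p (\<lambda>a b. if 2 \<le> \<sigma> (a + 2) then R (\<sigma> (a+2) - 2) b else 0)"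
  proof (rule fdet_rank_two_perturbation[where ?r0.0 = "A 0" and ?r1.0 = "A 1" and \<alpha> = \<alpha>
          and h = "\<lambda>a b. if 2 \<le> \<sigma> a then R (\<sigma> a - 2) b else 0"])
    fix a b assume "a < p + 2" "b < p + 2"
    then show "(\<Sum>l<n + 2. K (\<sigma> a) l * A l b) = (y0 (\<sigma> a) * A 1 b - y1 (\<sigma> a) * A 0 b) / \<alpha> +
        (if 2 \<le> b then if 2 \<le> \<sigma> a then R (\<sigma> a - 2) (b - 2) else 0 else 0)"
      using assms by (intro KA) (auto simp: p_def \<sigma>_def)
  qed (use al A_top assms anti s in \<open>auto simp: R_def p_def\<close>)
  also have "fdet p (\<lambda>a b. if 2 \<le> \<sigma> (a + 2) then R (\<sigma> (a+2) - 2) b else 0) = 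
      fdet p (\<lambda>a b. B (a+j) b)"
    using fdet_R[of j] assms by (simp add: p_def s)
  finally show ?thesis by (simp add: p_def s y_top)
qed

lemma minor_corner: "corner_minor (n+2) (n+1) (n+1) A = - y0 (n+1)"
  unfolding y0_last using skew[of "n+1" 0] by (simp add: corner_minor_def)

text \<open>The signs are distributed so as to absorb the factor (-1)^(jk): in terms of
  \<open>X\<close>, \<open>Y\<close> and \<open>D\<close> the remaining signed minors become
  products without any sign.\<close>

definition X where "X i = (-1) ^ (i+1) * y0 i"
definition Y where "Y j = (y0 j * y1 (j+1) - y1 j * y0 (j+1)) / \<alpha>"
definition D where "D j = (-1) ^ (j*(n+1)) * fdet (n-j) (\<lambda>a b. B (a+j) b)"

lemma signed_minor_last:
  assumes "1 \<le> j" "j \<le> n"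
  shows "signed_minor (n+2) j (n+1) A = \<alpha> * (Y j * D j)"
  using minor_last[OF assms] al by (simp add: signed_minor_def Y_def D_def)

lemma signed_minor_prelast:
  assumes "1 \<le> j" "j \<le> n"
  shows "signed_minor (n+2) j n A = \<alpha> * (X (j+1) * D j)"
  using minor_prelast[OF assms] by (simp add: signed_minor_def X_def D_def power_add)

lemma signed_minor_corner: "signed_minor (n+2) (n+1) (n+1) A = X (n+1)"
  unfolding signed_minor_def minor_corner X_def by (simp add: minus_one_power_iff)

text \<open>The lower left corner determinants of \<open>B\<close> belong to the test for
  \<open>B\<close> itself; the signs agree because \<open>n + 1\<close> and \<open>n - 1\<close>
  have the same parity.\<close>

lemma D_eq:
  assumes "1 \<le> j" "j < n"
  shows "D j = signed_minor n j (n-1) B"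
proof -
  obtain q where n: "n = Suc q" using assms by (cases n) auto
  have "(-1::real) ^ (j*(n+1)) = (-1) ^ (j * (n-1))"
    by (simp add: n power_add)
  then show ?thesis
    unfolding D_def signed_minor_def corner_minor_def by (simp add: n)
qed

lemma D_n: "D n = 1"
  by (simp add: D_def)

lemma X_1: "X 1 = \<alpha>"
  by (simp add: X_def y_top)

text \<open>From \<open>P\<close> of a product one factor is obtained only if \<open>P\<close> is
  known for the other. The corner minor is \<open>X (n+1)\<close> alone; the minor with j = k = n
  then gives \<alpha>, the minors of \<open>B\<close> give all \<open>D j\<close>, and now each
  remaining minor has a single unknown factor.\<close>

lemma minors_iff:
  assumes P: "P = (\<lambda>x. x > 0) \<or> P = (\<lambda>x::real. x \<noteq> 0)"
  shows "(\<forall>j k. 1 \<le> j \<and> j \<le> k \<and> k \<le> n + 2 - 1 \<longrightarrow> P (signed_minor (n+2) j k A)) \<longleftrightarrow>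
    (\<forall>j k. 1 \<le> j \<and> j \<le> k \<and> k \<le> n - 1 \<longrightarrow> P (signed_minor n j k B)) \<and>
    (\<forall>i. 1 \<le> i \<and> i \<le> n + 1 \<longrightarrow> P (X i)) \<and> (\<forall>j. 1 \<le> j \<and> j \<le> n \<longrightarrow> P (Y j))" 
  (is "?L \<longleftrightarrow> ?R1 \<and> ?R2 \<and> ?R3")
proof -
  have P1: "P 1" using P by auto
  have Pm: "P (x * y) \<longleftrightarrow> P y" if "P x" for x y using P that by (auto simp: zero_less_mult_iff)
  have Pa: "P (\<alpha>\<^sup>2 * x) \<longleftrightarrow> P x" for x using P al by (auto simp: zero_less_mult_iff)
  have PD: "P (D j)" if "?R1" "1 \<le> j" "j \<le> n" for j
    using that D_eq[of j] D_n P1 by (cases "j = n") auto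
  show ?thesis
  proof
    assume L: ?L
    have R1: ?R1
    proof (intro allI impI)
      fix j k assume "1 \<le> j \<and> j \<le> k \<and> k \<le> n - 1"
      then have jk: "1 \<le> j" "j \<le> k" "k + 1 \<le> n" by auto
      have "P (signed_minor (n+2) j k A)" using jk by (intro L[rule_format]) auto
      then show "P (signed_minor n j k B)"
        unfolding signed_minor_interior[OF jk] Pa .
    qed
    have "P (signed_minor (n+2) (n+1) (n+1) A)" by (intro L[rule_format]) auto
    then have Xn: "P (X (n+1))" unfolding signed_minor_corner .
    \<comment> \<open>For n = 0 there is no minor with j = k = n, but then the corner minor is
      \<open>X 1\<close>, which is \<alpha>.\<close>
    have Pal: "P \<alpha>"
    proof (cases "n = 0")
      case True
      then show ?thesis using Xn X_1 by simp
    next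
      case False
      then have "P (signed_minor (n+2) n n A)" by (intro L[rule_format]) auto
      then have "P (X (n+1) * \<alpha>)"
        using signed_minor_prelast[of n] False D_n by (simp add: mult.commute)
      then show ?thesis using Pm[OF Xn] by blast
    qed
    have R2: ?R2
    proof (intro allI impI)
      fix i assume i: "1 \<le> i \<and> i \<le> n + 1"
      show "P (X i)"
      proof (cases "i = 1")
        case True
        then show ?thesis using X_1 Pal by simp
      next
        case False
        define j where "j = i - 1"
        have j: "i = j + 1" "1 \<le> j" "j \<le> n" using i False by (auto simp: j_def)
        have "P (signed_minor (n+2) j n A)" using j by (intro L[rule_format]) auto
        then have "P (\<alpha> * (D j * X (j+1)))"
          unfolding signed_minor_prelast[OF j(2,3)] by (simp add: mult.commute)
        then have "P (X (j+1))" using Pm[OF Pal] Pm[OF PD[OF R1 j(2,3)]] by blast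
        then show ?thesis using j by simp
      qed
    qed
    have R3: ?R3
    proof (intro allI impI)
      fix j assume "1 \<le> j \<and> j \<le> n"
      then have j: "1 \<le> j" "j \<le> n" by auto
      have "P (signed_minor (n+2) j (n+1) A)" using j by (intro L[rule_format]) auto
      then have "P (\<alpha> * (D j * Y j))"
        unfolding signed_minor_last[OF j] by (simp add: mult.commute)
      then show "P (Y j)" using Pm[OF Pal] Pm[OF PD[OF R1 j]] by blast
    qed
    show "?R1 \<and> ?R2 \<and> ?R3" using R1 R2 R3 by blast
  next
    assume R: "?R1 \<and> ?R2 \<and> ?R3"
    have "P (X 1)" using R by (elim conjE) (erule allE[of _ 1], simp)
    then have Pal: "P \<alpha>" unfolding X_1 .
    have R1: ?R1 and R2: ?R2 and R3: ?R3 using R by blast+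
    show ?L
    proof (intro allI impI)
      fix j k assume jk: "1 \<le> j \<and> j \<le> k \<and> k \<le> n + 2 - 1"
      then have j: "1 \<le> j" "j \<le> k" by auto
      from jk consider "k + 1 \<le> n" | "k = n" | "k = n + 1" "j \<le> n" | "k = n + 1" "j = n + 1"
        by linarith
      then show "P (signed_minor (n+2) j k A)"
      proof cases
        case 1
        have "P (signed_minor n j k B)" using j 1 by (intro R1[rule_format]) auto
        then show ?thesis unfolding signed_minor_interior[OF j 1] Pa .
      next
        case 2
        have jn: "j \<le> n" using j 2 by simp
        have "P (X (j+1))" using jn by (intro R2[rule_format]) auto
        then show ?thesis
          unfolding 2 signed_minor_prelast[OF j(1) jn] using Pm[OF Pal] Pm PD[OF R1 j(1) jn] by blast
      next
        case 3
        have "P (Y j)" using 3 j by (intro R3[rule_format]) auto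
        then show ?thesis
          unfolding 3 signed_minor_last[OF j(1) 3(2)] using Pm[OF Pal] Pm PD[OF R1 j(1) 3(2)] by blast
      next
        case 4
        have "P (X (n+1))" by (intro R2[rule_format]) auto
        then show ?thesis unfolding 4 signed_minor_corner .
      qed
    qed
  qed
qed

end

section \<open>Block triangular products of the generators\<close>

definition gprod :: "nat \<Rightarrow> (nat \<times> real) list \<Rightarrow> real mat" where
  "gprod n zs = foldr (\<lambda>(i,x) M. xgen n i x * M) zs (1\<^sub>m (2*n))"

text \<open>\<open>W\<close> is the inverse of \<open>U\<close>, so \<open>A = U\<^sup>-\<^sup>1 R\<close> where \<open>R = U A\<close> is the upper right block of \<open>X\<close>.\<close>

definition has_blocks :: "nat \<Rightarrow> real mat \<Rightarrow> real mat \<Rightarrow> real mat \<Rightarrow> real mat \<Rightarrow> bool" where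
  "has_blocks n X U A W \<longleftrightarrow> U \<in> carrier_mat n n \<and> A \<in> carrier_mat n n \<and> W \<in> carrier_mat n n \<and>
     U * W = 1\<^sub>m n \<and> W * U = 1\<^sub>m n \<and> X = four_block_mat U (U * A) (0\<^sub>m n n) (transpose_mat W)"

lemma has_blocks_carrier:
  assumes "has_blocks n X U A W"
  shows "X \<in> carrier_mat (2*n) (2*n)"
  using assms by (auto simp: has_blocks_def mult_2)

lemma has_blocks_one: "has_blocks n (1\<^sub>m (2*n)) (1\<^sub>m n) (0\<^sub>m n n) (1\<^sub>m n)"
  by (auto simp: has_blocks_def mult_2)

text \<open>The new upper right block is \<open>U U' A'\<close> plus \<open>U A\<close> times the
  transpose of \<open>W'\<close>. Cancelling \<open>U U'\<close> leaves an affine action on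
  \<open>A\<close>: congruence by the inverse \<open>W'\<close> of \<open>U'\<close>, followed by
  adding \<open>A'\<close>. Later letters thus act on what earlier letters have produced.\<close>

lemma has_blocks_mult:
  assumes "has_blocks n X U A W" "has_blocks n X' U' A' W'"
  shows "has_blocks n (X * X') (U * U') (A' + W' * A * transpose_mat W') (W' * W)"
proof -
  have c [simp]: "U \<in> carrier_mat n n" "A \<in> carrier_mat n n" "W \<in> carrier_mat n n"
     "U' \<in> carrier_mat n n" "A' \<in> carrier_mat n n" "W' \<in> carrier_mat n n"
    using assms by (auto simp: has_blocks_def)
  have i: "U * W = 1\<^sub>m n" "W * U = 1\<^sub>m n" "U' * W' = 1\<^sub>m n" "W' * U' = 1\<^sub>m n"
    using assms by (auto simp: has_blocks_def)
  have as: "(P * Q) * S = P * (Q * S)" 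
    if "P \<in> carrier_mat n n" "Q \<in> carrier_mat n n" "S \<in> carrier_mat n n" for P Q S :: "real mat"
    using that by (rule assoc_mult_mat)
  have as': "P * (Q * S) = S" if "P * Q = 1\<^sub>m n" 
     "P \<in> carrier_mat n n" "Q \<in> carrier_mat n n" "S \<in> carrier_mat n n" for P Q S :: "real mat"
    using that as[of P Q S] by simp
  have UA: "U * U' * (A' + W' * A * transpose_mat W') = U * (U' * A') + U * A * transpose_mat W'"
  proof -
    have Q: "W' * (A * transpose_mat W') \<in> carrier_mat n n"
      by (rule mult_carrier_mat[OF c(6) mult_carrier_mat[OF c(2)]]) simp
    have "U * U' * (A' + W' * A * transpose_mat W') = U * (U' * (A' + W' * (A * transpose_mat W')))"
      using Q by (simp add: as)
    also have "U' * (A' + W' * (A * transpose_mat W')) = U' * A' + U' * (W' * (A * transpose_mat W'))"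
      by (rule mult_add_distrib_mat[of _ n n _ n]) (auto simp: Q)
    also have "U' * (W' * (A * transpose_mat W')) = A * transpose_mat W'"
      by (rule as') (auto simp: i mult_carrier_mat[OF c(2)])
    also have "U * (U' * A' + A * transpose_mat W') = U * (U' * A') + U * (A * transpose_mat W')"
      by (rule mult_add_distrib_mat[of _ n n _ n]) (auto simp: mult_carrier_mat[OF c(2)] mult_carrier_mat[OF c(4)])
    finally show ?thesis by (simp add: as)
  qed
  have "X * X' = four_block_mat (U * U') (U * (U' * A') + U * A * transpose_mat W') (0\<^sub>m n n)
      (transpose_mat W * transpose_mat W')"
  proof -
    note q = mult_carrier_mat[OF c(1,2)] mult_carrier_mat[OF c(4,5)]
    have "X * X' = four_block_mat (U * U' + U * A * 0\<^sub>m n n) (U * (U' * A') + U * A * transpose_mat W')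
       (0\<^sub>m n n * U' + transpose_mat W * 0\<^sub>m n n) (0\<^sub>m n n * (U' * A') + transpose_mat W * transpose_mat W')"
    proof -
      have t: "transpose_mat W \<in> carrier_mat n n" "transpose_mat W' \<in> carrier_mat n n" by simp_all
      have "X = four_block_mat U (U * A) (0\<^sub>m n n) (transpose_mat W)"
        "X' = four_block_mat U' (U' * A') (0\<^sub>m n n) (transpose_mat W')"
        using assms by (simp_all add: has_blocks_def)
      then show ?thesis
        by (simp only: mult_four_block_mat[OF c(1) q(1) zero_carrier_mat t(1) c(4) q(2) zero_carrier_mat t(2)])
    qed
    then show ?thesis
      using q mult_carrier_mat[OF c(1,4)] mult_carrier_mat[of "transpose_mat W" n n "transpose_mat W'" n]
      by (simp add: right_mult_zero_mat[OF q(1)] left_mult_zero_mat[OF q(2)] left_mult_zero_mat[OF c(4)]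
        right_mult_zero_mat[of "transpose_mat W" n n] right_add_zero_mat[of _ n n] left_add_zero_mat[of _ n n])
  qed
  moreover have "transpose_mat W * transpose_mat W' = transpose_mat (W' * W)"
    by (rule transpose_mult[OF c(6,3), symmetric])
  moreover have inv: "P * Q * (S * T) = 1\<^sub>m n" if "Q * S = 1\<^sub>m n" "P * T = 1\<^sub>m n"
     "P \<in> carrier_mat n n" "Q \<in> carrier_mat n n" "S \<in> carrier_mat n n" "T \<in> carrier_mat n n" for P Q S T :: "real mat"
    using as[OF that(3,4) mult_carrier_mat[OF that(5,6)]] as'[OF that(1,4,5,6)] that(2) by simp
  moreover have "A' + W' * A * transpose_mat W' \<in> carrier_mat n n"
    using mult_carrier_mat[OF mult_carrier_mat[OF c(6,2)], of "transpose_mat W'" n] by simp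
  ultimately show ?thesis
    unfolding has_blocks_def UA using mult_carrier_mat[OF c(1,4)] mult_carrier_mat[OF c(6,3)] c i by (simp only: simp_thms)
qed

section \<open>Skew matrices of rank two\<close>

definition wedge :: "nat \<Rightarrow> real vec \<Rightarrow> real vec \<Rightarrow> real mat" where
  "wedge m x y = mat m m (\<lambda>(i,j). x $ i * y $ j - y $ i * x $ j)"

lemma wedge_carrier [simp]: "wedge m x y \<in> carrier_mat m m"
  "dim_row (wedge m x y) = m" "dim_col (wedge m x y) = m"
  by (auto simp: wedge_def)

text \<open>The two sides may carry different matrices: equal ones give congruences, and the
  identity on the right gives the rank two summand of \<open>U A\<close>.\<close>

lemma mult_wedge_mult:
  assumes [simp]: "B \<in> carrier_mat m m" "C \<in> carrier_mat m m" "x \<in> carrier_vec m" "y \<in> carrier_vec m"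
  shows "B * wedge m x y * transpose_mat C =
    mat m m (\<lambda>(i,j). (B *\<^sub>v x) $ i * (C *\<^sub>v y) $ j - (B *\<^sub>v y) $ i * (C *\<^sub>v x) $ j)"
proof (rule eq_matI)
  have d [simp]: "dim_row B = m" "dim_col B = m" "dim_row C = m" "dim_col C = m" "dim_vec x = m" "dim_vec y = m"
    using carrier_matD[OF assms(1)] carrier_matD[OF assms(2)] carrier_vecD[OF assms(3)] carrier_vecD[OF assms(4)]
    by simp_all
  have 1: "(B * wedge m x y) $$ (i,k) = (B *\<^sub>v x) $ i * y $ k - (B *\<^sub>v y) $ i * x $ k" if "i < m" "k < m" for i k
    using that by (simp add: scalar_prod_def wedge_def sum_distrib_right flip: sum_subtractf)
      (rule sum.cong, auto simp: algebra_simps)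
  fix i j assume ij: "i < dim_row (mat m m (\<lambda>(i,j). (B *\<^sub>v x) $ i * (C *\<^sub>v y) $ j - (B *\<^sub>v y) $ i * (C *\<^sub>v x) $ j))"
    "j < dim_col (mat m m (\<lambda>(i,j). (B *\<^sub>v x) $ i * (C *\<^sub>v y) $ j - (B *\<^sub>v y) $ i * (C *\<^sub>v x) $ j))"
  have 2: "(P * transpose_mat C) $$ (i,j) = (\<Sum>k\<in>{0..<m}. P $$ (i,k) * C $$ (j,k))"
    if "P \<in> carrier_mat m m" for P
    using ij that by (auto simp: scalar_prod_def)
  have "(B * wedge m x y * transpose_mat C) $$ (i,j) =
      (\<Sum>k\<in>{0..<m}. (B * wedge m x y) $$ (i,k) * C $$ (j,k))"
    by (rule 2) (rule mult_carrier_mat[OF assms(1) wedge_carrier(1)])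
  also have "\<dots> = (\<Sum>k\<in>{0..<m}. ((B *\<^sub>v x) $ i * y $ k - (B *\<^sub>v y) $ i * x $ k) * C $$ (j,k))"
    using ij by (intro sum.cong refl) (subst 1, auto)
  also have "\<dots> = (B *\<^sub>v x) $ i * (C *\<^sub>v y) $ j - (B *\<^sub>v y) $ i * (C *\<^sub>v x) $ j"
    using ij by (simp add: scalar_prod_def[of "row C j"] sum_distrib_left flip: sum_subtractf)
      (rule sum.cong, auto simp: algebra_simps)
  finally show "(B * wedge m x y * transpose_mat C) $$ (i,j) = mat m m (\<lambda>(i,j). (B *\<^sub>v x) $ i * (C *\<^sub>v y) $ j - (B *\<^sub>v y) $ i * (C *\<^sub>v x) $ j) $$ (i,j)"
    using ij by simp
qed (simp_all add: carrier_matD[OF assms(1)] carrier_matD[OF assms(2)])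

lemma wedge_congruence:
  assumes "B \<in> carrier_mat m m" "x \<in> carrier_vec m" "y \<in> carrier_vec m"
  shows "B * wedge m x y * transpose_mat B = wedge m (B *\<^sub>v x) (B *\<^sub>v y)"
  using mult_wedge_mult[OF assms(1,1,2,3)] by (simp add: wedge_def)

text \<open>This is 1 + t E_{i,i+1} in the 1-based numbering of the generators, so the entry
  \<open>t\<close> sits at \<open>(i - 1, i)\<close>.\<close>

definition elementary :: "nat \<Rightarrow> nat \<Rightarrow> real \<Rightarrow> real mat" where
  "elementary n i t = mat n n (\<lambda>(r,c). if r = c then 1 else if r + 1 = i \<and> c = i then t else 0)"

lemma elementary_carrier [simp]: "elementary n i t \<in> carrier_mat n n"
  "dim_row (elementary n i t) = n" "dim_col (elementary n i t) = n"
  by (auto simp: elementary_def)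

lemma elementary_mult:
  assumes M: "M \<in> carrier_mat n n" and i: "1 \<le> i" "i < n"
  shows "elementary n i t * M = mat n n (\<lambda>(r,c). M $$ (r,c) + (if r + 1 = i then t * M $$ (i,c) else 0))"
proof (rule eq_matI)
  fix r c assume "r < dim_row (mat n n (\<lambda>(r,c). M $$ (r,c) + (if r + 1 = i then t * M $$ (i,c) else 0)))"
    "c < dim_col (mat n n (\<lambda>(r,c). M $$ (r,c) + (if r + 1 = i then t * M $$ (i,c) else 0)))"
  then have rc: "r < n" "c < n" by auto
  have "(elementary n i t * M) $$ (r,c) = (\<Sum>l\<in>{0..<n}. elementary n i t $$ (r,l) * M $$ (l,c))"
    using rc M by (simp add: scalar_prod_def)
  also have "\<dots> = (\<Sum>l\<in>{0..<n}. (if l = r then M $$ (r,c) else 0) +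
      (if l = i then if r + 1 = i then t * M $$ (i,c) else 0 else 0))"
    using rc by (intro sum.cong) (auto simp: elementary_def)
  also have "\<dots> = M $$ (r,c) + (if r + 1 = i then t * M $$ (i,c) else 0)"
    using rc i by (simp add: sum.distrib sum.delta)
  finally show "(elementary n i t * M) $$ (r,c) = mat n n (\<lambda>(r,c). M $$ (r,c) + (if r + 1 = i then t * M $$ (i,c) else 0)) $$ (r,c)"
    using rc by simp
qed (use M in auto)

lemma elementary_inverse:
  assumes "1 \<le> i" "i < n"
  shows "elementary n i t * elementary n i (- t) = 1\<^sub>m n"
  unfolding elementary_mult[OF elementary_carrier(1) assms]
  by (rule eq_matI) (use assms in \<open>auto simp: elementary_def\<close>)

lemma has_blocks_elem:
  assumes "1 \<le> i" "i < n"
  shows "has_blocks n (xgen n i t) (elementary n i t) (0\<^sub>m n n) (elementary n i (- t))"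
proof -
  have "xgen n i t = four_block_mat (elementary n i t) (0\<^sub>m n n) (0\<^sub>m n n) (transpose_mat (elementary n i (- t)))"
  proof (rule eq_matI)
    fix r c assume "r < dim_row (four_block_mat (elementary n i t) (0\<^sub>m n n) (0\<^sub>m n n) (transpose_mat (elementary n i (- t))))"
      "c < dim_col (four_block_mat (elementary n i t) (0\<^sub>m n n) (0\<^sub>m n n) (transpose_mat (elementary n i (- t))))"
    then have rc: "r < n + n" "c < n + n" by auto
    obtain m where m: "i = Suc m" using assms by (cases i) auto
    have "xgen n i t $$ (r,c) = (if r = c then 1 else 0) + (if r = i - 1 \<and> c = i then t else 0)
        - (if r = n + i \<and> c = n + i - 1 then t else 0)"
      using rc assms by (simp add: xgen_def unit_E_def m)
    also have "\<dots> = four_block_mat (elementary n i t) (0\<^sub>m n n) (0\<^sub>m n n) (transpose_mat (elementary n i (- t))) $$ (r,c)"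
    proof (cases "r < n"; cases "c < n")
      assume "\<not> r < n" "\<not> c < n"
      then have "r = n + (r - n)" "c = n + (c - n)" by auto
      then obtain r' c' where "r = n + r'" "c = n + c'" by blast
      with rc assms show ?thesis by (auto simp: elementary_def)
    qed (use rc assms in \<open>auto simp: elementary_def\<close>)
    finally show "xgen n i t $$ (r,c) = four_block_mat (elementary n i t) (0\<^sub>m n n) (0\<^sub>m n n) (transpose_mat (elementary n i (- t))) $$ (r,c)" .
  qed (use assms in \<open>auto simp: xgen_def unit_E_def\<close>)
  then show ?thesis
    using elementary_inverse[OF assms, of t] elementary_inverse[OF assms, of "-t"] by (simp add: has_blocks_def)
qed

text \<open>The letter \<open>n\<close> is the only source of the matrix \<open>A\<close>, and its
  unipotent part is trivial; the other letters only transform \<open>A\<close> by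
  congruence.\<close>

lemma has_blocks_last:
  assumes "2 \<le> n"
  shows "has_blocks n (xgen n n t) (1\<^sub>m n) (t \<cdot>\<^sub>m wedge n (unit_vec n (n-2)) (unit_vec n (n-1))) (1\<^sub>m n)"
proof -
  have "xgen n n t = four_block_mat (1\<^sub>m n) (t \<cdot>\<^sub>m wedge n (unit_vec n (n-2)) (unit_vec n (n-1))) (0\<^sub>m n n) (1\<^sub>m n)"
    (is "_ = ?F")
  proof (rule eq_matI)
    fix r c assume "r < dim_row ?F" "c < dim_col ?F"
    then have rc: "r < n + n" "c < n + n" by auto
    obtain m where m: "n = Suc (Suc m)" using assms by (metis add_2_eq_Suc le_Suc_ex)
    have "xgen n n t $$ (r,c) = (if r = c then 1 else 0) + (if r = n - 2 \<and> c = n + (n - 1) then t else 0)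
        - (if r = n - 1 \<and> c = n + (n - 2) then t else 0)"
      using rc by (simp add: xgen_def unit_E_def m)
    also have "\<dots> = ?F $$ (r,c)"
    proof (cases "r < n"; cases "c < n")
      assume "r < n" "\<not> c < n"
      then have "c = n + (c - n)" by auto
      then obtain c' where "c = n + c'" by blast
      with \<open>r < n\<close> rc m show ?thesis by (simp add: wedge_def unit_vec_def)
    qed (use rc assms in auto)
    finally show "xgen n n t $$ (r,c) = ?F $$ (r,c)" .
  qed (use assms in \<open>auto simp: xgen_def unit_E_def\<close>)
  then show ?thesis
    by (simp add: has_blocks_def)
qed

definition admissible :: "nat \<Rightarrow> (nat \<times> real) list \<Rightarrow> bool" where
  "admissible n zs \<longleftrightarrow> (\<forall>i\<in>fst ` set zs. 1 \<le> i \<and> i \<le> n \<and> 2 \<le> n)"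

lemma gprod_Nil [simp]: "gprod n [] = 1\<^sub>m (2*n)"
  and gprod_Cons: "gprod n ((i,x) # zs) = xgen n i x * gprod n zs"
  by (simp_all add: gprod_def)

lemma xgen_splits:
  assumes "1 \<le> i" "i \<le> n" "2 \<le> n"
  shows "\<exists>U A W. has_blocks n (xgen n i x) U A W"
  using assms has_blocks_elem[of i n x] has_blocks_last[of n x] by (cases "i = n") fastforce+

lemma gprod_carrier:
  assumes "admissible n zs"
  shows "gprod n zs \<in> carrier_mat (2*n) (2*n)"
  using assms
proof (induction zs)
  case (Cons z zs)
  obtain i x where z: "z = (i,x)" by (cases z)
  have "xgen n i x \<in> carrier_mat (2*n) (2*n)" 
    using xgen_splits[of i n x] has_blocks_carrier Cons.prems by (auto simp: admissible_def z)
  moreover have "gprod n zs \<in> carrier_mat (2*n) (2*n)" using Cons by (auto simp: admissible_def)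
  ultimately show ?case by (simp add: z gprod_Cons)
qed simp

lemma gprod_append:
  assumes "admissible n xs" "admissible n ys"
  shows "gprod n (xs @ ys) = gprod n xs * gprod n ys"
  using assms
proof (induction xs)
  case Nil
  then show ?case using gprod_carrier[of n ys] by simp
next
  case (Cons z xs)
  obtain i x where z: "z = (i,x)" by (cases z)
  have "xgen n i x \<in> carrier_mat (2*n) (2*n)" 
    using xgen_splits[of i n x] has_blocks_carrier Cons.prems by (auto simp: admissible_def z)
  moreover have "gprod n xs \<in> carrier_mat (2*n) (2*n)" "gprod n ys \<in> carrier_mat (2*n) (2*n)"
    using Cons.prems by (auto intro!: gprod_carrier simp: admissible_def)
  moreover have "gprod n (xs @ ys) = gprod n xs * gprod n ys"
    using Cons by (auto simp: admissible_def)
  ultimately show ?case by (simp add: z gprod_Cons)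
qed

definition bidiag :: "nat \<Rightarrow> nat \<Rightarrow> nat \<Rightarrow> (nat \<Rightarrow> real) \<Rightarrow> real mat" where
  "bidiag n a b \<tau> = mat n n (\<lambda>(r,c). if r = c then 1 else if c = r + 1 \<and> a \<le> c \<and> c < b then \<tau> c else 0)"

lemma bidiag_carrier [simp]: "bidiag n a b \<tau> \<in> carrier_mat n n"
  "dim_row (bidiag n a b \<tau>) = n" "dim_col (bidiag n a b \<tau>) = n"
  by (auto simp: bidiag_def)

text \<open>In a decreasing run, row \<open>b\<close> is still a unit row when it is added to row
  \<open>b - 1\<close>. Hence no products of parameters arise, and the superdiagonal consists of the
  parameters themselves.\<close>

lemma has_blocks_bidiag:
  assumes "1 \<le> a" "a \<le> b" "b \<le> n"
  shows "\<exists>W. has_blocks n (gprod n (map (\<lambda>i. (i, \<tau> i)) (rev [a..<b]))) (bidiag n a b \<tau>) (0\<^sub>m n n) W"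
  using assms(2,3)
proof (induction b rule: dec_induct)
  case base
  have "bidiag n a a \<tau> = 1\<^sub>m n" by (rule eq_matI) (auto simp: bidiag_def)
  then show ?case using has_blocks_one[of n] by auto
next
  case (step b)
  then obtain W where W: "has_blocks n (gprod n (map (\<lambda>i. (i, \<tau> i)) (rev [a..<b]))) (bidiag n a b \<tau>) (0\<^sub>m n n) W"
    by auto
  have b: "1 \<le> b" "b < n" using step assms by auto
  have "elementary n b (\<tau> b) * bidiag n a b \<tau> = bidiag n a (Suc b) \<tau>"
    unfolding elementary_mult[OF bidiag_carrier(1) b]
    by (rule eq_matI) (use b step in \<open>auto simp: bidiag_def\<close>)
  moreover have "0\<^sub>m n n + W * 0\<^sub>m n n * transpose_mat W = 0\<^sub>m n n"
    using W by (auto simp: has_blocks_def)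
  ultimately have "has_blocks n (gprod n (map (\<lambda>i. (i, \<tau> i)) (rev [a..<Suc b]))) (bidiag n a (Suc b) \<tau>) (0\<^sub>m n n)
      (W * elementary n b (- \<tau> b))"
    using has_blocks_mult[OF has_blocks_elem[OF b, of "\<tau> b"] W] step by (simp add: gprod_Cons)
  then show ?case by blast
qed

section \<open>The recursion for the word\<close>

text \<open>\<open>U\<close> and \<open>W\<close> are visible as blocks of \<open>X\<close>, and
  \<open>W\<close> cancels \<open>U\<close> in the upper right block. This transfers existence
  statements about a product to block data that are already fixed.\<close>

lemma has_blocks_unique:
  assumes "has_blocks n X U A W" "has_blocks n X U' A' W'"
  shows "U' = U" "A' = A" "W' = W"
proof -
  have c: "U \<in> carrier_mat n n" "A \<in> carrier_mat n n" "W \<in> carrier_mat n n"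
     "U' \<in> carrier_mat n n" "A' \<in> carrier_mat n n" "W' \<in> carrier_mat n n"
     and i: "W * U = 1\<^sub>m n"
     and eq: "four_block_mat U (U * A) (0\<^sub>m n n) (transpose_mat W) =
       four_block_mat U' (U' * A') (0\<^sub>m n n) (transpose_mat W')"
    using assms by (auto simp: has_blocks_def)
  have e: "four_block_mat U (U * A) (0\<^sub>m n n) (transpose_mat W) $$ (i,j) =
       four_block_mat U' (U' * A') (0\<^sub>m n n) (transpose_mat W') $$ (i,j)" for i j
    by (simp only: eq)
  note d = carrier_matD[OF c(1)] carrier_matD[OF c(2)] carrier_matD[OF c(3)]
    carrier_matD[OF c(4)] carrier_matD[OF c(5)] carrier_matD[OF c(6)]
  show U: "U' = U"
  proof (rule eq_matI)
    fix i j assume "i < dim_row U" "j < dim_col U"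
    then show "U' $$ (i,j) = U $$ (i,j)" using e[of i j] by (simp add: d)
  qed (simp_all add: d)
  show "W' = W"
  proof (rule eq_matI)
    fix i j assume "i < dim_row W" "j < dim_col W"
    then show "W' $$ (i,j) = W $$ (i,j)" using e[of "n + j" "n + i"] by (simp add: d)
  qed (simp_all add: d)
  have UA: "U * A' = U * A"
  proof (rule eq_matI)
    fix i j assume "i < dim_row (U * A)" "j < dim_col (U * A)"
    then show "(U * A') $$ (i,j) = (U * A) $$ (i,j)" using e[of i "n + j"] 
      by (simp add: d U del: index_mult_mat(1))
  qed (simp_all add: d)
  have "A' = (W * U) * A'" "A = (W * U) * A" using c i by auto
  then show "A' = A" using c UA by (metis assoc_mult_mat)
qed

lemma has_blocks_Amat:
  assumes "has_blocks n (xprod n t) U A W"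
  shows "Amat n t = A"
proof -
  have c: "U \<in> carrier_mat n n" "A \<in> carrier_mat n n" "W \<in> carrier_mat n n"
     and i: "W * U = 1\<^sub>m n" "U * W = 1\<^sub>m n"
     and X: "xprod n t = four_block_mat U (U * A) (0\<^sub>m n n) (transpose_mat W)"
    using assms by (auto simp: has_blocks_def)
  note d = carrier_matD[OF c(1)] carrier_matD[OF c(2)] carrier_matD[OF c(3)]
  have U: "Umat n t = U"
    by (rule eq_matI) (auto simp: Umat_def Xmat_def X d simp del: index_mult_mat(1))
  have R: "Rmat n t = U * A"
    by (rule eq_matI) (auto simp: Rmat_def Xmat_def X d simp del: index_mult_mat(1))
  have "U \<in> Units (ring_mat TYPE(real) n ())"
    using c i by (auto simp: Units_def ring_mat_def)
  then obtain V where V: "mat_inverse U = Some V"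
    using mat_inverse(1)[OF c(1), where b = "()"] by (cases "mat_inverse U") auto
  then have V': "V * U = 1\<^sub>m n" "V \<in> carrier_mat n n"
    using mat_inverse(2)[OF c(1)] by blast+
  then have "V * (U * A) = A"
    using c by (metis assoc_mult_mat left_mult_one_mat)
  then show ?thesis by (simp add: Amat_def U R V)
qed

text \<open>The block sum of \<open>d\<close> times the 2 by 2 identity and \<open>M\<close>. The
  value \<open>d = 1\<close> serves \<open>U\<close> and \<open>W\<close>, and \<open>d = 0\<close>
  serves \<open>A\<close>.\<close>

definition pad :: "nat \<Rightarrow> real \<Rightarrow> real mat \<Rightarrow> real mat" where
  "pad n d M = mat (n+2) (n+2) (\<lambda>(i,j). if i < 2 \<or> j < 2 then (if i = j then d else 0) else M $$ (i-2,j-2))"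

lemma pad_carrier [simp]: "pad n d M \<in> carrier_mat (n+2) (n+2)" 
  "pad n d M \<in> carrier_mat (Suc (Suc n)) (Suc (Suc n))"
  "dim_row (pad n d M) = n+2" "dim_col (pad n d M) = n+2"
  by (auto simp: pad_def)

lemma pad_mult:
  assumes "M \<in> carrier_mat n n" "N \<in> carrier_mat n n"
  shows "pad n d M * pad n e N = pad n (d*e) (M * N)"
proof (rule eq_matI)
  fix i j assume "i < dim_row (pad n (d*e) (M * N))" "j < dim_col (pad n (d*e) (M * N))"
  then have ij: "i < n + 2" "j < n + 2" by auto
  have "(pad n d M * pad n e N) $$ (i,j) = (\<Sum>l<n+2. pad n d M $$ (i,l) * pad n e N $$ (l,j))"
    using ij by (simp add: scalar_prod_def lessThan_atLeast0)
  also have "\<dots> = pad n (d*e) (M * N) $$ (i,j)"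
  proof (cases "i < 2 \<or> j < 2")
    case True
    then show ?thesis using ij unfolding sum_split_first_two 
      by (auto simp: pad_def less_2_cases_iff)
  next
    case False
    then show ?thesis using ij assms unfolding sum_split_first_two 
      by (auto simp: pad_def scalar_prod_def lessThan_atLeast0 intro!: sum.cong)
  qed
  finally show "(pad n d M * pad n e N) $$ (i,j) = pad n (d*e) (M * N) $$ (i,j)" .
qed auto

lemma pad_transpose:
  assumes "M \<in> carrier_mat n n"
  shows "transpose_mat (pad n d M) = pad n d (transpose_mat M)"
  using assms by (intro eq_matI) (auto simp: pad_def)

lemma pad_add:
  assumes "M \<in> carrier_mat n n" "N \<in> carrier_mat n n"
  shows "pad n d M + pad n e N = pad n (d+e) (M + N)"
  using assms by (intro eq_matI) (auto simp: pad_def)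

lemma pad_one: "pad n 1 (1\<^sub>m n) = 1\<^sub>m (n+2)"
  by (rule eq_matI) (auto simp: pad_def)

lemma pad_zero: "pad n 0 (0\<^sub>m n n) = 0\<^sub>m (n+2) (n+2)"
  by (rule eq_matI) (auto simp: pad_def)

lemma pad_elem:
  assumes "1 \<le> i" "i < n"
  shows "pad n 1 (elementary n i t) = elementary (n+2) (i+2) t"
  using assms by (intro eq_matI) (auto simp: pad_def elementary_def)

lemma pad_wedge:
  assumes "2 \<le> n"
  shows "pad n 0 (t \<cdot>\<^sub>m wedge n (unit_vec n (n-2)) (unit_vec n (n-1))) =
    t \<cdot>\<^sub>m wedge (n+2) (unit_vec (n+2) (n+2-2)) (unit_vec (n+2) (n+2-1))"
proof -
  obtain m where m: "n = Suc (Suc m)" using assms by (metis add_2_eq_Suc le_Suc_ex)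
  show ?thesis 
    by (intro eq_matI) (auto simp: pad_def wedge_def unit_vec_def m)
qed

definition shift_word :: "(nat \<times> real) list \<Rightarrow> (nat \<times> real) list" where
  "shift_word zs = map (\<lambda>(i,x). (i+2,x)) zs"

text \<open>Both kinds of generators are compatible with the shift: E_{i,i+1} moves two places down
  the diagonal, and the last letter involves only the last two coordinates. The data of both sizes
  are built side by side, so that every step pads the same three matrices.\<close>

lemma has_blocks_shift_aux:
  assumes "admissible n zs"
  shows "\<exists>U A W. has_blocks n (gprod n zs) U A W \<and>
    has_blocks (n+2) (gprod (n+2) (shift_word zs)) (pad n 1 U) (pad n 0 A) (pad n 1 W)"
  using assms
proof (induction zs)
  case Nil
  have "has_blocks (n+2) (gprod (n+2) (shift_word [])) (pad n 1 (1\<^sub>m n)) (pad n 0 (0\<^sub>m n n)) (pad n 1 (1\<^sub>m n))"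
    using has_blocks_one[of "n+2"] by (simp add: shift_word_def pad_one pad_zero)
  then show ?case using has_blocks_one[of n] by auto
next
  case (Cons z zs)
  obtain i x where z: "z = (i,x)" by (cases z)
  have i: "1 \<le> i" "i \<le> n" "2 \<le> n" using Cons.prems by (auto simp: admissible_def z)
  have "admissible n zs" using Cons.prems by (auto simp: admissible_def)
  then obtain U A W where 1: "has_blocks n (gprod n zs) U A W"
      "has_blocks (n+2) (gprod (n+2) (shift_word zs)) (pad n 1 U) (pad n 0 A) (pad n 1 W)"
    using Cons.IH by blast
  obtain U1 A1 W1 where 2: "has_blocks n (xgen n i x) U1 A1 W1"
      "has_blocks (n+2) (xgen (n+2) (i+2) x) (pad n 1 U1) (pad n 0 A1) (pad n 1 W1)"
  proof (cases "i = n")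
    case True
    have "has_blocks n (xgen n i x) (1\<^sub>m n) (x \<cdot>\<^sub>m wedge n (unit_vec n (n-2)) (unit_vec n (n-1))) (1\<^sub>m n)"
      using has_blocks_last[OF i(3), of x] by (simp only: True)
    then show ?thesis
      using that has_blocks_last[of "n+2" x] unfolding True by (metis pad_one pad_wedge[OF i(3)] le_add2)
  next
    case False
    then have "i < n" using i by auto
    then show ?thesis 
      using that[OF has_blocks_elem[of i n x]] has_blocks_elem[of "i+2" "n+2" x] i
      by (simp add: pad_elem pad_zero)
  qed
  have c: "U \<in> carrier_mat n n" "A \<in> carrier_mat n n" "W \<in> carrier_mat n n"
     "U1 \<in> carrier_mat n n" "A1 \<in> carrier_mat n n" "W1 \<in> carrier_mat n n"
    using 1 2 by (auto simp: has_blocks_def)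
  have cs: "W * A1 \<in> carrier_mat n n" "W * A1 * transpose_mat W \<in> carrier_mat n n"
    using mult_carrier_mat[OF c(3,5)] mult_carrier_mat[OF mult_carrier_mat[OF c(3,5)], of "transpose_mat W"] c by auto
  have "has_blocks n (gprod n (z # zs)) (U1 * U) (A + W * A1 * transpose_mat W) (W * W1)"
    using has_blocks_mult[OF 2(1) 1(1)] by (simp add: gprod_Cons z)
  moreover have "has_blocks (n+2) (gprod (n+2) (shift_word (z # zs))) (pad n 1 (U1 * U)) 
      (pad n 0 (A + W * A1 * transpose_mat W)) (pad n 1 (W * W1))"
    using has_blocks_mult[OF 2(2) 1(2)] c cs 
    by (simp add: gprod_Cons z shift_word_def pad_mult pad_add pad_transpose)
  ultimately show ?case by blast
qed

lemma has_blocks_shift: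
  assumes "admissible n zs" "has_blocks n (gprod n zs) U A W"
  shows "has_blocks (n+2) (gprod (n+2) (shift_word zs)) (pad n 1 U) (pad n 0 A) (pad n 1 W)"
  using has_blocks_shift_aux[OF assms(1)] has_blocks_unique[OF assms(2)] by metis

lemma upt_shift2: "[a+2..<b+2] = map (\<lambda>i. i+2) [a..<b]"
  by (rule nth_equalityI) (auto simp del: upt_Suc)

text \<open>Every bound of block \<open>m + 1\<close> for \<open>n + 2\<close> exceeds the
  corresponding bound of block \<open>m\<close> for \<open>n\<close> by two, so only block 1 is
  new.\<close>

lemma word_rec:
  "word (n+2) = (n+2) # rev [1..<n+1] @ rev [2..<n+2] @ map (\<lambda>i. i+2) (word n)"
proof -
  define blk where "blk = (\<lambda>n m. [n] @ rev [2*m-1 ..< n-1] @ rev [2*m ..< n])"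
  have w: "word n = concat (map (blk n) [1..<n div 2 + 1])" for n
    by (simp add: word_def blk_def)
  have "[1..<(n+2) div 2 + 1] = 1 # map Suc [1..<n div 2 + 1]"
    by (simp add: map_Suc_upt upt_conv_Cons del: upt_Suc)
  then have "word (n+2) = blk (n+2) 1 @ concat (map (blk (n+2) \<circ> Suc) [1..<n div 2 + 1])"
    unfolding w by simp
  also have "map (blk (n+2) \<circ> Suc) [1..<n div 2 + 1] = map (map (\<lambda>i. i+2) \<circ> blk n) [1..<n div 2 + 1]"
  proof (rule map_cong[OF refl])
    fix m assume "m \<in> set [1..<n div 2 + 1]"
    then have m: "1 \<le> m" "2 \<le> n" by auto
    have "[2*Suc m - 1 ..< n+2-1] = [(2*m-1)+2..<(n-1)+2]" using m by (intro arg_cong2[of _ _ _ _ upt]) auto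
    then have 1: "[2*Suc m - 1 ..< n+2-1] = map (\<lambda>i. i+2) [2*m-1..<n-1]" by (simp only: upt_shift2)
    have 2: "[2*Suc m ..< n+2] = map (\<lambda>i. i+2) [2*m..<n]" using upt_shift2[of "2*m" n] by simp
    show "(blk (n+2) \<circ> Suc) m = (map (\<lambda>i. i+2) \<circ> blk n) m"
      unfolding comp_def blk_def 1 2 by (simp add: rev_map)
  qed
  also have "concat \<dots> = map (\<lambda>i. i+2) (word n)"
    unfolding w by (simp add: map_concat)
  also have "blk (n+2) 1 = (n+2) # rev [1..<n+1] @ rev [2..<n+2]"
    by (simp add: blk_def)
  finally show ?thesis by simp
qed

lemma word_0 [simp]: "word 0 = []" "word (Suc 0) = []"
  by (simp_all add: word_def)

lemma NN_rec: "NN (n+2) = NN n + 2 * n + 1"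
  by (simp add: NN_def choose_two numeral_2_eq_2)

lemma length_word: "length (word n) = NN n"
proof (induction n rule: nat_induct2)
  case (step n)
  then show ?case unfolding word_rec NN_rec by auto
qed (simp_all add: NN_def)

lemma word_letters: "i \<in> set (word n) \<Longrightarrow> 1 \<le> i \<and> i \<le> n \<and> 2 \<le> n"
proof (induction n arbitrary: i rule: nat_induct2)
  case (step n)
  then show ?case unfolding word_rec by fastforce
qed simp_all

lemma admissible_word: "map fst zs = word n \<Longrightarrow> admissible n zs"
  using word_letters by (metis admissible_def list.set_map)

lemma xprod_eq: "xprod n t = gprod n (map (\<lambda>k. (word n ! (k-1), t k)) [1..<NN n + 1])"
  by (simp add: xprod_def gprod_def foldr_map comp_def case_prod_beta)

lemma map_fst_word: "map fst (map (\<lambda>k. (word n ! (k-1), t k)) [1..<NN n + 1]) = word n"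
  by (rule nth_equalityI) (auto simp: length_word simp del: upt_Suc)

section \<open>The first block of the word\<close>

lemma bidiag_vec:
  assumes "i < n" "v \<in> carrier_vec n"
  shows "(bidiag n a b \<tau> *\<^sub>v v) $ i =
    v $ i + (if a \<le> i + 1 \<and> i + 1 < b \<and> i + 1 < n then \<tau> (i+1) * v $ (i+1) else 0)"
proof -
  have "(bidiag n a b \<tau> *\<^sub>v v) $ i = (\<Sum>l<n. bidiag n a b \<tau> $$ (i,l) * v $ l)"
    using assms by (auto simp: scalar_prod_def lessThan_atLeast0)
  also have "\<dots> = (\<Sum>l<n. (if l = i then v $ i else 0) +
      (if l = i + 1 then if a \<le> i + 1 \<and> i + 1 < b then \<tau> (i+1) * v $ (i+1) else 0 else 0))"
    using assms by (intro sum.cong) (auto simp: bidiag_def)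
  also have "\<dots> = v $ i + (if a \<le> i + 1 \<and> i + 1 < b \<and> i + 1 < n then \<tau> (i+1) * v $ (i+1) else 0)"
    using assms by (simp add: sum.distrib sum.delta)
  finally show ?thesis .
qed

definition block_mat where
  "block_mat n \<tau> s = bidiag (n+2) 1 (n+1) \<tau> * bidiag (n+2) 2 (n+2) s"

definition block_word where
  "block_word n c \<tau> s = (n+2, c) # map (\<lambda>i. (i, \<tau> i)) (rev [1..<n+1]) @ map (\<lambda>i. (i, s i)) (rev [2..<n+2])"

lemma block_mat_carrier: "block_mat n \<tau> s \<in> carrier_mat (n+2) (n+2)"
  unfolding block_mat_def by (rule mult_carrier_mat[OF bidiag_carrier(1) bidiag_carrier(1)])

text \<open>The letter \<open>n + 2\<close> stands leftmost, so its wedge undergoes the congruence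
  by the inverse \<open>W\<close> of everything to its right; its two unit vectors become columns
  \<open>n\<close> and \<open>n + 1\<close> of \<open>W\<close>.\<close>

lemma has_blocks_block:
  "\<exists>W. has_blocks (n+2) (gprod (n+2) (block_word n c \<tau> s)) (block_mat n \<tau> s)
     (c \<cdot>\<^sub>m wedge (n+2) (W *\<^sub>v unit_vec (n+2) n) (W *\<^sub>v unit_vec (n+2) (n+1))) W"
proof -
  let ?m = "n+2"
  let ?z1 = "map (\<lambda>i. (i, \<tau> i)) (rev [1..<n+1])" and ?z2 = "map (\<lambda>i. (i, s i)) (rev [2..<n+2])"
  obtain W1 where W1: "has_blocks ?m (gprod ?m ?z1) (bidiag ?m 1 (n+1) \<tau>) (0\<^sub>m ?m ?m) W1"
    using has_blocks_bidiag[of 1 "n+1" ?m \<tau>] by auto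
  obtain W2 where W2: "has_blocks ?m (gprod ?m ?z2) (bidiag ?m 2 (n+2) s) (0\<^sub>m ?m ?m) W2"
    using has_blocks_bidiag[of 2 "n+2" ?m s] by auto
  have v: "admissible ?m ?z1" "admissible ?m ?z2" by (auto simp: admissible_def)
  define W where "W = W2 * W1"
  have c2: "W2 \<in> carrier_mat ?m ?m" "W1 \<in> carrier_mat ?m ?m" using W1 W2 by (auto simp: has_blocks_def)
  have c: "W \<in> carrier_mat ?m ?m" unfolding W_def by (rule mult_carrier_mat[OF c2])
  have z: "0\<^sub>m ?m ?m + V * 0\<^sub>m ?m ?m * transpose_mat V = 0\<^sub>m ?m ?m" if "V \<in> carrier_mat ?m ?m" for V :: "real mat"
    using that by simp
  have 1: "has_blocks ?m (gprod ?m (?z1 @ ?z2)) (block_mat n \<tau> s) (0\<^sub>m ?m ?m) W"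
    unfolding gprod_append[OF v] block_mat_def W_def
    using has_blocks_mult[OF W1 W2] unfolding z[OF c2(1)] .
  let ?E = "wedge ?m (unit_vec ?m n) (unit_vec ?m (n+1))"
  have 2: "has_blocks ?m (xgen ?m ?m c) (1\<^sub>m ?m) (c \<cdot>\<^sub>m ?E) (1\<^sub>m ?m)"
    using has_blocks_last[of ?m c] by simp
  have "has_blocks ?m (xgen ?m ?m c * gprod ?m (?z1 @ ?z2)) (1\<^sub>m ?m * block_mat n \<tau> s)
     (0\<^sub>m ?m ?m + W * (c \<cdot>\<^sub>m ?E) * transpose_mat W) (W * 1\<^sub>m ?m)"
    by (rule has_blocks_mult[OF 2 1])
  moreover have "W * (c \<cdot>\<^sub>m ?E) * transpose_mat W = c \<cdot>\<^sub>m (W * ?E * transpose_mat W)"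
    using c mult_carrier_mat[OF c, of ?E ?m] by (simp add: mult_smult_distrib[of _ ?m ?m _ ?m] mult_smult_assoc_mat[of _ ?m ?m _ ?m])
  moreover have "W * ?E * transpose_mat W = wedge ?m (W *\<^sub>v unit_vec ?m n) (W *\<^sub>v unit_vec ?m (n+1))"
    by (rule wedge_congruence) (use c in auto)
  moreover have "gprod ?m (block_word n c \<tau> s) = xgen ?m ?m c * gprod ?m (?z1 @ ?z2)"
    by (simp add: block_word_def gprod_Cons)
  ultimately show ?thesis
    using c left_mult_one_mat[OF block_mat_carrier] by (intro exI[of _ W]) simp
qed

text \<open>The recursions express that \<open>block_mat n \<tau> s\<close> maps \<open>p\<close> and \<open>q\<close> to the unit vectors \<open>n\<close> and \<open>n + 1\<close>;
  \<open>v\<close> is the image of \<open>p\<close> under the right bidiagonal factor.\<close>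

definition block_vectors where
  "block_vectors n \<tau> s p q v \<longleftrightarrow>
     v n = 1 \<and> (\<forall>i<n. v i = - \<tau> (i+1) * v (i+1)) \<and>
     p 0 = v 0 \<and> p (n+1) = 0 \<and> (\<forall>i. 1 \<le> i \<and> i \<le> n \<longrightarrow> p i + s (i+1) * p (i+1) = v i) \<and>
     q 0 = 0 \<and> q (n+1) = 1 \<and> (\<forall>i. 1 \<le> i \<and> i \<le> n \<longrightarrow> q i = - s (i+1) * (q (i+1) :: real))"

lemma block_mat_vec:
  assumes "x \<in> carrier_vec (n+2)"
  shows "block_mat n \<tau> s *\<^sub>v x = bidiag (n+2) 1 (n+1) \<tau> *\<^sub>v (bidiag (n+2) 2 (n+2) s *\<^sub>v x)"
  unfolding block_mat_def by (rule assoc_mult_mat_vec[OF bidiag_carrier(1) bidiag_carrier(1) assms])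

lemma block_vectorsI:
  assumes p: "p \<in> carrier_vec (n+2)" "block_mat n \<tau> s *\<^sub>v p = unit_vec (n+2) n"
    and q: "q \<in> carrier_vec (n+2)" "block_mat n \<tau> s *\<^sub>v q = unit_vec (n+2) (n+1)"
  shows "\<exists>v. block_vectors n \<tau> s (\<lambda>i. p $ i) (\<lambda>i. q $ i) v"
proof -
  let ?m = "n+2"
  define v where "v = bidiag ?m 2 (n+2) s *\<^sub>v p"
  define u where "u = bidiag ?m 2 (n+2) s *\<^sub>v q"
  have vc: "v \<in> carrier_vec ?m" "u \<in> carrier_vec ?m"
    unfolding v_def u_def
    by (rule mult_mat_vec_carrier[OF bidiag_carrier(1) p(1)], rule mult_mat_vec_carrier[OF bidiag_carrier(1) q(1)])
  have vp: "v $ i = p $ i + (if 2 \<le> i + 1 \<and> i + 1 < n + 2 then s (i+1) * p $ (i+1) else 0)" if "i < ?m" for i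
    using bidiag_vec[OF that p(1), of 2 "n+2" s] by (simp add: v_def)
  have uq: "u $ i = q $ i + (if 2 \<le> i + 1 \<and> i + 1 < n + 2 then s (i+1) * q $ (i+1) else 0)" if "i < ?m" for i
    using bidiag_vec[OF that q(1), of 2 "n+2" s] by (simp add: u_def)
  have "bidiag ?m 1 (n+1) \<tau> *\<^sub>v v = unit_vec ?m n" "bidiag ?m 1 (n+1) \<tau> *\<^sub>v u = unit_vec ?m (n+1)"
    using p(2) q(2) unfolding v_def u_def block_mat_vec[OF p(1)] block_mat_vec[OF q(1)] by simp_all
  then have v: "v $ i + (if 1 \<le> i + 1 \<and> i + 1 < n + 1 \<and> i + 1 < ?m then \<tau> (i+1) * v $ (i+1) else 0) = 
      (if i = n then 1 else 0)" 
    and u: "u $ i + (if 1 \<le> i + 1 \<and> i + 1 < n + 1 \<and> i + 1 < ?m then \<tau> (i+1) * u $ (i+1) else 0) = 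
      (if i = n + 1 then 1 else 0)" if "i < ?m" for i
    using that bidiag_vec[OF that vc(1), of 1 "n+1" \<tau>] bidiag_vec[OF that vc(2), of 1 "n+1" \<tau>]
    by (auto simp: unit_vec_def)
  \<comment> \<open>The left factor has no off-diagonal entry in column \<open>n + 1\<close>, so the
    image \<open>u\<close> of \<open>q\<close> under the right factor is already the unit vector;
    its other entries vanish by descending induction.\<close>
  have u0: "u $ i = 0" if "i \<le> n" for i
    using that
  proof (induction i rule: inc_induct)
    case base
    show ?case using u[of n] by simp
  next
    case (step i)
    then show ?case using u[of i] by auto
  qed
  have vn: "v $ (n+1) = 0" "v $ n = 1" using v[of "n+1"] v[of n] by auto
  have "block_vectors n \<tau> s (\<lambda>i. p $ i) (\<lambda>i. q $ i) (\<lambda>i. v $ i)"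
    unfolding block_vectors_def
  proof (intro conjI allI impI)
    fix i assume "i < n"
    then show "v $ i = - \<tau> (i+1) * v $ (i+1)" using v[of i] by auto
  next
    fix i assume "1 \<le> i \<and> i \<le> n"
    then show "p $ i + s (i+1) * p $ (i+1) = v $ i" using vp[of i] by auto
  next
    fix i assume "1 \<le> i \<and> i \<le> n"
    then show "q $ i = - s (i+1) * q $ (i+1)" using uq[of i] u0[of i] by auto
  qed (use vn vp[of 0] vp[of "n+1"] uq[of 0] uq[of "n+1"] u0[of 0] u[of "n+1"] in auto)
  then show ?thesis by blast
qed

lemma block_vectorsD:
  assumes "block_vectors n \<tau> s p q v"
  shows "block_mat n \<tau> s *\<^sub>v vec (n+2) p = unit_vec (n+2) n"
    and "block_mat n \<tau> s *\<^sub>v vec (n+2) q = unit_vec (n+2) (n+1)"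
proof -
  let ?m = "n+2"
  have r: "v n = 1" "\<And>i. i < n \<Longrightarrow> v i = - \<tau> (i+1) * v (i+1)" "p 0 = v 0" "p (n+1) = 0"
    "\<And>i. 1 \<le> i \<Longrightarrow> i \<le> n \<Longrightarrow> p i + s (i+1) * p (i+1) = v i"
    "q 0 = 0" "q (n+1) = 1" "\<And>i. 1 \<le> i \<Longrightarrow> i \<le> n \<Longrightarrow> q i = - s (i+1) * q (i+1)"
    using assms by (auto simp: block_vectors_def)
  have 1: "bidiag ?m 2 (n+2) s *\<^sub>v vec ?m p = vec ?m (\<lambda>i. if i \<le> n then v i else 0)"
  proof (rule eq_vecI)
    fix i assume "i < dim_vec (vec ?m (\<lambda>i. if i \<le> n then v i else 0))"
    then have i: "i < ?m" by simp
    have "i = 0 \<or> (1 \<le> i \<and> i \<le> n) \<or> i = n + 1" using i by auto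
    then show "(bidiag ?m 2 (n+2) s *\<^sub>v vec ?m p) $ i = vec ?m (\<lambda>i. if i \<le> n then v i else 0) $ i"
      using bidiag_vec[OF i, of "vec ?m p" 2 "n+2" s] r i by (elim disjE) simp_all
  qed simp
  have 2: "bidiag ?m 2 (n+2) s *\<^sub>v vec ?m q = unit_vec ?m (n+1)"
  proof (rule eq_vecI)
    fix i assume "i < dim_vec (unit_vec ?m (n+1))"
    then have i: "i < ?m" by simp
    have "i = 0 \<or> (1 \<le> i \<and> i \<le> n) \<or> i = n + 1" using i by auto
    then show "(bidiag ?m 2 (n+2) s *\<^sub>v vec ?m q) $ i = unit_vec ?m (n+1) $ i"
      using bidiag_vec[OF i, of "vec ?m q" 2 "n+2" s] r(6,7) r(8)[of i] i by (elim disjE) (simp_all add: unit_vec_def)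
  qed simp
  have 3: "bidiag ?m 1 (n+1) \<tau> *\<^sub>v vec ?m (\<lambda>i. if i \<le> n then v i else 0) = unit_vec ?m n"
  proof (rule eq_vecI)
    fix i assume "i < dim_vec (unit_vec ?m n)"
    then have i: "i < ?m" by simp
    have "i < n \<or> i = n \<or> i = n + 1" using i by auto
    then show "(bidiag ?m 1 (n+1) \<tau> *\<^sub>v vec ?m (\<lambda>i. if i \<le> n then v i else 0)) $ i = unit_vec ?m n $ i"
      using bidiag_vec[OF i, of "vec ?m (\<lambda>i. if i \<le> n then v i else 0)" 1 "n+1" \<tau>] r(1) r(2)[of i] i
      by (elim disjE) (simp_all add: unit_vec_def)
  qed simp
  have 4: "bidiag ?m 1 (n+1) \<tau> *\<^sub>v unit_vec ?m (n+1) = unit_vec ?m (n+1)"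
  proof (rule eq_vecI)
    fix i assume "i < dim_vec (unit_vec ?m (n+1))"
    then have i: "i < ?m" by simp
    then show "(bidiag ?m 1 (n+1) \<tau> *\<^sub>v unit_vec ?m (n+1)) $ i = unit_vec ?m (n+1) $ i"
      using bidiag_vec[OF i, of "unit_vec ?m (n+1)" 1 "n+1" \<tau>] by (simp add: unit_vec_def)
  qed simp
  show "block_mat n \<tau> s *\<^sub>v vec (n+2) p = unit_vec (n+2) n"
    "block_mat n \<tau> s *\<^sub>v vec (n+2) q = unit_vec (n+2) (n+1)"
    by (simp_all only: block_mat_vec[OF vec_carrier] 1 2 3 4)
qed

text \<open>Up to sign, \<open>v i\<close> is the product of the \<tau> with indices i + 1 to n, and
  for i \<ge> 1 \<open>q i\<close> is the product of the \<open>s\<close> with indices i + 1 to n +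
  1. Conversely the listed quantities give \<open>c\<close>, then \<open>w 0\<close>, then all
  \<open>y i\<close>, then all \<open>w j\<close>; quotients of neighbours are the
  parameters.\<close>

lemma block_vectors_sign:
  assumes bv: "block_vectors n \<tau> s p q v" and P: "P = (\<lambda>x. x > 0) \<or> P = (\<lambda>x::real. x \<noteq> 0)"
  shows "(\<forall>i. 1 \<le> i \<and> i \<le> n + 1 \<longrightarrow> P ((-1) ^ (i+1) * (c * v 0 * q i))) \<and>
    (\<forall>j. 1 \<le> j \<and> j \<le> n \<longrightarrow> P (c * q (j+1) * v j)) \<longleftrightarrow>
    P c \<and> (\<forall>i. 1 \<le> i \<and> i < n + 1 \<longrightarrow> P (\<tau> i)) \<and> (\<forall>i. 2 \<le> i \<and> i < n + 2 \<longrightarrow> P (s i))"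
    (is "?X \<and> ?Y \<longleftrightarrow> P c \<and> ?T \<and> ?S")
proof -
  have r: "v n = 1" "\<And>i. i < n \<Longrightarrow> v i = - \<tau> (i+1) * v (i+1)"
    "q (n+1) = 1" "\<And>i. 1 \<le> i \<Longrightarrow> i \<le> n \<Longrightarrow> q i = - s (i+1) * q (i+1)"
    using bv by (auto simp: block_vectors_def)
  define w where "w i = (-1) ^ (n+i) * v i" for i
  define y where "y i = (-1) ^ (n+1+i) * q i" for i
  have w: "w n = 1" "\<And>i. i < n \<Longrightarrow> w i = \<tau> (i+1) * w (i+1)"
    using r by (auto simp: w_def minus_one_power_iff)
  have y: "y (n+1) = 1" "\<And>i. 1 \<le> i \<Longrightarrow> i \<le> n \<Longrightarrow> y i = s (i+1) * y (i+1)"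
    using r(3) r(4) by (auto simp: y_def minus_one_power_iff)
  have Xe: "(-1) ^ (i+1) * (c * v 0 * q i) = w 0 * y i * c" for i
    by (simp add: w_def y_def minus_one_power_iff)
  have Ye: "c * q (j+1) * v j = y (j+1) * w j * c" for j
    by (simp add: w_def y_def minus_one_power_iff)
  have P1: "P 1" using P by auto
  have Pm: "P (x * z) \<longleftrightarrow> P z" if "P x" for x z using P that by (auto simp: zero_less_mult_iff)
  have Pw: "P (w i)" if "?T" "i \<le> n" for i
    using that(2)
  proof (induction i rule: inc_induct)
    case (step i)
    have "P (\<tau> (i+1))" using step by (intro that(1)[rule_format]) auto
    then show ?case using step w(2)[of i] Pm by simp
  qed (simp add: w P1)
  have Py: "P (y i)" if "?S" "1 \<le> i" "i \<le> n+1" for i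
    using that(3,2)
  proof (induction i rule: inc_induct)
    case (step i)
    have "P (s (i+1))" using step by (intro that(1)[rule_format]) auto
    then show ?case using step y(2)[of i] Pm by simp
  qed (use y P1 in simp)
  show ?thesis
    unfolding Xe Ye
  proof
    assume "(\<forall>i. 1 \<le> i \<and> i \<le> n + 1 \<longrightarrow> P (w 0 * y i * c)) \<and> (\<forall>j. 1 \<le> j \<and> j \<le> n \<longrightarrow> P (y (j+1) * w j * c))"
    then have X: "\<And>i. 1 \<le> i \<Longrightarrow> i \<le> n + 1 \<Longrightarrow> P (w 0 * y i * c)" 
      and Y: "\<And>j. 1 \<le> j \<Longrightarrow> j \<le> n \<Longrightarrow> P (y (j+1) * w j * c)" by blast+
    \<comment> \<open>At j = n both monomials are 1. For n = 0 there is no such j, and i = 1 gives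
      \<open>c\<close> instead.\<close>
    have c: "P c" 
    proof (cases "n = 0")
      case True
      then show ?thesis using X[of "n+1"] y(1) w(1) by simp
    next
      case False
      then show ?thesis using Y[of n] y(1) w(1) by simp
    qed
    have w0: "P (w 0)" using X[of "n+1"] y(1) Pm[OF c, of "w 0"] by (simp add: mult.commute)
    have yP: "P (y i)" if "1 \<le> i" "i \<le> n+1" for i
    proof -
      have "P (c * (w 0 * y i))" using X[OF that] by (simp add: mult_ac)
      then show ?thesis using Pm[OF c] Pm[OF w0] by blast
    qed
    have wP: "P (w j)" if "j \<le> n" for j
    proof (cases "j = 0")
      case False
      have "P (c * (y (j+1) * w j))" using Y[of j] that False by (simp add: mult_ac)
      then show ?thesis using Pm[OF c] Pm[OF yP[of "j+1"]] that by auto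
    qed (simp add: w0)
    have ?T
    proof (intro allI impI)
      fix i assume i: "1 \<le> i \<and> i < n + 1"
      have "P (w i * \<tau> i)" using w(2)[of "i-1"] wP[of "i-1"] i by (cases i) (simp_all add: mult.commute)
      then show "P (\<tau> i)" using Pm[OF wP[of i]] i by auto
    qed
    moreover have ?S
    proof (intro allI impI)
      fix i assume i: "2 \<le> i \<and> i < n + 2"
      have "P (y i * s i)" using y(2)[of "i-1"] yP[of "i-1"] i by (cases i) (simp_all add: mult.commute)
      then show "P (s i)" using Pm[OF yP[of i]] i by auto
    qed
    ultimately show "P c \<and> ?T \<and> ?S" using c by blast
  next
    assume a: "P c \<and> ?T \<and> ?S"
    then have c: "P c" and T: ?T and S: ?S by blast+
    show "(\<forall>i. 1 \<le> i \<and> i \<le> n + 1 \<longrightarrow> P (w 0 * y i * c)) \<and> (\<forall>j. 1 \<le> j \<and> j \<le> n \<longrightarrow> P (y (j+1) * w j * c))"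
    proof (intro conjI allI impI)
      fix i assume "1 \<le> i \<and> i \<le> n + 1"
      then show "P (w 0 * y i * c)"
        using Pm[of "w 0" "y i * c"] Pm[of "y i" c] Pw[OF T, of 0] Py[OF S, of i] c by (simp add: mult.assoc)
    next
      fix j assume "1 \<le> j \<and> j \<le> n"
      then show "P (y (j+1) * w j * c)"
        using Pm[of "y (j+1)" "w j * c"] Pm[of "w j" c] Pw[OF T, of j] Py[OF S, of "j+1"] c by (simp add: mult.assoc)
    qed
  qed
qed

section \<open>Factorization\<close>

definition skew :: "nat \<Rightarrow> real mat \<Rightarrow> bool" where
  "skew n A \<longleftrightarrow> A \<in> carrier_mat n n \<and> (\<forall>i<n. \<forall>j<n. A $$ (i,j) = - A $$ (j,i))"

definition unitri :: "nat \<Rightarrow> real mat \<Rightarrow> bool" where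
  "unitri n U \<longleftrightarrow> (\<forall>i<n. (\<forall>j<i. U $$ (i,j) = 0) \<and> U $$ (i,i) = 1)"

text \<open>With indices from 0 the antidiagonal is i + j = n - 1; the zeros lie strictly above
  it.\<close>

definition antitri :: "nat \<Rightarrow> real mat \<Rightarrow> bool" where
  "antitri n R \<longleftrightarrow> (\<forall>i j. i + j + 2 \<le> n \<longrightarrow> R $$ (i,j) = 0)"

definition minors_all :: "(real \<Rightarrow> bool) \<Rightarrow> nat \<Rightarrow> real mat \<Rightarrow> bool" where
  "minors_all P n A \<longleftrightarrow> (\<forall>j k. 1 \<le> j \<and> j \<le> k \<and> k \<le> n - 1 \<longrightarrow> P (signed_minor n j k (\<lambda>a b. A $$ (a,b))))"

lemma mult_entry:
  assumes "M \<in> carrier_mat n n" "N \<in> carrier_mat n n" "i < n" "j < n"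
  shows "(M * N) $$ (i,j) = (\<Sum>l<n. M $$ (i,l) * N $$ (l,j))"
  using assms by (auto simp: scalar_prod_def lessThan_atLeast0)

lemma unitri_mult:
  assumes c: "U \<in> carrier_mat n n" "V \<in> carrier_mat n n" and "unitri n U" "unitri n V"
  shows "unitri n (U * V)"
proof -
  have e: "(U * V) $$ (i,j) = (if i = j then 1 else 0)" if ij: "i < n" "j \<le> i" for i j
  proof -
    have "(U * V) $$ (i,j) = (\<Sum>l<n. U $$ (i,l) * V $$ (l,j))"
      using ij by (intro mult_entry[OF c]) auto
    also have "\<dots> = (\<Sum>l<n. if l = i then if i = j then 1 else 0 else 0)"
    proof (rule sum.cong[OF refl])
      fix l assume "l \<in> {..<n}"
      then show "U $$ (i,l) * V $$ (l,j) = (if l = i then if i = j then 1 else 0 else 0)"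
        using assms(3,4) ij unfolding unitri_def by (cases l i rule: linorder_cases) auto
    qed
    also have "\<dots> = (if i = j then 1 else 0)" using ij by (simp add: sum.delta)
    finally show ?thesis .
  qed
  show ?thesis unfolding unitri_def using e by auto
qed

lemma unitri_bidiag: "unitri n (bidiag n a b \<tau>)"
  by (auto simp: unitri_def bidiag_def)

lemma unitri_emb: "unitri n U \<Longrightarrow> unitri (n+2) (pad n 1 U)"
  by (auto simp: unitri_def pad_def)

lemma unitri_block: "unitri (n+2) (block_mat n \<tau> s)"
  unfolding block_mat_def by (intro unitri_mult unitri_bidiag bidiag_carrier)

text \<open>Each bidiagonal factor moves the index by at most one. The resulting width two matches
  the shift by two in the recursion.\<close>

lemma block_mat_band:
  assumes "i < n + 2" "l < n + 2" "l < i \<or> i + 2 < l"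
  shows "block_mat n \<tau> s $$ (i,l) = 0"
proof -
  have "block_mat n \<tau> s $$ (i,l) =
      (\<Sum>k<n+2. bidiag (n+2) 1 (n+1) \<tau> $$ (i,k) * bidiag (n+2) 2 (n+2) s $$ (k,l))"
    unfolding block_mat_def using assms by (intro mult_entry) auto
  also have "\<dots> = 0"
    using assms by (intro sum.neutral) (auto simp: bidiag_def)
  finally show ?thesis .
qed

lemma pad_vec_top:
  assumes "x \<in> carrier_vec (n+2)" "i < 2"
  shows "(pad n 1 M *\<^sub>v x) $ i = x $ i"
proof -
  have "(pad n 1 M *\<^sub>v x) $ i = (\<Sum>l<n+2. pad n 1 M $$ (i,l) * x $ l)"
    using assms by (auto simp: scalar_prod_def lessThan_atLeast0)
  also have "\<dots> = (\<Sum>l<n+2. if l = i then x $ i else 0)"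
    using assms by (intro sum.cong) (auto simp: pad_def)
  finally show ?thesis using assms by (simp add: sum.delta)
qed

lemma smult_wedge_congruence:
  assumes "B \<in> carrier_mat m m" "x \<in> carrier_vec m" "y \<in> carrier_vec m"
  shows "B * (c \<cdot>\<^sub>m wedge m x y) * transpose_mat B = c \<cdot>\<^sub>m wedge m (B *\<^sub>v x) (B *\<^sub>v y)"
proof -
  have "B * (c \<cdot>\<^sub>m wedge m x y) * transpose_mat B = c \<cdot>\<^sub>m (B * wedge m x y * transpose_mat B)"
    using mult_carrier_mat[OF assms(1) wedge_carrier(1)[of m x y]] assms(1)
    by (simp add: mult_smult_distrib[of _ m m _ m] mult_smult_assoc_mat[of _ m m _ m])
  then show ?thesis by (simp only: wedge_congruence[OF assms])
qed

lemma admissible_block_word: "admissible (n+2) (block_word n c \<tau> s)"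
  by (auto simp: admissible_def block_word_def)

lemma admissible_shift_word: "admissible n zs \<Longrightarrow> admissible (n+2) (shift_word zs)"
  by (auto simp: admissible_def shift_word_def)

lemma has_blocks_compose:
  assumes v: "admissible n zs" and z: "has_blocks n (gprod n zs) U A W"
    and b: "has_blocks (n+2) (gprod (n+2) (block_word n c \<tau> s)) (block_mat n \<tau> s) (c \<cdot>\<^sub>m wedge (n+2) p q) V"
    and pq: "p \<in> carrier_vec (n+2)" "q \<in> carrier_vec (n+2)"
  shows "has_blocks (n+2) (gprod (n+2) (block_word n c \<tau> s @ shift_word zs)) (block_mat n \<tau> s * pad n 1 U)
    (pad n 0 A + c \<cdot>\<^sub>m wedge (n+2) (pad n 1 W *\<^sub>v p) (pad n 1 W *\<^sub>v q)) (pad n 1 W * V)"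
  unfolding gprod_append[OF admissible_block_word admissible_shift_word[OF v]]
    smult_wedge_congruence[OF pad_carrier(1) pq, symmetric]
  by (rule has_blocks_mult[OF b has_blocks_shift[OF v z]])

lemma word_decompose:
  assumes "map fst zs = word (n+2)"
  obtains c \<tau> s zs' where "zs = block_word n c \<tau> s @ shift_word zs'" "map fst zs' = word n"
proof -
  \<comment> \<open>The letters of a decreasing run are distinct, so a parameter list over it is a
    function of the letter.\<close>
  have m: "a = map (\<lambda>i. (i, the (map_of a i))) (map fst a)" if "distinct (map fst a)" for a :: "(nat \<times> real) list"
  proof -
    have "map (\<lambda>i. (i, the (map_of a i))) (map fst a) = map (\<lambda>x. x) a"
      unfolding map_map comp_def
    proof (rule map_cong[OF refl])
      fix x assume "x \<in> set a"
      then have "map_of a (fst x) = Some (snd x)" using that by (simp add: map_of_is_SomeI)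
      then show "(fst x, the (map_of a (fst x))) = x" by simp
    qed
    then show ?thesis by simp
  qed
  obtain z r where r: "zs = z # r" "fst z = n+2"
      "map fst r = rev [1..<n+1] @ rev [2..<n+2] @ map (\<lambda>i. i+2) (word n)"
    using assms unfolding word_rec by (cases zs) auto
  obtain a r2 where a: "r = a @ r2" "map fst a = rev [1..<n+1]"
      "map fst r2 = rev [2..<n+2] @ map (\<lambda>i. i+2) (word n)"
    using map_eq_append_conv[THEN iffD1, OF r(3)] by metis
  obtain b d where b: "r2 = b @ d" "map fst b = rev [2..<n+2]" "map fst d = map (\<lambda>i. i+2) (word n)"
    using map_eq_append_conv[THEN iffD1, OF a(3)] by metis
  have zs: "zs = z # a @ b @ d" by (simp add: r a b)
  note f = r(2) a(2) b(2,3)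
  define \<tau> where "\<tau> i = the (map_of a i)" for i
  define s where "s i = the (map_of b i)" for i
  define zs' where "zs' = map (\<lambda>(i,x). (i-2,x)) d"
  have a: "a = map (\<lambda>i. (i, \<tau> i)) (rev [1..<n+1])" 
    using m[of a] unfolding f(2) \<tau>_def by (simp del: upt_Suc)
  have b: "b = map (\<lambda>i. (i, s i)) (rev [2..<n+2])" 
    using m[of b] unfolding f(3) s_def by (simp del: upt_Suc)
  have ge: "2 \<le> fst x" if "x \<in> set d" for x
  proof -
    have "fst x \<in> set (map fst d)" using that by simp
    then show ?thesis unfolding f(4) by auto
  qed
  have "shift_word zs' = map (\<lambda>x. x) d"
    unfolding shift_word_def zs'_def map_map comp_def
  proof (rule map_cong[OF refl])
    fix x assume "x \<in> set d"
    then have "2 \<le> fst x" by (rule ge)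
    then show "(case case x of (i, x) \<Rightarrow> (i - 2, x) of (i, x) \<Rightarrow> (i + 2, x)) = x"
      by (simp add: case_prod_beta prod_eq_iff)
  qed
  then have 1: "d = shift_word zs'" by simp
  have "map fst zs' = map (\<lambda>i. i - 2) (map fst d)"
    by (simp add: zs'_def comp_def case_prod_beta)
  also have "\<dots> = word n" unfolding f(4) by (simp add: comp_def)
  finally have 2: "map fst zs' = word n" .
  have "z = (n+2, snd z)" using f(1) by (cases z) auto
  then have "zs = block_word n (snd z) \<tau> s @ shift_word zs'"
    unfolding zs block_word_def using a b 1 by simp
  then show ?thesis using that 2 by blast
qed

lemma block_word_all:
  "(\<forall>z\<in>set (block_word n c \<tau> s @ shift_word zs). P (snd z)) \<longleftrightarrow>
    P c \<and> (\<forall>i. 1 \<le> i \<and> i < n + 1 \<longrightarrow> P (\<tau> i)) \<and> (\<forall>i. 2 \<le> i \<and> i < n + 2 \<longrightarrow> P (s i)) \<and> (\<forall>z\<in>set zs. P (snd z))"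
  by (auto simp: block_word_def shift_word_def case_prod_beta ball_Un simp del: upt_Suc)

text \<open>The triangular shapes of \<open>U\<close> and \<open>U A\<close> belong to the induction
  because the recursion for the minors uses them for the smaller matrix. Nonzero parameters
  guarantee \<alpha> \<noteq> 0, so that the Schur complement exists.\<close>

lemma factorization_forward:
  assumes "map fst zs = word n" "\<forall>z\<in>set zs. snd z \<noteq> 0"
  shows "\<exists>U A W. has_blocks n (gprod n zs) U A W \<and> skew n A \<and> unitri n U \<and> antitri n (U * A) \<and>
    (\<forall>P. P = (\<lambda>x. x > 0) \<or> P = (\<lambda>x. x \<noteq> 0) \<longrightarrow> (minors_all P n A \<longleftrightarrow> (\<forall>z\<in>set zs. P (snd z))))"
  using assms
proof (induction n arbitrary: zs rule: nat_induct2)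
  case 0
  then show ?case using has_blocks_one[of 0]
    by (intro exI[of _ "1\<^sub>m 0"] exI[of _ "0\<^sub>m 0 0"]) (auto simp: skew_def unitri_def antitri_def minors_all_def)
next
  case 1
  then show ?case using has_blocks_one[of 1]
    by (intro exI[of _ "1\<^sub>m 1"] exI[of _ "0\<^sub>m 1 1"]) (auto simp: skew_def unitri_def antitri_def minors_all_def)
next
  case (step n zs)
  let ?m = "n + 2"
  obtain c \<tau> s zs' where zs: "zs = block_word n c \<tau> s @ shift_word zs'" and zs': "map fst zs' = word n"
    using word_decompose[OF step.prems(1)] .
  have nz: "c \<noteq> 0" "\<And>i. 1 \<le> i \<Longrightarrow> i < n + 1 \<Longrightarrow> \<tau> i \<noteq> 0" "\<And>i. 2 \<le> i \<Longrightarrow> i < n + 2 \<Longrightarrow> s i \<noteq> 0" "\<forall>z\<in>set zs'. snd z \<noteq> 0"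
    using step.prems(2) unfolding zs block_word_all[where P = "\<lambda>x. x \<noteq> 0"] by auto
  obtain U' A' W' where sp': "has_blocks n (gprod n zs') U' A' W'" and sk': "skew n A'" and ut': "unitri n U'"
    and at': "antitri n (U' * A')" and mi': "\<And>P. P = (\<lambda>x. x > 0) \<or> P = (\<lambda>x. x \<noteq> 0) \<Longrightarrow>
       minors_all P n A' \<longleftrightarrow> (\<forall>z\<in>set zs'. P (snd z))"
    using step.IH[OF zs' nz(4)] by blast
  have c': "U' \<in> carrier_mat n n" "A' \<in> carrier_mat n n" "W' \<in> carrier_mat n n" "U' * W' = 1\<^sub>m n"
    using sp' by (auto simp: has_blocks_def)
  have UAc: "U' * A' \<in> carrier_mat n n" by (rule mult_carrier_mat[OF c'(1,2)])
  obtain V where V: "has_blocks ?m (gprod ?m (block_word n c \<tau> s)) (block_mat n \<tau> s)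
     (c \<cdot>\<^sub>m wedge ?m (V *\<^sub>v unit_vec ?m n) (V *\<^sub>v unit_vec ?m (n+1))) V"
    using has_blocks_block by blast
  define p where "p = V *\<^sub>v unit_vec ?m n"
  define q where "q = V *\<^sub>v unit_vec ?m (n+1)"
  let ?\<gamma> = "block_mat n \<tau> s"
  have Vc: "V \<in> carrier_mat ?m ?m" "?\<gamma> * V = 1\<^sub>m ?m" using V by (auto simp: has_blocks_def)
  have pq: "p \<in> carrier_vec ?m" "q \<in> carrier_vec ?m"
    unfolding p_def q_def by (rule mult_mat_vec_carrier[OF Vc(1) unit_vec_carrier])+
  have \<gamma>pq: "?\<gamma> *\<^sub>v p = unit_vec ?m n" "?\<gamma> *\<^sub>v q = unit_vec ?m (n+1)"
    unfolding p_def q_def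
    using assoc_mult_mat_vec[OF block_mat_carrier Vc(1) unit_vec_carrier, of \<tau> s] Vc(2)
    by (metis one_mult_mat_vec unit_vec_carrier)+
  obtain v where bv: "block_vectors n \<tau> s (\<lambda>i. p $ i) (\<lambda>i. q $ i) v"
    using block_vectorsI[OF pq(1) \<gamma>pq(1) pq(2) \<gamma>pq(2)] by blast
  define X where "X = pad n 1 W' *\<^sub>v p"
  define Y where "Y = pad n 1 W' *\<^sub>v q"
  define U where "U = ?\<gamma> * pad n 1 U'"
  define A where "A = pad n 0 A' + c \<cdot>\<^sub>m wedge ?m X Y"
  have sp: "has_blocks ?m (gprod ?m zs) U A (pad n 1 W' * V)"
    unfolding zs U_def A_def X_def Y_def
    using has_blocks_compose[OF admissible_word[OF zs'] sp' V[folded p_def q_def] pq] .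
  have EE: "pad n 1 U' * pad n 1 W' = 1\<^sub>m ?m"
    using pad_mult[OF c'(1,3), of 1 1] c'(4) pad_one by simp
  have XYc: "X \<in> carrier_vec ?m" "Y \<in> carrier_vec ?m"
    unfolding X_def Y_def by (rule mult_mat_vec_carrier[OF pad_carrier(1) pq(1)], rule mult_mat_vec_carrier[OF pad_carrier(1) pq(2)])
  have UXY: "pad n 1 U' *\<^sub>v X = p" "pad n 1 U' *\<^sub>v Y = q"
    unfolding X_def Y_def
    using assoc_mult_mat_vec[OF pad_carrier(1) pad_carrier(1) pq(1), of 1 U' 1 W'] 
       assoc_mult_mat_vec[OF pad_carrier(1) pad_carrier(1) pq(2), of 1 U' 1 W'] pq
    by (simp_all only: EE one_mult_mat_vec)
  have XYtop: "X $ i = p $ i" "Y $ i = q $ i" if "i < 2" for i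
    unfolding X_def Y_def using pad_vec_top[OF pq(1) that] pad_vec_top[OF pq(2) that] by auto
  have bvs: "p $ 0 = v 0" "p $ (n+1) = 0" "q $ 0 = 0" "q $ (n+1) = 1" "v n = 1"
    "\<And>i. 1 \<le> i \<Longrightarrow> i \<le> n \<Longrightarrow> p $ i + s (i+1) * p $ (i+1) = v i"
    "\<And>i. 1 \<le> i \<Longrightarrow> i \<le> n \<Longrightarrow> q $ i = - s (i+1) * q $ (i+1)"
    using bv by (auto simp: block_vectors_def)
  have sign_ne: "\<And>i. 1 \<le> i \<Longrightarrow> i \<le> n + 1 \<Longrightarrow> c * v 0 * q $ i \<noteq> 0"
  proof -
    fix i assume i: "1 \<le> i" "i \<le> n + 1"
    have "(\<forall>i. 1 \<le> i \<and> i \<le> n + 1 \<longrightarrow> (-1) ^ (i+1) * (c * v 0 * q $ i) \<noteq> 0)"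
      using block_vectors_sign[OF bv, of "\<lambda>x. x \<noteq> 0" c] nz by auto
    then show "c * v 0 * q $ i \<noteq> 0" using i by auto
  qed
  \<comment> \<open>This is the entry (0, 1): padding leaves the first two coordinates alone, so
    \<open>X\<close> starts with \<open>v 0\<close> and \<open>Y\<close> with 0 and
    \<open>q 1\<close>.\<close>
  define \<alpha> where "\<alpha> = c * v 0 * q $ 1"
  have \<alpha>0: "\<alpha> \<noteq> 0" using sign_ne[of 1] by (simp add: \<alpha>_def)
  have Ae: "A $$ (i,j) = (if 2 \<le> i \<and> 2 \<le> j then A' $$ (i-2,j-2) else 0) + c * (X $ i * Y $ j - Y $ i * X $ j)"
    if "i < ?m" "j < ?m" for i j
    using that by (auto simp: A_def pad_def wedge_def)
  have A0: "A $$ (0,j) = c * v 0 * Y $ j" if "j < ?m" for j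
    using Ae[of 0 j] that XYtop[of 0] bvs by (simp add: algebra_simps)
  have A1: "A $$ (1,j) = c * (p $ 1 * Y $ j - q $ 1 * X $ j)" if "j < ?m" for j
    using Ae[of 1 j] that XYtop[of 1] by (simp add: algebra_simps)
  have skA: "skew ?m A"
    unfolding skew_def
  proof (intro conjI allI impI)
    show "A \<in> carrier_mat ?m ?m" by (simp add: A_def)
    fix i j assume ij: "i < ?m" "j < ?m"
    have "(if 2 \<le> i \<and> 2 \<le> j then A' $$ (i-2,j-2) else 0) = - (if 2 \<le> j \<and> 2 \<le> i then A' $$ (j-2,i-2) else 0)"
    proof (cases "2 \<le> i \<and> 2 \<le> j")
      case True
      then have "A' $$ (i-2,j-2) = - A' $$ (j-2,i-2)"
        using ij by (intro sk'[unfolded skew_def, THEN conjunct2, rule_format]) auto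
      then show ?thesis using True by simp
    qed auto
    then show "A $$ (i,j) = - A $$ (j,i)" 
      unfolding Ae[OF ij] Ae[OF ij(2,1)] by (simp add: algebra_simps)
  qed
  interpret S: schur_reduction n "\<lambda>i j. A $$ (i,j)" "\<lambda>i j. A' $$ (i,j)" \<alpha> "\<lambda>i j. U' $$ (i,j)"
  proof
    show "A $$ (0,1) = \<alpha>" using A0[of 1] XYtop[of 1] by (simp add: \<alpha>_def)
    show "\<alpha> \<noteq> 0" by fact
    fix i j 
    show "A $$ (i,j) = - A $$ (j,i)" if "i < ?m" "j < ?m"
      using skA that unfolding skew_def by blast
    show "A $$ (i,j) = (A $$ (0,i) * A $$ (1,j) - A $$ (1,i) * A $$ (0,j)) / \<alpha> +
      (if 2 \<le> i \<and> 2 \<le> j then A' $$ (i-2,j-2) else 0)" if ij: "i < ?m" "j < ?m"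
    proof -
      \<comment> \<open>Rows 0 and 1 of \<open>A\<close> are combinations of \<open>X\<close> and
        \<open>Y\<close>, and their wedge is \<alpha> c times that of \<open>X\<close> and
        \<open>Y\<close>. Division by \<alpha> returns the rank two summand, so the Schur complement
        is \<open>A'\<close>.\<close>
      have "A $$ (0,i) * A $$ (1,j) - A $$ (1,i) * A $$ (0,j) = \<alpha> * (c * (X $ i * Y $ j - Y $ i * X $ j))"
        unfolding A0[OF ij(1)] A0[OF ij(2)] A1[OF ij(1)] A1[OF ij(2)] \<alpha>_def by (simp add: algebra_simps)
      then show ?thesis using Ae[OF ij] \<alpha>0 by simp
    qed
    show "U' $$ (i,j) = 0" if "i < n" "j < i" using ut' that by (auto simp: unitri_def)
    show "U' $$ (i,i) = 1" if "i < n" using ut' that by (auto simp: unitri_def)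
    show "(\<Sum>l<n. U' $$ (i,l) * A' $$ (l,j)) = 0" if "i + j + 2 \<le> n"
      using at' that mult_entry[OF c'(1,2), of i j] by (auto simp: antitri_def)
  qed
  have Kv: "(\<Sum>l<?m. S.K i l * x $ l) = (pad n 1 U' *\<^sub>v x) $ i" if "i < ?m" "x \<in> carrier_vec ?m" for i x
    using that by (auto simp: scalar_prod_def lessThan_atLeast0 S.K_def pad_def intro!: sum.cong)
  \<comment> \<open>\<open>U'\<close> undoes the congruence by \<open>W'\<close> and takes
    \<open>Y\<close> back to \<open>q\<close>, so the result depends on the parameters of the first
    block only.\<close>
  have y0: "S.y0 i = c * v 0 * q $ i" if "i < ?m" for i
  proof -
    have "S.y0 i = (\<Sum>l<?m. S.K i l * (c * v 0 * Y $ l))"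
      unfolding S.y0_def by (intro sum.cong refl) (simp add: A0)
    also have "\<dots> = c * v 0 * (\<Sum>l<?m. S.K i l * Y $ l)"
      by (simp only: sum_distrib_left mult_ac)
    finally show ?thesis using Kv[OF that XYc(2)] UXY by simp
  qed
  have y1: "S.y1 i = c * (p $ 1 * q $ i - q $ 1 * p $ i)" if "i < ?m" for i
  proof -
    have "S.y1 i = (\<Sum>l<?m. S.K i l * (c * (p $ 1 * Y $ l - q $ 1 * X $ l)))"
      unfolding S.y1_def by (intro sum.cong refl) (simp add: A1[unfolded One_nat_def])
    also have "\<dots> = c * (p $ 1 * (\<Sum>l<?m. S.K i l * Y $ l) - q $ 1 * (\<Sum>l<?m. S.K i l * X $ l))"
      unfolding sum_distrib_left sum_subtractf[symmetric] by (intro sum.cong refl) (simp add: algebra_simps)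
    finally show ?thesis using Kv[OF that XYc(1)] Kv[OF that XYc(2)] UXY by simp
  qed
  have SX: "S.X i = (-1) ^ (i+1) * (c * v 0 * q $ i)" if "i \<le> n + 1" for i
    using y0[of i] that by (simp add: S.X_def)
  \<comment> \<open>Substituting q_j = - s_{j+1} q_{j+1} into p_j q_{j+1} - q_j p_{j+1} leaves
    q_{j+1} times p_j + s_{j+1} p_{j+1}, which is v_j.\<close>
  have SY: "S.Y j = c * q $ (j+1) * v j" if "1 \<le> j" "j \<le> n" for j
  proof -
    have "S.y0 j * S.y1 (j+1) - S.y1 j * S.y0 (j+1) = \<alpha> * (c * (p $ j * q $ (j+1) - q $ j * p $ (j+1)))"
    proof -
      have j: "j < ?m" "j + 1 < ?m" using that by auto
      show ?thesis
        unfolding y0[OF j(1)] y0[OF j(2)] y1[OF j(1)] y1[OF j(2)] \<alpha>_def by (simp add: algebra_simps)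
    qed
    then have "S.Y j = c * (p $ j * q $ (j+1) - q $ j * p $ (j+1))"
      using \<alpha>0 by (simp add: S.Y_def)
    also have "\<dots> = c * q $ (j+1) * (p $ j + s (j+1) * p $ (j+1))"
      using bvs(7)[OF that] by (simp add: algebra_simps)
    finally show ?thesis using bvs(6)[OF that] by simp
  qed
  have minors: "minors_all P ?m A \<longleftrightarrow> (\<forall>z\<in>set zs. P (snd z))" 
    if P: "P = (\<lambda>x. x > 0) \<or> P = (\<lambda>x. x \<noteq> 0)" for P
  proof -
    have "minors_all P ?m A \<longleftrightarrow> minors_all P n A' \<and> 
      ((\<forall>i. 1 \<le> i \<and> i \<le> n + 1 \<longrightarrow> P (S.X i)) \<and> (\<forall>j. 1 \<le> j \<and> j \<le> n \<longrightarrow> P (S.Y j)))"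
      unfolding minors_all_def by (rule S.minors_iff[OF P])
    also have "(\<forall>i. 1 \<le> i \<and> i \<le> n + 1 \<longrightarrow> P (S.X i)) \<longleftrightarrow>
        (\<forall>i. 1 \<le> i \<and> i \<le> n + 1 \<longrightarrow> P ((-1) ^ (i+1) * (c * v 0 * q $ i)))"
      using SX by simp
    also have "(\<forall>j. 1 \<le> j \<and> j \<le> n \<longrightarrow> P (S.Y j)) \<longleftrightarrow> (\<forall>j. 1 \<le> j \<and> j \<le> n \<longrightarrow> P (c * q $ (j+1) * v j))"
      using SY by simp
    finally show ?thesis
      unfolding block_vectors_sign[OF bv P] mi'[OF P] zs block_word_all[where P = P] by blast
  qed
  have utU: "unitri ?m U"
    unfolding U_def by (intro unitri_mult block_mat_carrier pad_carrier unitri_block unitri_emb ut')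
  have "antitri ?m (U * A)"
  proof -
    have Xc: "c \<cdot>\<^sub>m wedge ?m X Y \<in> carrier_mat ?m ?m" by simp
    have "U * A = U * pad n 0 A' + U * (c \<cdot>\<^sub>m wedge ?m X Y)"
      unfolding A_def U_def by (rule mult_add_distrib_mat[OF mult_carrier_mat[OF block_mat_carrier pad_carrier(1)] pad_carrier(1) Xc])
    also have "U * pad n 0 A' = ?\<gamma> * pad n 0 (U' * A')"
      unfolding U_def assoc_mult_mat[OF block_mat_carrier pad_carrier(1) pad_carrier(1)] pad_mult[OF c'(1,2)] by simp
    finally have UA: "U * A = ?\<gamma> * pad n 0 (U' * A') + U * (c \<cdot>\<^sub>m wedge ?m X Y)" .
    have Uc: "U \<in> carrier_mat ?m ?m" unfolding U_def by (rule mult_carrier_mat[OF block_mat_carrier pad_carrier(1)])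
    \<comment> \<open>Consequently the rank two summand of \<open>U A\<close> lives in rows
      \<open>n\<close> and \<open>n + 1\<close>. Its only position above the antidiagonal is (n, 0),
      where the entry is a multiple of \<open>Y $ 0 = 0\<close>.\<close>
    have UX: "U *\<^sub>v X = unit_vec ?m n" "U *\<^sub>v Y = unit_vec ?m (n+1)"
      unfolding U_def using assoc_mult_mat_vec[OF block_mat_carrier pad_carrier(1) XYc(1), of \<tau> s 1 U']
        assoc_mult_mat_vec[OF block_mat_carrier pad_carrier(1) XYc(2), of \<tau> s 1 U'] by (simp_all only: UXY \<gamma>pq)
    have "(U * A) $$ (i,j) = 0" if ij: "i + j + 2 \<le> ?m" for i j
    proof -
      have b: "i < ?m" "j < ?m" using ij by auto
      have "(?\<gamma> * pad n 0 (U' * A')) $$ (i,j) = (\<Sum>l<?m. ?\<gamma> $$ (i,l) * pad n 0 (U' * A') $$ (l,j))"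
        by (rule mult_entry[OF block_mat_carrier pad_carrier(1) b])
      also have "\<dots> = 0"
      proof (rule sum.neutral, rule ballI)
        fix l assume "l \<in> {..<?m}"
        then have l: "l < ?m" by simp
        show "?\<gamma> $$ (i,l) * pad n 0 (U' * A') $$ (l,j) = 0"
        proof (cases "i + 2 < l")
          case True
          then show ?thesis using block_mat_band[OF b(1) l] by simp
        next
          case False
          \<comment> \<open>Here l \<le> i + 2, hence (l - 2) + (j - 2) + 2 \<le> i + j \<le> n, and
            the smaller antitriangularity applies.\<close>
          have "pad n 0 (U' * A') $$ (l,j) = 0"
          proof (cases "l < 2 \<or> j < 2")
            case True
            then show ?thesis using l b by (auto simp: pad_def)
          next
            case F2: False
            then have "pad n 0 (U' * A') $$ (l,j) = (U' * A') $$ (l - 2, j - 2)"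
              using l b UAc unfolding pad_def by simp
            also have "\<dots> = 0"
              using False F2 ij by (intro at'[unfolded antitri_def, rule_format]) linarith
            finally show ?thesis .
          qed
          then show ?thesis by simp
        qed
      qed
      finally have 1: "(?\<gamma> * pad n 0 (U' * A')) $$ (i,j) = 0" .
      have "U * (c \<cdot>\<^sub>m wedge ?m X Y) = c \<cdot>\<^sub>m (U * wedge ?m X Y * transpose_mat (1\<^sub>m ?m))"
        using mult_smult_distrib[OF Uc wedge_carrier(1)] mult_carrier_mat[OF Uc wedge_carrier(1)[of ?m X Y]] by simp
      also have "\<dots> = c \<cdot>\<^sub>m mat ?m ?m (\<lambda>(i,j). unit_vec ?m n $ i * Y $ j - unit_vec ?m (n+1) $ i * X $ j)"
        unfolding mult_wedge_mult[OF Uc one_carrier_mat XYc] UX using XYc by simp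
      finally have "(U * (c \<cdot>\<^sub>m wedge ?m X Y)) $$ (i,j) = c * (unit_vec ?m n $ i * Y $ j - unit_vec ?m (n+1) $ i * X $ j)"
        using b by simp
      also have "\<dots> = 0"
      proof (cases "i = n")
        case True
        then have "j = 0" using ij by simp
        then show ?thesis using True XYtop(2)[of 0] bvs(3) by (simp add: unit_vec_def)
      next
        case False
        then show ?thesis using ij by (simp add: unit_vec_def)
      qed
      finally have 2: "(U * (c \<cdot>\<^sub>m wedge ?m X Y)) $$ (i,j) = 0" .
      show ?thesis unfolding UA using 1 2 b Uc by simp
    qed
    then show ?thesis unfolding antitri_def by blast
  qed
  then show ?case using sp skA utU minors by blast
qed

lemma map_fst_block_word:
  "map fst zs = word n \<Longrightarrow> map fst (block_word n c \<tau> s @ shift_word zs) = word (n+2)"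
proof -
  assume "map fst zs = word n"
  moreover have "map fst (shift_word zs) = map (\<lambda>i. i+2) (map fst zs)"
    by (simp add: shift_word_def comp_def case_prod_beta)
  moreover have "map fst (map (\<lambda>i. (i, f i)) xs) = xs" for f :: "nat \<Rightarrow> real" and xs
    by (simp add: comp_def)
  ultimately show ?thesis
    unfolding word_rec block_word_def by (simp del: map_map upt_Suc)
qed

text \<open>The Schur complement inherits nonvanishing minors and is factored by induction. Its
  unipotent factor gives \<open>y0\<close> and \<open>y1\<close>, which span the plane of the
  vectors \<open>p\<close> and \<open>q\<close> of the block to be found; the monomial formulas are
  then solved for the parameters.\<close>

lemma factorization_backward:
  assumes "skew n A" "minors_all (\<lambda>x. x \<noteq> 0) n A"
  shows "\<exists>zs. map fst zs = word n \<and> (\<forall>z\<in>set zs. snd z \<noteq> 0) \<and> (\<exists>U W. has_blocks n (gprod n zs) U A W)"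
  using assms
proof (induction n arbitrary: A rule: nat_induct2)
  case 0
  then have "A = 0\<^sub>m 0 0" by (intro eq_matI) (auto simp: skew_def)
  then show ?case using has_blocks_one[of 0] by (intro exI[of _ "[]"]) auto
next
  case 1
  then have "A $$ (0,0) = - A $$ (0,0)" by (auto simp: skew_def)
  then have "A = 0\<^sub>m 1 1" using 1 by (intro eq_matI) (auto simp: skew_def)
  then show ?case using has_blocks_one[of 1] by (intro exI[of _ "[]"]) auto
next
  case (step n A)
  let ?m = "n + 2"
  have Ac: "A \<in> carrier_mat ?m ?m" and sk: "\<And>i j. i < ?m \<Longrightarrow> j < ?m \<Longrightarrow> A $$ (i,j) = - A $$ (j,i)"
    using step.prems(1) unfolding skew_def by blast+
  define \<alpha> where "\<alpha> = A $$ (0,1)"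
  have d0: "A $$ (0,0) = 0" "A $$ (1,1) = 0" "A $$ (1,0) = - \<alpha>"
    using sk[of 0 0] sk[of 1 1] sk[of 1 0] by (simp_all add: \<alpha>_def)
  \<comment> \<open>The minor j = k = n has rows 0, n + 1 and columns 0, 1. Since the entry (0, 0)
    vanishes, it has \<alpha> as a factor.\<close>
  have \<alpha>0: "\<alpha> \<noteq> 0"
  proof (cases "n = 0")
    case True
    have "signed_minor 2 1 1 (\<lambda>a b. A $$ (a,b)) \<noteq> 0"
      using step.prems(2)[unfolded minors_all_def, rule_format, of 1 1] True by (simp add: numeral_2_eq_2)
    then show ?thesis using d0 by (simp add: signed_minor_def corner_minor_def numeral_2_eq_2)
  next
    case False
    then have "signed_minor ?m n n (\<lambda>a b. A $$ (a,b)) \<noteq> 0"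
      by (intro step.prems(2)[unfolded minors_all_def, rule_format]) auto
    then show ?thesis using d0 by (auto simp: signed_minor_def corner_minor_def \<alpha>_def numeral_2_eq_2)
  qed
  define B where "B = mat n n (\<lambda>(i,j). A $$ (i+2,j+2) - (A $$ (0,i+2) * A $$ (1,j+2) - A $$ (1,i+2) * A $$ (0,j+2)) / \<alpha>)"
  interpret C: schur_complement n "\<lambda>i j. A $$ (i,j)" "\<lambda>i j. B $$ (i,j)" \<alpha>
  proof
    show "A $$ (0,1) = \<alpha>" "\<alpha> \<noteq> 0" using \<alpha>0 by (auto simp: \<alpha>_def)
    fix i j assume ij: "i < ?m" "j < ?m"
    then show "A $$ (i,j) = - A $$ (j,i)" by (rule sk)
    show "A $$ (i,j) = (A $$ (0,i) * A $$ (1,j) - A $$ (1,i) * A $$ (0,j)) / \<alpha> +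
      (if 2 \<le> i \<and> 2 \<le> j then B $$ (i-2,j-2) else 0)"
    proof -
      consider "i = 0" | "i = 1" | "j = 0" | "j = 1" | "2 \<le> i" "2 \<le> j" by linarith
      then show ?thesis
      proof cases
        case 1
        then show ?thesis using d0 \<alpha>0 by (simp add: \<alpha>_def)
      next
        case 2
        then show ?thesis using d0 \<alpha>0 by (simp add: \<alpha>_def)
      next
        case 3
        then show ?thesis using d0 \<alpha>0 sk[of i 0] ij by simp
      next
        case 4
        then show ?thesis using d0 \<alpha>0 sk[of i 1] ij by (simp add: \<alpha>_def)
      next
        case 5
        then have "i - 2 < n" "j - 2 < n" "i - 2 + 2 = i" "j - 2 + 2 = j" using ij by auto
        then show ?thesis using 5 by (simp add: B_def del: add_2_eq_Suc')
      qed
    qed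
  qed
  have skB: "skew n B"
    unfolding skew_def
  proof (intro conjI allI impI)
    show "B \<in> carrier_mat n n" by (simp add: B_def)
    fix i j assume ij: "i < n" "j < n"
    have "A $$ (i+2,j+2) = - A $$ (j+2,i+2)" using ij by (intro sk) auto
    then show "B $$ (i,j) = - B $$ (j,i)" using ij \<alpha>0 by (simp add: B_def field_simps)
  qed
  have "minors_all (\<lambda>x. x \<noteq> 0) n B"
    unfolding minors_all_def
  proof (intro allI impI)
    fix j k assume "1 \<le> j \<and> j \<le> k \<and> k \<le> n - 1"
    then have jk: "1 \<le> j" "j \<le> k" "k + 1 \<le> n" by auto
    have "signed_minor ?m j k (\<lambda>a b. A $$ (a,b)) \<noteq> 0"
      using jk by (intro step.prems(2)[unfolded minors_all_def, rule_format]) auto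
    then show "signed_minor n j k (\<lambda>a b. B $$ (a,b)) \<noteq> 0"
      unfolding C.signed_minor_interior[OF jk] by simp
  qed
  then obtain zs' U' W' where zs': "map fst zs' = word n" "\<forall>z\<in>set zs'. snd z \<noteq> 0"
      and sp': "has_blocks n (gprod n zs') U' B W'"
    using step.IH[OF skB] by blast
  have ut': "unitri n U'" and at': "antitri n (U' * B)"
    using factorization_forward[OF zs'] has_blocks_unique[OF sp'] by metis+
  have c': "U' \<in> carrier_mat n n" "B \<in> carrier_mat n n" "W' \<in> carrier_mat n n" "W' * U' = 1\<^sub>m n"
    using sp' by (auto simp: has_blocks_def)
  interpret S: schur_reduction n "\<lambda>i j. A $$ (i,j)" "\<lambda>i j. B $$ (i,j)" \<alpha> "\<lambda>i j. U' $$ (i,j)"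
  proof
    fix i j 
    show "U' $$ (i,j) = 0" if "i < n" "j < i" using ut' that by (auto simp: unitri_def)
    show "U' $$ (i,i) = 1" if "i < n" using ut' that by (auto simp: unitri_def)
    show "(\<Sum>l<n. U' $$ (i,l) * B $$ (l,j)) = 0" if "i + j + 2 \<le> n"
      using at' that mult_entry[OF c'(1,2), of i j] by (auto simp: antitri_def)
  qed
  have Y: "S.Y j \<noteq> 0" if "1 \<le> j" "j \<le> n" for j
    using S.minors_iff[of "\<lambda>x. x \<noteq> 0"] step.prems(2) that unfolding minors_all_def by blast
  have X: "S.X i \<noteq> 0" if "1 \<le> i" "i \<le> n + 1" for i
    using S.minors_iff[of "\<lambda>x. x \<noteq> 0"] step.prems(2) that unfolding minors_all_def by blast
  have y0n: "S.y0 i \<noteq> 0" if "1 \<le> i" "i \<le> n + 1" for i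
    using X[OF that] by (simp add: S.X_def)
  \<comment> \<open>The wedge of \<open>y0\<close> and \<open>y1\<close> over \<alpha> has to equal
    \<open>c\<close> times the wedge of \<open>p\<close> and \<open>q\<close>. The latter wedge is 1
    at (n, n + 1), which forces the value of \<open>c\<close>.\<close>
  define D where "D i j = (S.y0 i * S.y1 j - S.y1 i * S.y0 j) / \<alpha>" for i j
  have DY: "S.Y j = D j (j+1)" for j by (simp add: D_def S.Y_def)
  define c where "c = D n (n+1)"
  have c0: "c \<noteq> 0"
  proof (cases "n = 0")
    case True
    have "D 0 1 \<noteq> 0" using \<alpha>0 by (simp add: D_def S.y_top)
    then show ?thesis unfolding c_def by (simp add: True)
  next
    case False
    then show ?thesis using Y[of n] by (simp add: c_def DY)
  qed
  \<comment> \<open>All choices are forced by the forward formulas: \<open>q\<close> is proportional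
    to \<open>y0\<close> with last entry 1, \<open>p\<close> is column \<open>n + 1\<close> of
    \<open>D / c\<close>, \<open>v\<close> comes from \<open>Y j = c q (j+1) v j\<close>, and
    \<open>s\<close> and \<tau> come from the recursions in \<open>block_vectors\<close>.\<close>
  define q where "q i = S.y0 i / S.y0 (n+1)" for i
  define p where "p i = D i (n+1) / c" for i
  define v where "v i = (if i = 0 then p 0 else D i (i+1) / (c * q (i+1)))" for i
  define s where "s i = - q (i-1) / q i" for i
  define \<tau> where "\<tau> i = - v (i-1) / v i" for i
  have q0: "q i \<noteq> 0" if "1 \<le> i" "i \<le> n + 1" for i
    using y0n[OF that] y0n[of "n+1"] by (simp add: q_def)
  have qn: "q (n+1) = 1" using y0n[of "n+1"] by (simp add: q_def)
  have Dpq: "D i j = c * (p i * q j - q i * p j)" for i j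
  proof -
    \<comment> \<open>A Pluecker relation: the 3 by 3 determinant with rows \<open>y0\<close>,
      \<open>y0\<close>, \<open>y1\<close> and columns i, j, n + 1 vanishes. So column
      \<open>n + 1\<close> and \<open>y0\<close> determine all of \<open>D\<close>.\<close>
    have "S.y0 (n+1) * D i j = S.y0 j * D i (n+1) - S.y0 i * D j (n+1)"
      using \<alpha>0 by (simp add: D_def field_simps)
    then have "D i j = (S.y0 j * D i (n+1) - S.y0 i * D j (n+1)) / S.y0 (n+1)"
      using y0n[of "n+1"] by (simp add: field_simps)
    then show ?thesis using c0 by (simp add: p_def q_def diff_divide_distrib mult_ac right_diff_distrib)
  qed
  have p0: "p 0 \<noteq> 0"
    using y0n[of "n+1"] \<alpha>0 c0 by (simp add: p_def D_def S.y_top)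
  have v0: "v i \<noteq> 0" if "i \<le> n" for i
  proof (cases "i = 0")
    case False
    then show ?thesis using that Y[of i] q0[of "i+1"] c0 by (simp add: v_def DY)
  qed (simp add: v_def p0)
  have bv: "block_vectors n \<tau> s p q v"
    unfolding block_vectors_def
  proof (intro conjI allI impI)
    show "v n = 1"
    proof (cases "n = 0")
      case True
      then show ?thesis using c0 by (simp add: v_def p_def c_def)
    next
      case False
      then show ?thesis using c0 qn by (simp add: v_def c_def)
    qed
    show "v i = - \<tau> (i+1) * v (i+1)" if "i < n" for i
      using v0[of "i+1"] that by (simp add: \<tau>_def)
    show "p 0 = v 0" by (simp add: v_def)
    show "p (n+1) = 0" by (simp add: p_def D_def)
    show "p i + s (i+1) * p (i+1) = v i" if "1 \<le> i \<and> i \<le> n" for i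
    proof -
      have "v i = (p i * q (i+1) - q i * p (i+1)) / q (i+1)"
        using that c0 by (simp add: v_def Dpq)
      then show ?thesis using q0[of "i+1"] that by (simp add: s_def field_simps)
    qed
    show "q 0 = 0" by (simp add: q_def S.y_top)
    show "q (n+1) = 1" by (rule qn)
    show "q i = - s (i+1) * q (i+1)" if "1 \<le> i \<and> i \<le> n" for i
      using q0[of "i+1"] that by (simp add: s_def)
  qed
  define zs where "zs = block_word n c \<tau> s @ shift_word zs'"
  have "\<forall>z\<in>set zs. snd z \<noteq> 0"
    unfolding zs_def block_word_all[where P = "\<lambda>x. x \<noteq> 0"]
  proof (intro conjI allI impI c0 zs'(2))
    show "\<tau> i \<noteq> 0" if "1 \<le> i \<and> i < n + 1" for i using that v0[of "i-1"] v0[of i] by (cases i) (auto simp: \<tau>_def)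
    show "s i \<noteq> 0" if "2 \<le> i \<and> i < n + 2" for i using that q0[of "i-1"] q0[of i] by (cases i) (auto simp: s_def)
  qed
  moreover have "map fst zs = word (n+2)" unfolding zs_def by (rule map_fst_block_word[OF zs'(1)])
  moreover have "\<exists>U W. has_blocks ?m (gprod ?m zs) U A W"
  proof -
    obtain V where V: "has_blocks ?m (gprod ?m (block_word n c \<tau> s)) (block_mat n \<tau> s)
       (c \<cdot>\<^sub>m wedge ?m (V *\<^sub>v unit_vec ?m n) (V *\<^sub>v unit_vec ?m (n+1))) V"
      using has_blocks_block by blast
    have Vc: "V \<in> carrier_mat ?m ?m" "V * block_mat n \<tau> s = 1\<^sub>m ?m" using V by (auto simp: has_blocks_def)
    have "V *\<^sub>v unit_vec ?m n = vec ?m p" "V *\<^sub>v unit_vec ?m (n+1) = vec ?m q"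
      unfolding block_vectorsD[OF bv, symmetric]
      using assoc_mult_mat_vec[OF Vc(1) block_mat_carrier vec_carrier, symmetric] by (simp_all only: Vc(2) one_mult_mat_vec[OF vec_carrier])
    then have V2: "has_blocks ?m (gprod ?m (block_word n c \<tau> s)) (block_mat n \<tau> s) (c \<cdot>\<^sub>m wedge ?m (vec ?m p) (vec ?m q)) V"
      using V by simp
    have sp: "has_blocks ?m (gprod ?m zs) (block_mat n \<tau> s * pad n 1 U')
      (pad n 0 B + c \<cdot>\<^sub>m wedge ?m (pad n 1 W' *\<^sub>v vec ?m p) (pad n 1 W' *\<^sub>v vec ?m q)) (pad n 1 W' * V)"
      unfolding zs_def by (rule has_blocks_compose[OF admissible_word[OF zs'(1)] sp' V2 vec_carrier vec_carrier])
    have EE: "pad n 1 W' * pad n 1 U' = 1\<^sub>m ?m"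
      using pad_mult[OF c'(3,1), of 1 1] c'(4) pad_one by simp
    have Ev: "pad n 1 W' *\<^sub>v (pad n 1 U' *\<^sub>v vec ?m x) = vec ?m x" for x
      using assoc_mult_mat_vec[OF pad_carrier(1)[of n 1 W'] pad_carrier(1)[of n 1 U'] vec_carrier[of ?m x]]
      by (simp only: EE one_mult_mat_vec[OF vec_carrier])
    have Kv: "vec ?m (\<lambda>i. \<Sum>l<?m. S.K i l * f l) = pad n 1 U' *\<^sub>v vec ?m f" for f
      by (rule eq_vecI) (auto simp: scalar_prod_def lessThan_atLeast0 S.K_def pad_def intro!: sum.cong)
    have y: "pad n 1 W' *\<^sub>v vec ?m S.y0 = vec ?m (\<lambda>j. A $$ (0,j))" "pad n 1 W' *\<^sub>v vec ?m S.y1 = vec ?m (\<lambda>j. A $$ (1,j))"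
      unfolding S.y0_def S.y1_def Kv Ev by simp_all
    have cong: "pad n 1 W' * (d \<cdot>\<^sub>m wedge ?m (vec ?m f) (vec ?m g)) * transpose_mat (pad n 1 W') =
        d \<cdot>\<^sub>m wedge ?m (pad n 1 W' *\<^sub>v vec ?m f) (pad n 1 W' *\<^sub>v vec ?m g)" for d f g
      by (rule smult_wedge_congruence[OF pad_carrier(1) vec_carrier vec_carrier])
    have "c \<cdot>\<^sub>m wedge ?m (vec ?m p) (vec ?m q) = (1/\<alpha>) \<cdot>\<^sub>m wedge ?m (vec ?m S.y0) (vec ?m S.y1)"
    proof (rule eq_matI)
      fix i j assume "i < dim_row ((1/\<alpha>) \<cdot>\<^sub>m wedge ?m (vec ?m S.y0) (vec ?m S.y1))"
        "j < dim_col ((1/\<alpha>) \<cdot>\<^sub>m wedge ?m (vec ?m S.y0) (vec ?m S.y1))"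
      then show "(c \<cdot>\<^sub>m wedge ?m (vec ?m p) (vec ?m q)) $$ (i,j) = ((1/\<alpha>) \<cdot>\<^sub>m wedge ?m (vec ?m S.y0) (vec ?m S.y1)) $$ (i,j)"
        using Dpq[of i j] by (simp add: wedge_def D_def)
    qed simp_all
    then have "c \<cdot>\<^sub>m wedge ?m (pad n 1 W' *\<^sub>v vec ?m p) (pad n 1 W' *\<^sub>v vec ?m q) =
        (1/\<alpha>) \<cdot>\<^sub>m wedge ?m (vec ?m (\<lambda>j. A $$ (0,j))) (vec ?m (\<lambda>j. A $$ (1,j)))"
      using cong[of c p q] cong[of "1/\<alpha>" S.y0 S.y1] by (simp only: y)
    then have "pad n 0 B + c \<cdot>\<^sub>m wedge ?m (pad n 1 W' *\<^sub>v vec ?m p) (pad n 1 W' *\<^sub>v vec ?m q) = 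
        pad n 0 B + (1/\<alpha>) \<cdot>\<^sub>m wedge ?m (vec ?m (\<lambda>j. A $$ (0,j))) (vec ?m (\<lambda>j. A $$ (1,j)))"
      by simp
    also have "\<dots> = A"
    proof (rule eq_matI)
      fix i j assume "i < dim_row A" "j < dim_col A"
      then have ij: "i < ?m" "j < ?m" using Ac by auto
      have "(pad n 0 B + (1/\<alpha>) \<cdot>\<^sub>m wedge ?m (vec ?m (\<lambda>j. A $$ (0,j))) (vec ?m (\<lambda>j. A $$ (1,j)))) $$ (i,j)
         = (A $$ (0,i) * A $$ (1,j) - A $$ (1,i) * A $$ (0,j)) / \<alpha> +
           (if 2 \<le> i \<and> 2 \<le> j then B $$ (i-2,j-2) else 0)"
        using ij by (simp add: pad_def wedge_def)
      also have "\<dots> = A $$ (i,j)" by (rule C.schur[OF ij, symmetric])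
      finally show "(pad n 0 B + (1/\<alpha>) \<cdot>\<^sub>m wedge ?m (vec ?m (\<lambda>j. A $$ (0,j))) (vec ?m (\<lambda>j. A $$ (1,j)))) $$ (i,j) = A $$ (i,j)" .
    qed (use Ac in auto)
    finally show ?thesis using sp by auto
  qed
  ultimately show ?case by blast
qed

section \<open>Signs of polynomials near the corner of an orthant\<close>

text \<open>Polynomial functions of \<open>t 0\<close> to \<open>t (n - 1)\<close>, encoded as
  iterated univariate polynomials with the last variable outermost. The sign argument peels off
  variables in this order.\<close>

fun iterpoly :: "nat \<Rightarrow> ((nat \<Rightarrow> real) \<Rightarrow> real) \<Rightarrow> bool" where
  "iterpoly 0 g \<longleftrightarrow> (\<exists>c. \<forall>t. g t = c)"
| "iterpoly (Suc n) g \<longleftrightarrow> (\<exists>G d. (\<forall>t. g t = poly (G t) (t n)) \<and> (\<forall>t. degree (G t) \<le> d) \<and>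
     (\<forall>i. iterpoly n (\<lambda>t. coeff (G t) i)))"

lemma iterpoly_const: "iterpoly n (\<lambda>t. c)"
proof (induction n arbitrary: c)
  case (Suc n)
  show ?case
    by (auto intro!: exI[of _ "\<lambda>t. [:c:]"] simp: Suc coeff_pCons split: nat.split)
qed simp

lemma iterpoly_var: "k < n \<Longrightarrow> iterpoly n (\<lambda>t. t k)"
proof (induction n)
  case (Suc n)
  show ?case
  proof (cases "k = n")
    case True
    have "iterpoly n (\<lambda>t. coeff [:0, 1::real:] i)" for i by (rule iterpoly_const)
    then show ?thesis using True
      by (auto intro!: exI[of _ "\<lambda>t. [:0, 1:]"])
  next
    case False
    then have "iterpoly n (\<lambda>t. t k)" using Suc by auto
    then have "iterpoly n (\<lambda>t. coeff [:t k:] i)" for i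
      by (cases i) (auto simp: iterpoly_const)
    then show ?thesis
      by (auto intro!: exI[of _ "\<lambda>t. [:t k:]"])
  qed
qed simp

lemma iterpoly_add: "iterpoly n f \<Longrightarrow> iterpoly n g \<Longrightarrow> iterpoly n (\<lambda>t. f t + g t)"
proof (induction n arbitrary: f g)
  case (Suc n)
  obtain F d where F: "\<And>t. f t = poly (F t) (t n)" "\<And>t. degree (F t) \<le> d" "\<And>i. iterpoly n (\<lambda>t. coeff (F t) i)"
    using Suc.prems(1) by auto
  obtain G e where G: "\<And>t. g t = poly (G t) (t n)" "\<And>t. degree (G t) \<le> e" "\<And>i. iterpoly n (\<lambda>t. coeff (G t) i)"
    using Suc.prems(2) by auto
  have "degree (F t + G t) \<le> max d e" for t
    using F(2)[of t] G(2)[of t] by (intro degree_add_le) auto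
  moreover have "iterpoly n (\<lambda>t. coeff (F t + G t) i)" for i
    using Suc.IH[OF F(3) G(3)] by simp
  ultimately show ?case
    using F(1) G(1) by (auto intro!: exI[of _ "\<lambda>t. F t + G t"])
qed auto

lemma iterpoly_sum: "(\<And>i. i \<in> I \<Longrightarrow> iterpoly n (f i)) \<Longrightarrow> iterpoly n (\<lambda>t. \<Sum>i\<in>I. f i t)"
  by (induction I rule: infinite_finite_induct) (auto simp: iterpoly_const iterpoly_add)

lemma iterpoly_mult: "iterpoly n f \<Longrightarrow> iterpoly n g \<Longrightarrow> iterpoly n (\<lambda>t. f t * g t)"
proof (induction n arbitrary: f g)
  case (Suc n)
  obtain F d where F: "\<And>t. f t = poly (F t) (t n)" "\<And>t. degree (F t) \<le> d" "\<And>i. iterpoly n (\<lambda>t. coeff (F t) i)"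
    using Suc.prems(1) by auto
  obtain G e where G: "\<And>t. g t = poly (G t) (t n)" "\<And>t. degree (G t) \<le> e" "\<And>i. iterpoly n (\<lambda>t. coeff (G t) i)"
    using Suc.prems(2) by auto
  have "degree (F t * G t) \<le> d + e" for t
    using F(2)[of t] G(2)[of t] degree_mult_le[of "F t" "G t"] by linarith
  moreover have "iterpoly n (\<lambda>t. coeff (F t * G t) i)" for i
    unfolding coeff_mult by (intro iterpoly_sum Suc.IH F G)
  ultimately show ?case
    using F(1) G(1) by (auto intro!: exI[of _ "\<lambda>t. F t * G t"])
qed auto

lemma iterpoly_local:
  assumes "iterpoly n g" "\<And>k. k < n \<Longrightarrow> t k = t' k"
  shows "g t = g t'"
  using assms
proof (induction n arbitrary: g)
  case (Suc n)
  obtain G where G: "\<And>t. g t = poly (G t) (t n)" "\<And>i. iterpoly n (\<lambda>t. coeff (G t) i)"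
    using Suc.prems(1) by auto
  have "G t = G t'"
    by (rule poly_eqI) (rule Suc.IH[OF G(2)], use Suc.prems in auto)
  then show ?case using G(1) Suc.prems by simp
qed auto

text \<open>Each \<open>x k\<close> is small depending on \<open>x 0, \<dots>, x (k - 1)\<close>, i.e. \<open>x 0 \<gg> x 1 \<gg> \<dots>\<close>; the base value is irrelevant.\<close>

fun nested_ev :: "nat \<Rightarrow> ((nat \<Rightarrow> real) \<Rightarrow> bool) \<Rightarrow> bool" where
  "nested_ev 0 \<phi> \<longleftrightarrow> \<phi> (\<lambda>_. 1)"
| "nested_ev (Suc n) \<phi> \<longleftrightarrow> nested_ev n (\<lambda>x. \<forall>\<^sub>F r in at_right 0. \<phi> (x(n := r)))"

lemma nested_ev_mono: "nested_ev n \<phi> \<Longrightarrow> (\<And>x. \<phi> x \<Longrightarrow> \<psi> x) \<Longrightarrow> nested_ev n \<psi>"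
proof (induction n arbitrary: \<phi> \<psi>)
  case (Suc n)
  show ?case
    unfolding nested_ev.simps
    by (rule Suc.IH[OF Suc.prems(1)[unfolded nested_ev.simps]]) (auto elim!: eventually_mono intro: Suc.prems(2))
qed auto

lemma nested_ev_conj: "nested_ev n \<phi> \<Longrightarrow> nested_ev n \<psi> \<Longrightarrow> nested_ev n (\<lambda>x. \<phi> x \<and> \<psi> x)"
proof (induction n arbitrary: \<phi> \<psi>)
  case (Suc n)
  show ?case
    unfolding nested_ev.simps eventually_conj_iff
    using Suc by simp
qed auto

lemma nested_ev_pos: "nested_ev n (\<lambda>x. \<forall>k<n. x k > 0)"
proof (induction n)
  case (Suc n)
  show ?case
    unfolding nested_ev.simps
  proof (rule nested_ev_mono[OF Suc])
    fix x :: "nat \<Rightarrow> real" assume x: "\<forall>k<n. x k > 0"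
    have "\<forall>\<^sub>F r in at_right 0. r > (0::real)" by (rule eventually_at_right_less)
    then show "\<forall>\<^sub>F r in at_right 0. \<forall>k<Suc n. (x(n := r)) k > 0"
      by (rule eventually_mono) (use x in auto)
  qed
qed auto

lemma nested_ev_ball: "(\<And>i. i < (r::nat) \<Longrightarrow> nested_ev n (\<phi> i)) \<Longrightarrow> nested_ev n (\<lambda>x. \<forall>i<r. \<phi> i x)"
proof (induction r)
  case 0
  show ?case by (rule nested_ev_mono[OF nested_ev_pos]) auto
next
  case (Suc r)
  have "nested_ev n (\<lambda>x. (\<forall>i<r. \<phi> i x) \<and> \<phi> r x)"
    by (intro nested_ev_conj Suc) auto
  then show ?case by (rule nested_ev_mono) (auto simp: less_Suc_eq)
qed

lemma nested_ev_ex: "nested_ev n \<phi> \<Longrightarrow> \<exists>x. \<phi> x"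
proof (induction n arbitrary: \<phi>)
  case (Suc n)
  then obtain x where "\<forall>\<^sub>F r in at_right (0::real). \<phi> (x(n := r))" by auto
  then show ?case using eventually_happens'[of "at_right (0::real)"] by auto
qed auto

lemma poly_sgn_near_zero:
  fixes p :: "real poly"
  assumes low: "\<And>i. i < m \<Longrightarrow> coeff p i = 0" and ne: "coeff p m \<noteq> 0" and s: "s = 1 \<or> s = -1"
  shows "\<forall>\<^sub>F r in at_right 0. sgn (poly p (s * r)) = sgn (coeff p m) * s ^ m"
proof -
  obtain p' where p': "p = monom 1 m * p'"
    using low monom_1_dvd_iff'[of m p] by auto
  have c: "poly p' 0 = coeff p m" by (simp add: p' coeff_monom_mult poly_0_coeff_0)
  have "((\<lambda>r. poly p' (s * r)) \<longlongrightarrow> poly p' (s * 0)) (at_right 0)"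
    by (intro tendsto_intros)
  then have lim: "((\<lambda>r. poly p' (s * r)) \<longlongrightarrow> coeff p m) (at_right 0)" using c by simp
  have "\<forall>\<^sub>F r in at_right 0. sgn (poly p' (s * r)) = sgn (coeff p m)"
  proof (cases "coeff p m > 0")
    case True
    show ?thesis by (rule eventually_mono[OF order_tendstoD(1)[OF lim True]]) (use True in auto)
  next
    case False
    then have neg: "coeff p m < 0" using ne by simp
    show ?thesis by (rule eventually_mono[OF order_tendstoD(2)[OF lim neg]]) (use neg in auto)
  qed
  moreover have "\<forall>\<^sub>F r in at_right 0. r > (0::real)" by (rule eventually_at_right_less)
  ultimately show ?thesis
  proof eventually_elim
    case (elim r)
    have sr: "sgn (s * r) = s" using s elim(2) by (auto simp: sgn_mult)
    have "poly p (s * r) = (s * r) ^ m * poly p' (s * r)" by (simp add: p' poly_monom)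
    then have "sgn (poly p (s * r)) = sgn (s * r) ^ m * sgn (poly p' (s * r))"
      by (simp only: sgn_mult power_sgn)
    then show ?case using elim(1) sr by simp
  qed
qed

text \<open>One monomial dominates: take the lowest exponent of the last variable and recurse into
  its coefficient. Neither \<sigma> nor \<open>e\<close> depends on \<open>s\<close>, so the same
  monomial governs all orthants.\<close>

lemma iterpoly_sgn:
  assumes "iterpoly n g" "\<exists>t. g t \<noteq> 0"
  shows "\<exists>\<sigma> e. \<sigma> \<noteq> 0 \<and> (\<forall>s. (\<forall>k. s k = 1 \<or> s k = -1) \<longrightarrow>
    nested_ev n (\<lambda>x. sgn (g (\<lambda>k. s k * x k)) = \<sigma> * (\<Prod>k<n. s k ^ e k)))"
  using assms
proof (induction n arbitrary: g)
  case 0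
  then obtain c where c: "\<And>t. g t = c" by auto
  then have "c \<noteq> 0" using 0 by auto
  then show ?case using c by (intro exI[of _ "sgn c"]) (auto simp: sgn_zero_iff)
next
  case (Suc n)
  obtain G where G: "\<And>t. g t = poly (G t) (t n)" "\<And>i. iterpoly n (\<lambda>t. coeff (G t) i)"
    using Suc.prems(1) by auto
  obtain t0 where "g t0 \<noteq> 0" using Suc.prems(2) by auto
  then have "G t0 \<noteq> 0" using G(1)[of t0] by auto
  then have "\<exists>i t. coeff (G t) i \<noteq> 0" using leading_coeff_0_iff by blast
  \<comment> \<open>The minimum is taken over all \<open>t\<close> at once and is thus independent
    of the point. That coefficient \<open>m\<close> is nonzero at the points in question follows
    from the induction hypothesis and \<sigma> \<noteq> 0.\<close>
  define m where "m = (LEAST i. \<exists>t. coeff (G t) i \<noteq> 0)"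
  have m: "\<exists>t. coeff (G t) m \<noteq> 0" unfolding m_def by (rule LeastI_ex) fact
  have low: "coeff (G t) i = 0" if "i < m" for t i using not_less_Least[OF that[unfolded m_def]] by blast
  obtain \<sigma> e where \<sigma>: "\<sigma> \<noteq> 0" and IH: "\<And>s. (\<forall>k. s k = 1 \<or> s k = -1) \<Longrightarrow>
    nested_ev n (\<lambda>x. sgn (coeff (G (\<lambda>k. s k * x k)) m) = \<sigma> * (\<Prod>k<n. s k ^ e k))"
    using Suc.IH[OF G(2) m] by blast
  have "nested_ev (Suc n) (\<lambda>x. sgn (g (\<lambda>k. s k * x k)) = \<sigma> * (\<Prod>k<Suc n. s k ^ (e(n := m)) k))"
    if s: "\<forall>k. s k = 1 \<or> s k = -1" for s
    unfolding nested_ev.simps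
  proof (rule nested_ev_mono[OF IH[OF s]])
    fix x assume x: "sgn (coeff (G (\<lambda>k. s k * x k)) m) = \<sigma> * (\<Prod>k<n. s k ^ e k)"
    have "s k \<noteq> 0" for k using s by (metis one_neq_zero neg_equal_0_iff_equal)
    then have "(\<Prod>k<n. s k ^ e k) \<noteq> 0" by (simp add: prod_zero_iff)
    then have "sgn (coeff (G (\<lambda>k. s k * x k)) m) \<noteq> 0" unfolding x using \<sigma> by simp
    then have ne: "coeff (G (\<lambda>k. s k * x k)) m \<noteq> 0" by (simp add: sgn_zero_iff)
    have "g (\<lambda>k. s k * (x(n := r)) k) = poly (G (\<lambda>k. s k * x k)) (s n * r)" for r
    proof -
      have "G (\<lambda>k. s k * (x(n := r)) k) = G (\<lambda>k. s k * x k)"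
        by (rule poly_eqI) (rule iterpoly_local[OF G(2)], simp)
      then show ?thesis using G(1)[of "\<lambda>k. s k * (x(n := r)) k"] by simp
    qed
    moreover have "\<forall>\<^sub>F r in at_right 0. sgn (poly (G (\<lambda>k. s k * x k)) (s n * r)) =
        sgn (coeff (G (\<lambda>k. s k * x k)) m) * s n ^ m"
      by (rule poly_sgn_near_zero) (use low ne s in auto)
    moreover have "(\<Prod>k<n. s k ^ (e(n := m)) k) = (\<Prod>k<n. s k ^ e k)"
      by (rule prod.cong) auto
    ultimately show "\<forall>\<^sub>F r in at_right 0. sgn (g (\<lambda>k. s k * (x(n := r)) k)) = \<sigma> * (\<Prod>k<Suc n. s k ^ (e(n := m)) k)"
      by (auto simp: x mult.assoc)
  qed
  then show ?case using \<sigma> by blast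
qed

text \<open>Pigeonhole: 2^N sign vectors share at most 2^r patterns of values. Characters are
  multiplicative, so the product of two distinct vectors with equal patterns, given by the symmetric
  difference of the sets, lies in every kernel.\<close>

lemma common_kernel_of_sign_characters:
  fixes e :: "nat \<Rightarrow> nat \<Rightarrow> nat"
  assumes "r < N"
  obtains C where "C \<subseteq> {..<N}" "C \<noteq> {}"
    "\<And>i. i < r \<Longrightarrow> (\<Prod>k<N. (if k \<in> C then -1 else 1 :: real) ^ e i k) = 1"
proof -
  define \<chi> where "\<chi> i A = (\<Prod>k<N. (if k \<in> A then -1 else 1 :: real) ^ e i k)" for i A
  define F where "F A = {i\<in>{..<r}. \<chi> i A = 1}" for A
  have \<chi>: "\<chi> i A = 1 \<or> \<chi> i A = -1" for i A
  proof -
    have "\<bar>\<chi> i A\<bar> = 1" unfolding \<chi>_def abs_prod by (intro prod.neutral) (auto simp: power_abs)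
    then show ?thesis by linarith
  qed
  have "\<not> inj_on F (Pow {..<N})"
  proof
    assume "inj_on F (Pow {..<N})"
    moreover have "F ` Pow {..<N} \<subseteq> Pow {..<r}" by (auto simp: F_def)
    ultimately have "card (Pow {..<N}) \<le> card (Pow {..<r})" by (intro card_inj_on_le) auto
    then show False using assms by (simp add: card_Pow)
  qed
  then obtain A B where AB: "A \<subseteq> {..<N}" "B \<subseteq> {..<N}" "A \<noteq> B" "F A = F B"
    by (auto simp: inj_on_def)
  define C where "C = (A - B) \<union> (B - A)"
  have "\<chi> i C = 1" if "i < r" for i
  proof -
    have "\<chi> i C = \<chi> i A * \<chi> i B"
      unfolding \<chi>_def prod.distrib[symmetric] by (intro prod.cong) (auto simp: C_def simp flip: power_mult_distrib)
    moreover have "\<chi> i A = 1 \<longleftrightarrow> \<chi> i B = 1" using AB(4) that by (auto simp: F_def)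
    ultimately show ?thesis using \<chi>[of i A] \<chi>[of i B] by auto
  qed
  then show ?thesis using that[of C] AB by (auto simp: C_def \<chi>_def)
qed

section \<open>Total positivity\<close>

definition iterpoly_mat :: "nat \<Rightarrow> nat \<Rightarrow> ((nat \<Rightarrow> real) \<Rightarrow> real mat) \<Rightarrow> bool" where
  "iterpoly_mat N n M \<longleftrightarrow> (\<forall>x. M x \<in> carrier_mat n n) \<and> (\<forall>i<n. \<forall>j<n. iterpoly N (\<lambda>x. M x $$ (i,j)))"

lemma iterpoly_mat_mult:
  assumes "iterpoly_mat N n M" "iterpoly_mat N n M'"
  shows "iterpoly_mat N n (\<lambda>x. M x * M' x)"
proof -
  have c: "M x \<in> carrier_mat n n" "M' x \<in> carrier_mat n n" for x using assms by (auto simp: iterpoly_mat_def)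
  have "iterpoly N (\<lambda>x. \<Sum>l<n. M x $$ (i,l) * M' x $$ (l,j))" if "i < n" "j < n" for i j
    using assms that by (intro iterpoly_sum iterpoly_mult) (auto simp: iterpoly_mat_def)
  then show ?thesis
    unfolding iterpoly_mat_def using mult_entry[OF c(1) c(2)] mult_carrier_mat[OF c(1) c(2)] by simp
qed

lemma iterpoly_mat_add:
  assumes "iterpoly_mat N n M" "iterpoly_mat N n M'"
  shows "iterpoly_mat N n (\<lambda>x. M x + M' x)"
proof -
  have d: "dim_row (M' x) = n" "dim_col (M' x) = n" for x using assms by (auto simp: iterpoly_mat_def)
  show ?thesis
    using assms unfolding iterpoly_mat_def by (auto simp: d intro: iterpoly_add)
qed

lemma iterpoly_mat_transpose:
  assumes "iterpoly_mat N n M"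
  shows "iterpoly_mat N n (\<lambda>x. transpose_mat (M x))"
proof -
  have d: "dim_row (M x) = n" "dim_col (M x) = n" for x using assms by (auto simp: iterpoly_mat_def)
  show ?thesis
    using assms unfolding iterpoly_mat_def by (auto simp: d)
qed

lemma iterpoly_mat_const: "M \<in> carrier_mat n n \<Longrightarrow> iterpoly_mat N n (\<lambda>x. M)"
  by (simp add: iterpoly_mat_def iterpoly_const)

lemma iterpoly_mat_smult:
  assumes "iterpoly N f" "M \<in> carrier_mat n n"
  shows "iterpoly_mat N n (\<lambda>x. f x \<cdot>\<^sub>m M)"
  using assms by (auto simp: iterpoly_mat_def intro!: iterpoly_mult iterpoly_const)

lemma iterpoly_mat_elem:
  assumes "iterpoly N f"
  shows "iterpoly_mat N n (\<lambda>x. elementary n i (f x))"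
proof -
  have "iterpoly N (\<lambda>x. elementary n i (f x) $$ (r,c))" if "r < n" "c < n" for r c
    using that assms iterpoly_const[of N 1] iterpoly_const[of N 0]
    by (cases "r = c"; cases "r + 1 = i \<and> c = i") (auto simp: elementary_def)
  then show ?thesis by (simp add: iterpoly_mat_def)
qed

text \<open>\<open>W\<close> is followed along with \<open>A\<close>. A generator is inverted by
  negating its parameter, so no division occurs although \<open>A\<close> is defined through the
  inverse of \<open>U\<close>.\<close>

lemma gprod_polynomial:
  assumes "\<And>i f. (i,f) \<in> set zs \<Longrightarrow> 1 \<le> i \<and> i \<le> n \<and> 2 \<le> n \<and> iterpoly N f"
  shows "\<exists>U A W. (\<forall>x. has_blocks n (gprod n (map (\<lambda>(i,f). (i, f x)) zs)) (U x) (A x) (W x)) \<and>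
    iterpoly_mat N n A \<and> iterpoly_mat N n W"
  using assms
proof (induction zs)
  case Nil
  show ?case using has_blocks_one[of n]
    by (intro exI[of _ "\<lambda>x. 1\<^sub>m n"] exI[of _ "\<lambda>x. 0\<^sub>m n n"]) (simp add: iterpoly_mat_const)
next
  case (Cons z zs)
  obtain i f where z: "z = (i,f)" by (cases z)
  have i: "1 \<le> i" "i \<le> n" "2 \<le> n" and f: "iterpoly N f" using Cons.prems[of i f] by (auto simp: z)
  have "\<exists>U A W. (\<forall>x. has_blocks n (gprod n (map (\<lambda>(i,f). (i, f x)) zs)) (U x) (A x) (W x)) \<and>
      iterpoly_mat N n A \<and> iterpoly_mat N n W"
    by (rule Cons.IH) (rule Cons.prems, simp)
  then obtain U A W where IH: "\<And>x. has_blocks n (gprod n (map (\<lambda>(i,f). (i, f x)) zs)) (U x) (A x) (W x)"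
    "iterpoly_mat N n A" "iterpoly_mat N n W"
    by blast
  have nf: "iterpoly N (\<lambda>x. - f x)"
    using iterpoly_mult[OF iterpoly_const[of N "-1"] f] by simp
  obtain U1 A1 W1 where 1: "\<And>x. has_blocks n (xgen n i (f x)) (U1 x) (A1 x) (W1 x)"
    "iterpoly_mat N n A1" "iterpoly_mat N n W1"
  proof (cases "i = n")
    case True
    have "has_blocks n (xgen n i t) (1\<^sub>m n) (t \<cdot>\<^sub>m wedge n (unit_vec n (n-2)) (unit_vec n (n-1))) (1\<^sub>m n)" for t
      using has_blocks_last[OF i(3), of t] by (simp only: True)
    then show ?thesis 
      using that[of "\<lambda>x. 1\<^sub>m n" "\<lambda>x. f x \<cdot>\<^sub>m wedge n (unit_vec n (n-2)) (unit_vec n (n-1))" "\<lambda>x. 1\<^sub>m n"]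
      by (simp add: iterpoly_mat_const iterpoly_mat_smult f)
  next
    case False
    then have "has_blocks n (xgen n i t) (elementary n i t) (0\<^sub>m n n) (elementary n i (- t))" for t
      using has_blocks_elem[of i n t] i by simp
    then show ?thesis 
      using that[of "\<lambda>x. elementary n i (f x)" "\<lambda>x. 0\<^sub>m n n" "\<lambda>x. elementary n i (- f x)"]
      by (simp add: iterpoly_mat_const iterpoly_mat_elem nf)
  qed
  have "has_blocks n (gprod n (map (\<lambda>(i,f). (i, f x)) (z # zs))) (U1 x * U x) (A x + W x * A1 x * transpose_mat (W x)) (W x * W1 x)" for x
    using has_blocks_mult[OF 1(1) IH(1)] by (simp add: z gprod_Cons)
  moreover have "iterpoly_mat N n (\<lambda>x. A x + W x * A1 x * transpose_mat (W x))" "iterpoly_mat N n (\<lambda>x. W x * W1 x)"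
    by (intro iterpoly_mat_add iterpoly_mat_mult iterpoly_mat_transpose IH 1)+
  ultimately show ?case
    by (intro exI[of _ "\<lambda>x. U1 x * U x"] exI[of _ "\<lambda>x. A x + W x * A1 x * transpose_mat (W x)"] exI[of _ "\<lambda>x. W x * W1 x"]) blast
qed

text \<open>Parameters are numbered from 1 and polynomial variables from 0, whence the shift
  \<open>k - 1\<close>.\<close>

lemma iterpoly_Amat:
  assumes "polyfun n f"
  shows "iterpoly (NN n) (\<lambda>x. f (Amat n (\<lambda>k. x (k-1))))"
proof -
  define zs :: "(nat \<times> ((nat \<Rightarrow> real) \<Rightarrow> real)) list" 
    where "zs = map (\<lambda>k. (word n ! (k-1), \<lambda>x. x (k-1))) [1..<NN n + 1]"
  have "\<exists>U A W. (\<forall>x. has_blocks n (gprod n (map (\<lambda>(i,f). (i, f x)) zs)) (U x) (A x) (W x)) \<and>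
    iterpoly_mat (NN n) n A \<and> iterpoly_mat (NN n) n W"
  proof (rule gprod_polynomial)
    fix i f assume "(i,f) \<in> set zs"
    then obtain k where k: "1 \<le> k" "k < NN n + 1" "i = word n ! (k-1)" "f = (\<lambda>x. x (k-1))"
      by (auto simp: zs_def)
    then have "i \<in> set (word n)" by (auto simp: length_word)
    then show "1 \<le> i \<and> i \<le> n \<and> 2 \<le> n \<and> iterpoly (NN n) f"
      using word_letters[of i n] k iterpoly_var[of "k-1" "NN n"] by auto
  qed
  then obtain U A W where sp: "\<And>x. has_blocks n (gprod n (map (\<lambda>(i,f). (i, f x)) zs)) (U x) (A x) (W x)"
    and A: "iterpoly_mat (NN n) n A" by blast
  have "map (\<lambda>(i,f). (i, f x)) zs = map (\<lambda>k. (word n ! (k-1), x (k-1))) [1..<NN n + 1]" for x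
    by (simp add: zs_def del: upt_Suc)
  then have "has_blocks n (xprod n (\<lambda>k. x (k-1))) (U x) (A x) (W x)" for x
    using sp[of x] by (simp add: xprod_eq del: upt_Suc)
  then have e: "Amat n (\<lambda>k. x (k-1)) = A x" for x
    by (rule has_blocks_Amat)
  show ?thesis
    unfolding e using assms
    by (induction) (use A in \<open>auto simp: iterpoly_const iterpoly_add iterpoly_mult iterpoly_mat_def\<close>)
qed

lemma skew_iff: "skew n A \<longleftrightarrow> A \<in> skew_sym n"
proof
  assume "skew n A"
  then have c: "A \<in> carrier_mat n n" and s: "\<And>i j. i < n \<Longrightarrow> j < n \<Longrightarrow> A $$ (i,j) = - A $$ (j,i)"
    unfolding skew_def by blast+
  have "transpose_mat A = - A"
  proof (rule eq_matI)
    fix i j assume "i < dim_row (- A)" "j < dim_col (- A)"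
    then have "i < n" "j < n" using c by auto
    then show "transpose_mat A $$ (i,j) = (- A) $$ (i,j)" using s[of j i] c by simp
  qed (use c in auto)
  then show "A \<in> skew_sym n" using c by (simp add: skew_sym_def)
next
  assume "A \<in> skew_sym n"
  then have c: "A \<in> carrier_mat n n" and t: "transpose_mat A = - A" by (auto simp: skew_sym_def)
  have "A $$ (i,j) = - A $$ (j,i)" if "i < n" "j < n" for i j
  proof -
    have "transpose_mat A $$ (j,i) = (- A) $$ (j,i)" by (simp only: t)
    then show ?thesis using that c by simp
  qed
  then show "skew n A" using c unfolding skew_def by blast
qed

lemma minors_all_iff:
  assumes "A \<in> carrier_mat n n"
  shows "minors_all P n A \<longleftrightarrow> (\<forall>j k. 1 \<le> j \<and> j \<le> k \<and> k \<le> n - 1 \<longrightarrow> P (Mjk n j k A))"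
  unfolding minors_all_def signed_minor_def using Mjk_eq[OF assms] by simp

text \<open>Among nonzero parameter vectors the minors detect the positive orthant, so a vector with
  a negative entry cannot share its matrix with a positive one.\<close>

lemma Amat_properties:
  assumes "\<forall>k\<in>{1..NN n}. t k \<noteq> 0"
  shows "skew n (Amat n t)"
    and "minors_all (\<lambda>x. x > 0) n (Amat n t) \<longleftrightarrow> (\<forall>k\<in>{1..NN n}. t k > 0)"
proof -
  define zs where "zs = map (\<lambda>k. (word n ! (k-1), t k)) [1..<NN n + 1]"
  have all: "(\<forall>z\<in>set zs. P (snd z)) \<longleftrightarrow> (\<forall>k\<in>{1..NN n}. P (t k))" for P
    by (auto simp: zs_def simp del: upt_Suc)
  have w: "map fst zs = word n" unfolding zs_def by (rule map_fst_word)
  have nz: "\<forall>z\<in>set zs. snd z \<noteq> 0" using all[of "\<lambda>x. x \<noteq> 0"] assms by blast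
  obtain U A W where sp: "has_blocks n (gprod n zs) U A W" and sk: "skew n A" and
    m: "\<And>P. P = (\<lambda>x. x > 0) \<or> P = (\<lambda>x. x \<noteq> 0) \<Longrightarrow> minors_all P n A \<longleftrightarrow> (\<forall>z\<in>set zs. P (snd z))"
    using factorization_forward[OF w nz] by blast
  have mi: "minors_all (\<lambda>x. x > 0) n A \<longleftrightarrow> (\<forall>z\<in>set zs. snd z > 0)" by (rule m) simp
  have A: "Amat n t = A" by (rule has_blocks_Amat) (use sp in \<open>simp only: xprod_eq zs_def\<close>)
  show "skew n (Amat n t)" using sk A by simp
  show "minors_all (\<lambda>x. x > 0) n (Amat n t) \<longleftrightarrow> (\<forall>k\<in>{1..NN n}. t k > 0)"
    using mi all[of "\<lambda>x. x > 0"] by (simp only: A)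
qed

text \<open>Nonvanishing minors already provide some nonzero parameter vector, and the sign
  criterion applied to it turns positive minors into positive parameters.\<close>

lemma totally_positive_iff:
  assumes "skew n A"
  shows "totally_positive n A \<longleftrightarrow> minors_all (\<lambda>x. x > 0) n A"
proof
  assume "totally_positive n A"
  then obtain t where t: "\<forall>k\<in>{1..NN n}. t k > 0" "A = Amat n t" by (auto simp: totally_positive_def)
  then show "minors_all (\<lambda>x. x > 0) n A" using Amat_properties(2)[of n t] by force
next
  assume m: "minors_all (\<lambda>x. x > 0) n A"
  then have "minors_all (\<lambda>x. x \<noteq> 0) n A" by (force simp: minors_all_def)
  then obtain zs U W where zs: "map fst zs = word n" "\<forall>z\<in>set zs. snd z \<noteq> 0" and sp: "has_blocks n (gprod n zs) U A W"
    using factorization_backward[OF assms] by blast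
  define t where "t k = snd (zs ! (k-1))" for k
  have len: "length zs = NN n" using zs(1) length_word by (metis length_map)
  have "zs = map (\<lambda>k. (word n ! (k-1), t k)) [1..<NN n + 1]"
    by (rule nth_equalityI) (simp_all add: len t_def prod_eq_iff flip: zs(1) del: upt_Suc)
  then have A: "Amat n t = A" using sp by (intro has_blocks_Amat) (simp only: xprod_eq)
  have "t k \<noteq> 0" if "k \<in> {1..NN n}" for k
    using zs(2) that len by (auto simp: t_def)
  then have "\<forall>k\<in>{1..NN n}. t k > 0" using Amat_properties(2)[of n t] m A by blast
  then show "totally_positive n A" using A by (auto simp: totally_positive_def)
qed

lemma card_index_pairs: "card {(j,k). 1 \<le> j \<and> j \<le> k \<and> k \<le> n - 1} = NN n"
proof -
  have "{(j,k). 1 \<le> j \<and> j \<le> k \<and> k \<le> n - 1} = prod.swap ` (SIGMA k:{1..n-1}. {1..k})"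
    by (auto simp: image_iff)
  then have "card {(j,k). 1 \<le> j \<and> j \<le> k \<and> k \<le> n - 1} = card (SIGMA k:{1..n-1}. {1..k})"
    by (simp add: card_image)
  also have "\<dots> = \<Sum>{1..n-1}" by simp
  also have "\<dots> = NN n"
    by (cases n) (simp_all add: NN_def choose_two Sum_Icc_nat mult.commute)
  finally show ?thesis .
qed

lemma no_shorter_description:
  assumes r: "r < NN n" and f: "\<forall>i<r. polyfun n (f i)"
    and desc: "\<forall>A\<in>skew_sym n. totally_positive n A \<longleftrightarrow> (\<forall>i<r. f i A > 0)"
  shows False
proof -
  let ?N = "NN n"
  define B where "B x = Amat n (\<lambda>k. x (k-1))" for x :: "nat \<Rightarrow> real"
  have ball: "(\<forall>k\<in>{1..?N}. P (x (k-1))) \<longleftrightarrow> (\<forall>k<?N. P (x k))" for P and x :: "nat \<Rightarrow> real"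
  proof -
    have "(\<forall>k<?N. P (x k)) \<Longrightarrow> (\<forall>k\<in>{1..?N}. P (x (k-1)))" by auto
    moreover have "(\<forall>k\<in>{1..?N}. P (x (k-1))) \<Longrightarrow> (\<forall>k<?N. P (x k))"
    proof (intro allI impI)
      fix k assume "\<forall>k\<in>{1..?N}. P (x (k-1))" "k < ?N"
      then show "P (x k)" by (elim ballE[of _ _ "Suc k"]) auto
    qed
    ultimately show ?thesis by blast
  qed
  have B: "B x \<in> skew_sym n" "totally_positive n (B x) \<longleftrightarrow> (\<forall>k<?N. x k > 0)" if "\<forall>k<?N. x k \<noteq> 0" for x
    using Amat_properties[of n "\<lambda>k. x (k-1)"] that ball[of "\<lambda>y. y \<noteq> 0" x] ball[of "\<lambda>y. y > 0" x]
      totally_positive_iff[of n "B x"] by (auto simp: B_def skew_iff)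
  have fB: "(\<forall>i<r. f i (B x) > 0) \<longleftrightarrow> (\<forall>k<?N. x k > 0)" if "\<forall>k<?N. x k \<noteq> 0" for x
    using desc B[OF that] by blast
  define Q where "Q i p \<longleftrightarrow> (\<forall>s. (\<forall>k. s k = 1 \<or> s k = -1) \<longrightarrow>
    nested_ev ?N (\<lambda>x. sgn (f i (B (\<lambda>k. s k * x k))) = fst p * (\<Prod>k<?N. s k ^ snd p k)))"
    for i and p :: "real \<times> (nat \<Rightarrow> nat)"
  have "\<exists>p. Q i p" if "i < r" for i
  proof -
    have "iterpoly ?N (\<lambda>x. f i (B x))" unfolding B_def using f that by (intro iterpoly_Amat) auto
    \<comment> \<open>The sign lemma needs a function that is not identically zero; all parameters
      equal to 1 give a totally positive matrix, where \<open>f i\<close> is positive.\<close>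
    moreover have "f i (B (\<lambda>_. 1)) > 0" using fB[of "\<lambda>_. 1"] that by auto
    then have "\<exists>x. f i (B x) \<noteq> 0" by (intro exI[of _ "\<lambda>_. 1"]) simp
    ultimately obtain \<sigma> e where "\<forall>s. (\<forall>k. s k = 1 \<or> s k = -1) \<longrightarrow>
        nested_ev ?N (\<lambda>x. sgn (f i (B (\<lambda>k. s k * x k))) = \<sigma> * (\<Prod>k<?N. s k ^ e k))"
      using iterpoly_sgn by blast
    then have "Q i (\<sigma>, e)" by (simp add: Q_def)
    then show ?thesis by blast
  qed
  then have "\<forall>i\<in>{..<r}. \<exists>p. Q i p" by simp
  then obtain p where p: "\<forall>i\<in>{..<r}. Q i (p i)" by (rule bchoice[THEN exE])
  define \<sigma> e where "\<sigma> i = fst (p i)" and "e i = snd (p i)" for i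
  have se: "nested_ev ?N (\<lambda>x. sgn (f i (B (\<lambda>k. s k * x k))) = \<sigma> i * (\<Prod>k<?N. s k ^ e i k))"
    if "i < r" "\<forall>k. s k = 1 \<or> s k = -1" for i s
    using p that unfolding Q_def \<sigma>_def e_def by blast
  have ex: "\<exists>x. (\<forall>k<?N. x k > 0) \<and> (\<forall>i<r. sgn (f i (B (\<lambda>k. s k * x k))) = \<sigma> i * (\<Prod>k<?N. s k ^ e i k))"
    if "\<forall>k. s k = 1 \<or> s k = -1" for s
    by (rule nested_ev_ex, rule nested_ev_conj[OF nested_ev_pos nested_ev_ball]) (rule se[OF _ that])
  \<comment> \<open>For the trivial sign vector the character is 1, and the sign of
    \<open>f i\<close> is known from the description.\<close>
  have \<sigma>: "\<sigma> i = 1" if "i < r" for i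
  proof -
    obtain x where x: "\<forall>k<?N. x k > 0" "\<forall>i<r. sgn (f i (B (\<lambda>k. 1 * x k))) = \<sigma> i * (\<Prod>k<?N. 1 ^ e i k)"
      using ex[of "\<lambda>_. 1"] by auto
    have "\<forall>k<?N. x k \<noteq> 0" using x(1) by force
    then have "f i (B x) > 0" using fB[of x] x(1) that by blast
    then show ?thesis using x(2) that by auto
  qed
  obtain C where C: "C \<subseteq> {..<?N}" "C \<noteq> {}"
    "\<And>i. i < r \<Longrightarrow> (\<Prod>k<?N. (if k \<in> C then -1 else 1 :: real) ^ e i k) = 1"
    using common_kernel_of_sign_characters[OF r] by blast
  \<comment> \<open>No \<open>f i\<close> can distinguish this sign vector from the trivial one near
    the corner, yet it is nontrivial because \<open>C\<close> is nonempty.\<close>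
  define s :: "nat \<Rightarrow> real" where "s k = (if k \<in> C then -1 else 1)" for k
  obtain x where x: "\<forall>k<?N. x k > 0" "\<forall>i<r. sgn (f i (B (\<lambda>k. s k * x k))) = \<sigma> i * (\<Prod>k<?N. s k ^ e i k)"
  proof -
    have "\<forall>k. s k = 1 \<or> s k = -1" by (simp add: s_def)
    from ex[OF this] that show thesis by blast
  qed
  have "f i (B (\<lambda>k. s k * x k)) > 0" if "i < r" for i
  proof -
    have "sgn (f i (B (\<lambda>k. s k * x k))) = 1"
      using x(2) C(3)[OF that] \<sigma>[OF that] that unfolding s_def by simp
    then show ?thesis by (simp add: sgn_1_pos)
  qed
  moreover have "\<forall>k<?N. s k * x k \<noteq> 0"
  proof (intro allI impI)
    fix k assume "k < ?N"
    then show "s k * x k \<noteq> 0" using x(1)[rule_format, of k] by (simp add: s_def)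
  qed
  ultimately have "\<forall>k<?N. s k * x k > 0" using fB[of "\<lambda>k. s k * x k"] by blast
  moreover obtain k where "k \<in> C" "k < ?N" using C(1,2) by blast
  ultimately show False using x(1) by (force simp: s_def)
qed

theorem theorem1p2:
  fixes n :: nat
  assumes "n \<ge> 2"
  shows "(\<forall>A \<in> skew_sym n.
            totally_positive n A \<longleftrightarrow>
            (\<forall>j k. 1 \<le> j \<and> j \<le> k \<and> k \<le> n - 1 \<longrightarrow> Mjk n j k A > 0))
       \<and> card {(j,k). 1 \<le> j \<and> j \<le> k \<and> k \<le> n - 1} = NN n
       \<and> \<not> (\<exists>r f. r < NN n \<and> (\<forall>i<r. polyfun n (f i)) \<and>
              (\<forall>A \<in> skew_sym n. totally_positive n A \<longleftrightarrow> (\<forall>i<r. f i A > 0)))"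
proof (intro conjI ballI)
  fix A assume A: "A \<in> skew_sym n"
  then have "A \<in> carrier_mat n n" by (simp add: skew_sym_def)
  from minors_all_iff[OF this] show "totally_positive n A \<longleftrightarrow>
      (\<forall>j k. 1 \<le> j \<and> j \<le> k \<and> k \<le> n - 1 \<longrightarrow> Mjk n j k A > 0)"
    using totally_positive_iff[of n A] A by (simp only: skew_iff)
next
  show "card {(j,k). 1 \<le> j \<and> j \<le> k \<and> k \<le> n - 1} = NN n" by (rule card_index_pairs)
next
  show "\<not> (\<exists>r f. r < NN n \<and> (\<forall>i<r. polyfun n (f i)) \<and>
      (\<forall>A \<in> skew_sym n. totally_positive n A \<longleftrightarrow> (\<forall>i<r. f i A > 0)))"
    using no_shorter_description by blast
qed

end
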